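(* Let $S = NA$ be the solvable Lie group with left-invariant Riemannian metric which realizes the symmetric space $SL(3,\mathbb{C})/SU(3)$. Let $\alpha\in[0,\frac{\pi}{2}]$, $H = \cos(\alpha)H_0+\sin(\alpha)H_1$, $S_H = N\exp(\mathbb{R}H)\subset S$ with the induced metric, and let the flow $\{\phi_H^s : S\to S\}_{s\in\mathbb{R}}$ be defined by $$\phi_H^s(q) := q\cdot\exp(sT_H),\qquad T_H = \sin(\alpha)H_0-\cos(\alpha)H_1 \perp T_eS_H.$$ Then $S$ admits a codimension one foliation with leaves $\{\phi_H^s(S_H)\}_{s\in\mathbb{R}}$. Moreover, the leaves of this foliation are pairwise equidistant and isometric to $S_H$. In the particular case $\alpha=0$, all leaves of this foliation are minimal and isometric to the Damek-Ricci space $S_{H_0}$, and $\phi_H^s$ is volume preserving both in $S$ and as a map between the leaves.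
   Context: Ambient space. $\mathfrak{n}$ is the real Lie algebra of strictly upper triangular complex $3\times 3$ matrices, $\mathfrak{a}$ the Lie algebra of real diagonal trace-zero $3\times 3$ matrices, $N, A \subset SL(3,\mathbb{C})$ the corresponding connected Lie groups, and $S = NA$, with Lie algebra $\mathfrak{s} = \mathfrak{n}\oplus\mathfrak{a} = T_eS$. By the Iwasawa decomposition $SL(3,\mathbb{C}) = NA\,SU(3)$, the map $S \to SL(3,\mathbb{C})/SU(3)$, $s \mapsto s\,SU(3)$, is a diffeomorphism. The symmetric metric on $SL(3,\mathbb{C})/SU(3)$ is the $SL(3,\mathbb{C})$-invariant one induced by the inner product $2\,\mathrm{Re}\,\mathrm{Tr}(X_1\bar X_2^\top)$ on $\mathfrak{p}=\{X\in\mathfrak{sl}(3,\mathbb{C}) : \bar X^\top = X\}$. Its pull-back to $S$ is the left-invariant metric given on $\mathfrak{s}$ by $$\langle Y_1 + A_1, Y_2 + A_2\rangle_{\mathfrak{s}} = \mathrm{Re}\,\mathrm{Tr}(Y_1\bar Y_2^\top) + 2\,\mathrm{Tr}(A_1A_2),\qquad Y_i\in\mathfrak{n},\ A_i\in\mathfrak{a}.$$ An orthonormal basis of $\mathfrak{a}$ is $H_0 = \mathrm{diag}(\tfrac12,0,-\tfrac12)$, $H_1 = \mathrm{diag}(\tfrac{1}{2\sqrt3},-\tfrac{1}{\sqrt3},\tfrac{1}{2\sqrt3})$. $S_H$ is a Lie subgroup with Lie algebra $T_eS_H = \mathfrak{n}\oplus\mathbb{R}H$. Conventions. All leaves carry the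 metric induced from $S$. Two leaves $L,L'$ are equidistant if the distance in $S$ from $p$ to $L'$ does not depend on $p\in L$, and likewise with the roles of $L$ and $L'$ exchanged. A hypersurface is minimal if its mean curvature (trace of the second fundamental form) vanishes. Volume preserving as a map between the leaves means that each $\phi_H^s:\phi_H^r(S_H)\to\phi_H^{r+s}(S_H)$ preserves the induced Riemannian volume. Damek-Ricci space. A Damek-Ricci space is a simply connected solvable Lie group with left-invariant metric whose metric Lie algebra is of the form $\mathfrak{v}\oplus\mathfrak{z}\oplus\mathbb{R}H_0$ (orthogonal direct sum), with $H_0$ a unit vector, $[\mathfrak{v},\mathfrak{v}]\subset\mathfrak{z}$, $[\mathfrak{v},\mathfrak{z}]=[\mathfrak{z},\mathfrak{z}]=\{0\}$; for each $Z\in\mathfrak{z}$ the map $J_Z\in\mathrm{End}(\mathfrak{v})$ defined by $\langle J_Z U_1,U_2\rangle = \langle Z,[U_1,U_2]\rangle$ for all $U_1,U_2\in\mathfrak{v}$ satisfies $J_Z^2 = -\|Z\|^2\,\mathrm{id}_{\mathfrak{v}}$; and $[H_0,U]=\tfrac12U$ for $U\in\mathfrak{v}$, $[H_0,Z]=Z$ for $Z\in\mathfrak{z}$. *)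

theory Defs
  imports "HOL-Analysis.Analysis" "HOL-Algebra.Solvable_Groups"
begin

section \<open>Submanifolds of Euclidean spaces\<close>

primrec Ck_on :: "nat \<Rightarrow> 'a::euclidean_space set \<Rightarrow> ('a \<Rightarrow> 'b::euclidean_space) \<Rightarrow> bool" where
  "Ck_on 0 U f \<longleftrightarrow> continuous_on U f"
| "Ck_on (Suc k) U f \<longleftrightarrow>
     (\<forall>x\<in>U. f differentiable (at x)) \<and>
     (\<forall>v. Ck_on k U (\<lambda>x. frechet_derivative f (at x) v))"

definition smooth_on_open :: "'a::euclidean_space set \<Rightarrow> ('a \<Rightarrow> 'b::euclidean_space) \<Rightarrow> bool" where
  "smooth_on_open U f \<longleftrightarrow> open U \<and> (\<forall>k. Ck_on k U f)"

text \<open>Smoothness on an arbitrary subset: local existence of smooth extensions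
  (Milnor, Guillemin--Pollack).\<close>

definition smooth_map :: "'a::euclidean_space set \<Rightarrow> ('a \<Rightarrow> 'b::euclidean_space) \<Rightarrow> bool" where
  "smooth_map A f \<longleftrightarrow>
     (\<forall>p\<in>A. \<exists>U F. p \<in> U \<and> smooth_on_open U F \<and> (\<forall>x\<in>A \<inter> U. F x = f x))"

definition diffeomorphism ::
  "'a::euclidean_space set \<Rightarrow> 'b::euclidean_space set \<Rightarrow> ('a \<Rightarrow> 'b) \<Rightarrow> bool" where
  "diffeomorphism A B f \<longleftrightarrow> bij_betw f A B \<and> smooth_map A f \<and> smooth_map B (inv_into A f)"

text \<open>Embedded \<open>k\<close>-dimensional submanifolds. The chart takes values in a \<open>k\<close>-dimensional linear
  subspace \<open>W\<close> of the ambient space, in the role of \<open>\<real>\<^sup>k\<close>; this keeps \<open>k\<close> a number rather than a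
  type.\<close>

definition submanifold :: "nat \<Rightarrow> 'a::euclidean_space set \<Rightarrow> bool" where
  "submanifold k M \<longleftrightarrow>
     (\<forall>p\<in>M. \<exists>U W V f. openin (top_of_set M) U \<and> p \<in> U \<and>
        subspace (W::'a set) \<and> dim W = k \<and> openin (top_of_set W) V \<and> diffeomorphism U V f)"

definition tangent_space :: "'a::euclidean_space set \<Rightarrow> 'a \<Rightarrow> 'a set" where
  "tangent_space M p =
     {v. \<exists>c \<epsilon>. 0 < \<epsilon> \<and> smooth_on_open {-\<epsilon><..<\<epsilon>} c \<and> c ` {-\<epsilon><..<\<epsilon>} \<subseteq> M \<and>
          c 0 = p \<and> (c has_vector_derivative v) (at (0::real))}"

text \<open>The derivative of \<open>f\<close> relative to \<open>M\<close> is not unique as a linear map on the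
  ambient space, but its values on \<^term>\<open>tangent_space M p\<close> are; it is only used there.\<close>

abbreviation differential ::
  "'a::euclidean_space set \<Rightarrow> ('a \<Rightarrow> 'b::euclidean_space) \<Rightarrow> 'a \<Rightarrow> 'a \<Rightarrow> 'b" where
  "differential M f p \<equiv> frechet_derivative f (at p within M)"

definition vector_field :: "'a::euclidean_space set \<Rightarrow> ('a \<Rightarrow> 'a) \<Rightarrow> bool" where
  "vector_field M X \<longleftrightarrow> smooth_map M X \<and> (\<forall>p\<in>M. X p \<in> tangent_space M p)"

definition lie_bracket ::
  "'a::euclidean_space set \<Rightarrow> ('a \<Rightarrow> 'a) \<Rightarrow> ('a \<Rightarrow> 'a) \<Rightarrow> 'a \<Rightarrow> 'a" where
  "lie_bracket M X Y p = differential M Y p (X p) - differential M X p (Y p)"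

text \<open>A codimension one foliation: a decomposition into connected leaves, and around each point a
  chart onto a product \<open>B \<times> I\<close> such that for each leaf \<open>L\<close> the connected components
  of \<open>L \<inter> U\<close> are slices \<open>B \<times> {c}\<close>.\<close>

definition codim_one_foliation :: "'a::euclidean_space set \<Rightarrow> 'a set set \<Rightarrow> bool" where
  "codim_one_foliation M F \<longleftrightarrow>
     (\<exists>n. submanifold (Suc n) M \<and> partition_on M F \<and> (\<forall>L\<in>F. connected L) \<and>
        (\<forall>p\<in>M. \<exists>U W B I \<psi>. openin (top_of_set M) U \<and> p \<in> U \<and>
           subspace (W::'a set) \<and> dim W = n \<and> openin (top_of_set W) B \<and> connected B \<and>
           open (I::real set) \<and> connected I \<and> diffeomorphism U (B \<times> I) \<psi> \<and>
           (\<forall>L\<in>F. \<forall>C\<in>components (L \<inter> U). \<exists>c\<in>I. C = {q\<in>U. snd (\<psi> q) = c})))"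


section \<open>Riemannian metrics\<close>

text \<open>\<open>g p u v\<close> is the product of \<open>u\<close> and \<open>v\<close>, tangent vectors at \<open>p\<close>; values for other
  arguments are irrelevant. The induced metric of a submanifold is thus given by the same \<open>g\<close>.\<close>

type_synonym 'a metric_tensor = "'a \<Rightarrow> 'a \<Rightarrow> 'a \<Rightarrow> real"

text \<open>Requiring the speed to have an integral matters:
  \<^const>\<open>piecewise_C1_differentiable_on\<close> does not bound the velocity near the exceptional points,
  and the integral operator is \<open>0\<close> on non-integrable functions.\<close>

definition riem_dist :: "'a::euclidean_space set \<Rightarrow> 'a metric_tensor \<Rightarrow> 'a \<Rightarrow> 'a \<Rightarrow> real" where
  "riem_dist M g p q =
     Inf {l. \<exists>\<gamma>. \<gamma> piecewise_C1_differentiable_on {0..1} \<and> path_image \<gamma> \<subseteq> M \<and>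
              pathstart \<gamma> = p \<and> pathfinish \<gamma> = q \<and>
              ((\<lambda>t. let v = vector_derivative \<gamma> (at t) in sqrt (g (\<gamma> t) v v))
                 has_integral l) {0..1}}"

definition riem_dist_set ::
  "'a::euclidean_space set \<Rightarrow> 'a metric_tensor \<Rightarrow> 'a \<Rightarrow> 'a set \<Rightarrow> real" where
  "riem_dist_set M g p L = (INF q\<in>L. riem_dist M g p q)"

definition equidistant ::
  "'a::euclidean_space set \<Rightarrow> 'a metric_tensor \<Rightarrow> 'a set \<Rightarrow> 'a set \<Rightarrow> bool" where
  "equidistant M g L L' \<longleftrightarrow>
     (\<forall>p\<in>L. \<forall>q\<in>L. riem_dist_set M g p L' = riem_dist_set M g q L') \<and>
     (\<forall>p\<in>L'. \<forall>q\<in>L'. riem_dist_set M g p L = riem_dist_set M g q L)"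

definition riem_isometric ::
  "'a::euclidean_space set \<Rightarrow> 'a metric_tensor \<Rightarrow>
   'b::euclidean_space set \<Rightarrow> 'b metric_tensor \<Rightarrow> bool" where
  "riem_isometric M g M' g' \<longleftrightarrow>
     (\<exists>f. diffeomorphism M M' f \<and>
        (\<forall>p\<in>M. \<forall>u\<in>tangent_space M p. \<forall>v\<in>tangent_space M p.
           g' (f p) (differential M f p u) (differential M f p v) = g p u v))"


subsection \<open>Levi-Civita connection and mean curvature\<close>

definition koszul :: "'a::euclidean_space set \<Rightarrow> 'a metric_tensor \<Rightarrow>
    ('a \<Rightarrow> 'a) \<Rightarrow> ('a \<Rightarrow> 'a) \<Rightarrow> ('a \<Rightarrow> 'a) \<Rightarrow> 'a \<Rightarrow> real" where
  "koszul M g X Y Z p =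
     (differential M (\<lambda>q. g q (Y q) (Z q)) p (X p)
      + differential M (\<lambda>q. g q (X q) (Z q)) p (Y p)
      - differential M (\<lambda>q. g q (X q) (Y q)) p (Z p)
      + g p (lie_bracket M X Y p) (Z p)
      - g p (lie_bracket M X Z p) (Y p)
      - g p (lie_bracket M Y Z p) (X p)) / 2"

text \<open>\<open>(\<nabla>\<^sub>X Y)(p)\<close>, determined by the Koszul formula.\<close>

definition levi_civita :: "'a::euclidean_space set \<Rightarrow> 'a metric_tensor \<Rightarrow>
    ('a \<Rightarrow> 'a) \<Rightarrow> ('a \<Rightarrow> 'a) \<Rightarrow> 'a \<Rightarrow> 'a" where
  "levi_civita M g X Y p =
     (THE w. w \<in> tangent_space M p \<and>
        (\<forall>Z. vector_field M Z \<longrightarrow> g p w (Z p) = koszul M g X Y Z p))"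

definition normal_space ::
  "'a::euclidean_space set \<Rightarrow> 'a metric_tensor \<Rightarrow> 'a set \<Rightarrow> 'a \<Rightarrow> 'a set" where
  "normal_space M g L p = {w \<in> tangent_space M p. \<forall>v\<in>tangent_space L p. g p w v = 0}"

text \<open>The normal part of \<open>\<nabla>\<^sub>X Y\<close> at \<open>p\<close>, for local extensions \<open>X\<close>, \<open>Y\<close> of \<open>u\<close>, \<open>v\<close> which are
  tangent to \<open>L\<close> along \<open>L\<close>; it does not depend on the extensions.\<close>

definition second_fundamental_form :: "'a::euclidean_space set \<Rightarrow> 'a metric_tensor \<Rightarrow>
    'a set \<Rightarrow> 'a \<Rightarrow> 'a \<Rightarrow> 'a \<Rightarrow> 'a" where
  "second_fundamental_form M g L p u v =
     (THE w. w \<in> normal_space M g L p \<and>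
        (\<exists>U X Y. open U \<and> p \<in> U \<and>
           vector_field (M \<inter> U) X \<and> vector_field (M \<inter> U) Y \<and>
           (\<forall>q\<in>L \<inter> U. X q \<in> tangent_space L q \<and> Y q \<in> tangent_space L q) \<and>
           X p = u \<and> Y p = v \<and>
           levi_civita (M \<inter> U) g X Y p - w \<in> tangent_space L p))"

definition orthonormal_basis :: "'a::real_vector set \<Rightarrow> ('a \<Rightarrow> 'a \<Rightarrow> real) \<Rightarrow> 'a set \<Rightarrow> bool" where
  "orthonormal_basis V b B \<longleftrightarrow>
     finite B \<and> span B = V \<and> (\<forall>e\<in>B. \<forall>f\<in>B. b e f = (if e = f then 1 else 0))"

definition mean_curvature ::
  "'a::euclidean_space set \<Rightarrow> 'a metric_tensor \<Rightarrow> 'a set \<Rightarrow> 'a \<Rightarrow> 'a" where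
  "mean_curvature M g L p =
     (\<Sum>e\<in>(SOME B. orthonormal_basis (tangent_space L p) (g p) B).
        second_fundamental_form M g L p e e)"

definition minimal_hypersurface ::
  "'a::euclidean_space set \<Rightarrow> 'a metric_tensor \<Rightarrow> 'a set \<Rightarrow> bool" where
  "minimal_hypersurface M g L \<longleftrightarrow>
     L \<subseteq> M \<and> (\<exists>n. submanifold (Suc n) M \<and> submanifold n L) \<and>
     (\<forall>p\<in>L. mean_curvature M g L p = 0)"


subsection \<open>Riemannian volume\<close>

text \<open>Here local coordinates have to range over a space carrying Lebesgue measure, so the dimension
  is the cardinality of an index type \<open>'n\<close>.\<close>

definition local_parametrization ::
  "'a::euclidean_space set \<Rightarrow> (real ^ 'n) set \<Rightarrow> (real ^ 'n \<Rightarrow> 'a) \<Rightarrow> bool" where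
  "local_parametrization M V \<psi> \<longleftrightarrow>
     open V \<and> openin (top_of_set M) (\<psi> ` V) \<and> diffeomorphism V (\<psi> ` V) \<psi>"

definition gram_matrix ::
  "'a::euclidean_space metric_tensor \<Rightarrow> (real ^ 'n \<Rightarrow> 'a) \<Rightarrow> real ^ 'n \<Rightarrow> real ^ 'n ^ 'n" where
  "gram_matrix g \<psi> x =
     (\<chi> i j. g (\<psi> x) (frechet_derivative \<psi> (at x) (axis i 1)) (frechet_derivative \<psi> (at x) (axis j 1)))"

text \<open>The volume of a Borel subset \<open>A\<close> of \<open>M\<close>, where \<open>M\<close> has dimension \<open>CARD('n)\<close>: the supremum of
  \<open>\<Sum>\<^sub>i \<integral>\<^bsub>B\<^sub>i\<^esub> sqrt (det G\<^sub>i) dx\<close> over finite families of disjoint Borel pieces \<open>\<psi>\<^sub>i(B\<^sub>i)\<close> of \<open>A\<close>, each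
  lying in one chart, with \<open>G\<^sub>i\<close> the metric coefficients in that chart. (As \<open>M\<close> is covered by
  countably many charts, this is the usual Riemannian measure.)\<close>

definition riem_volume ::
  "'n::finite itself \<Rightarrow> 'a::euclidean_space set \<Rightarrow> 'a metric_tensor \<Rightarrow> 'a set \<Rightarrow> ennreal" where
  "riem_volume (_ :: 'n itself) M g A =
     Sup {(\<Sum>i<k. \<integral>\<^sup>+x\<in>B i. ennreal (sqrt (det (gram_matrix g (\<psi> i) x))) \<partial>lborel)
          | (k::nat) V B (\<psi> :: nat \<Rightarrow> real ^ 'n \<Rightarrow> 'a).
            (\<forall>i<k. local_parametrization M (V i) (\<psi> i) \<and>
                   B i \<in> sets borel \<and> B i \<subseteq> V i \<and> \<psi> i ` B i \<subseteq> A) \<and>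
            disjoint_family_on (\<lambda>i. \<psi> i ` B i) {..<k}}"

definition volume_preserving ::
  "'n::finite itself \<Rightarrow> 'a::euclidean_space set \<Rightarrow> 'a metric_tensor \<Rightarrow>
   'b::euclidean_space set \<Rightarrow> 'b metric_tensor \<Rightarrow> ('a \<Rightarrow> 'b) \<Rightarrow> bool" where
  "volume_preserving n M g M' g' f \<longleftrightarrow>
     diffeomorphism M M' f \<and>
     (\<forall>A\<in>sets borel. A \<subseteq> M \<longrightarrow> riem_volume n M' g' (f ` A) = riem_volume n M g A)"


section \<open>Matrix Lie groups\<close>

definition GL_group :: "(complex ^ 'n ^ 'n) monoid" where
  "GL_group = \<lparr>carrier = {X. invertible X}, mult = (**), one = mat 1\<rparr>"

definition commutator :: "complex ^ 'n ^ 'n \<Rightarrow> complex ^ 'n ^ 'n \<Rightarrow> complex ^ 'n ^ 'n" where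
  "commutator X Y = X ** Y - Y ** X"

definition mat_exp :: "complex ^ 'n ^ 'n \<Rightarrow> complex ^ 'n ^ 'n" where
  "mat_exp X = (\<Sum>k. (1 / fact k) *\<^sub>R ((**) X ^^ k) (mat 1))"

text \<open>The connected Lie subgroup with a given Lie algebra.\<close>

definition connected_lie_subgroup :: "(complex ^ 'n ^ 'n) set \<Rightarrow> (complex ^ 'n ^ 'n) set" where
  "connected_lie_subgroup \<hh> = generate GL_group (mat_exp ` \<hh>)"

definition inner_product_on :: "'a::real_vector set \<Rightarrow> ('a \<Rightarrow> 'a \<Rightarrow> real) \<Rightarrow> bool" where
  "inner_product_on V b \<longleftrightarrow>
     (\<forall>u\<in>V. \<forall>v\<in>V. b u v = b v u) \<and>
     (\<forall>u\<in>V. \<forall>v\<in>V. \<forall>w\<in>V. b (u + v) w = b u w + b v w) \<and>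
     (\<forall>u\<in>V. \<forall>v\<in>V. \<forall>c. b (c *\<^sub>R u) v = c * b u v) \<and>
     (\<forall>u\<in>V. u \<noteq> 0 \<longrightarrow> b u u > 0)"

definition left_invariant_on ::
  "(complex ^ 'n ^ 'n) set \<Rightarrow> (complex ^ 'n ^ 'n) metric_tensor \<Rightarrow> bool" where
  "left_invariant_on G g \<longleftrightarrow>
     inner_product_on (tangent_space G (mat 1)) (g (mat 1)) \<and>
     (\<forall>a\<in>G. \<forall>p\<in>G. \<forall>u\<in>tangent_space G p. \<forall>v\<in>tangent_space G p.
        g (a ** p) (a ** u) (a ** v) = g p u v)"

definition damek_ricci_space ::
  "(complex ^ 'n ^ 'n) set \<Rightarrow> (complex ^ 'n ^ 'n) metric_tensor \<Rightarrow> bool" where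
  "damek_ricci_space G g \<longleftrightarrow>
     subgroup G GL_group \<and> (\<exists>d. submanifold d G) \<and> simply_connected G \<and>
     solvable (GL_group\<lparr>carrier := G\<rparr>) \<and> left_invariant_on G g \<and>
     (let ip = g (mat 1) in
      \<exists>\<vv> \<zz> H.
        subspace \<vv> \<and> subspace \<zz> \<and>
        tangent_space G (mat 1) = {U + Z + t *\<^sub>R H | U Z t. U \<in> \<vv> \<and> Z \<in> \<zz>} \<and>
        (\<forall>U\<in>\<vv>. \<forall>Z\<in>\<zz>. ip U Z = 0) \<and> (\<forall>U\<in>\<vv>. ip U H = 0) \<and> (\<forall>Z\<in>\<zz>. ip Z H = 0) \<and>
        ip H H = 1 \<and>
        (\<forall>U\<^sub>1\<in>\<vv>. \<forall>U\<^sub>2\<in>\<vv>. commutator U\<^sub>1 U\<^sub>2 \<in> \<zz>) \<and>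
        (\<forall>U\<in>\<vv>. \<forall>Z\<in>\<zz>. commutator U Z = 0) \<and>
        (\<forall>Z\<^sub>1\<in>\<zz>. \<forall>Z\<^sub>2\<in>\<zz>. commutator Z\<^sub>1 Z\<^sub>2 = 0) \<and>
        (\<forall>Z\<in>\<zz>. \<exists>J. linear J \<and> J ` \<vv> \<subseteq> \<vv> \<and>
           (\<forall>U\<^sub>1\<in>\<vv>. \<forall>U\<^sub>2\<in>\<vv>. ip (J U\<^sub>1) U\<^sub>2 = ip Z (commutator U\<^sub>1 U\<^sub>2)) \<and>
           (\<forall>U\<in>\<vv>. J (J U) = - (ip Z Z) *\<^sub>R U)) \<and>
        (\<forall>U\<in>\<vv>. commutator H U = (1/2) *\<^sub>R U) \<and>
        (\<forall>Z\<in>\<zz>. commutator H Z = Z))"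


section \<open>The solvable group \<open>S = N A\<close>\<close>

text \<open>The entries are written out, as the order on the index type \<open>3\<close> is not \<open>1 < 2 < 3\<close>
  (there \<open>3 = 0\<close>).\<close>

definition \<nn> :: "(complex ^ 3 ^ 3) set" where
  "\<nn> = {vector [vector [0, x, z], vector [0, 0, y], vector [0, 0, 0]] | x y z. True}"

definition diag3 :: "real \<Rightarrow> real \<Rightarrow> real \<Rightarrow> complex ^ 3 ^ 3" where
  "diag3 a b c =
     vector [vector [of_real a, 0, 0], vector [0, of_real b, 0], vector [0, 0, of_real c]]"

definition \<aa> :: "(complex ^ 3 ^ 3) set" where
  "\<aa> = {diag3 a b c | a b c. a + b + c = 0}"

definition group_N :: "(complex ^ 3 ^ 3) set" where
  "group_N = connected_lie_subgroup \<nn>"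

definition group_A :: "(complex ^ 3 ^ 3) set" where
  "group_A = connected_lie_subgroup \<aa>"

definition group_S :: "(complex ^ 3 ^ 3) set" where
  "group_S = {n ** a | n a. n \<in> group_N \<and> a \<in> group_A}"

definition conjugate_transpose :: "complex ^ 'n ^ 'n \<Rightarrow> complex ^ 'n ^ 'n" where
  "conjugate_transpose X = (\<chi> i j. cnj (X $ j $ i))"

definition diagonal_part :: "complex ^ 'n ^ 'n \<Rightarrow> complex ^ 'n ^ 'n" where
  "diagonal_part X = (\<chi> i j. if i = j then X $ i $ j else 0)"

definition off_diagonal_part :: "complex ^ 'n ^ 'n \<Rightarrow> complex ^ 'n ^ 'n" where
  "off_diagonal_part X = (\<chi> i j. if i = j then 0 else X $ i $ j)"

text \<open>On \<open>\<ss> = \<nn> \<oplus> \<aa>\<close> the off-diagonal and the diagonal part are the \<open>\<nn>\<close>- and the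
  \<open>\<aa>\<close>-component.\<close>

definition inner_s :: "complex ^ 3 ^ 3 \<Rightarrow> complex ^ 3 ^ 3 \<Rightarrow> real" where
  "inner_s X\<^sub>1 X\<^sub>2 =
     Re (trace (off_diagonal_part X\<^sub>1 ** conjugate_transpose (off_diagonal_part X\<^sub>2)))
     + 2 * Re (trace (diagonal_part X\<^sub>1 ** diagonal_part X\<^sub>2))"

definition metric_S :: "(complex ^ 3 ^ 3) metric_tensor" where
  "metric_S p U V = inner_s (matrix_inv p ** U) (matrix_inv p ** V)"

text \<open>The differential at \<open>e\<close> of \<open>s \<mapsto> s SU(3)\<close>, followed by the identification of
  \<open>\<ss>\<ll>(3,\<complex>) / \<ss>\<uu>(3)\<close> with the Hermitian matrices \<open>\<pp>\<close>, is \<open>X \<mapsto> (X + X\<^sup>*) / 2\<close>. So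
  \<^const>\<open>metric_S\<close> is the pull-back of the symmetric metric given by
  \<open>2 Re Tr (X\<^sub>1 X\<^sub>2\<^sup>*)\<close> on \<open>\<pp>\<close>.\<close>

lemma inner_s_eq_pullback:
  fixes X\<^sub>1 X\<^sub>2 :: "complex ^ 3 ^ 3"
  defines "herm \<equiv> (\<lambda>X :: complex ^ 3 ^ 3. (1/2) *\<^sub>R (X + conjugate_transpose X))"
  assumes "X\<^sub>1 \<in> {Y + D | Y D. Y \<in> \<nn> \<and> D \<in> \<aa>}" "X\<^sub>2 \<in> {Y + D | Y D. Y \<in> \<nn> \<and> D \<in> \<aa>}"
  shows "inner_s X\<^sub>1 X\<^sub>2 = 2 * Re (trace (herm X\<^sub>1 ** conjugate_transpose (herm X\<^sub>2)))"
  using assms(2,3)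
  by (auto simp: \<nn>_def \<aa>_def diag3_def inner_s_def herm_def trace_def conjugate_transpose_def
      diagonal_part_def off_diagonal_part_def matrix_matrix_mult_def sum_3 vector_3 field_simps)

definition H\<^sub>0 :: "complex ^ 3 ^ 3" where
  "H\<^sub>0 = diag3 (1/2) 0 (-1/2)"

definition H\<^sub>1 :: "complex ^ 3 ^ 3" where
  "H\<^sub>1 = diag3 (1 / (2 * sqrt 3)) (-1 / sqrt 3) (1 / (2 * sqrt 3))"

definition S_H :: "complex ^ 3 ^ 3 \<Rightarrow> (complex ^ 3 ^ 3) set" where
  "S_H H = {n ** mat_exp (t *\<^sub>R H) | n t. n \<in> group_N}"

definition flow :: "complex ^ 3 ^ 3 \<Rightarrow> real \<Rightarrow> complex ^ 3 ^ 3 \<Rightarrow> complex ^ 3 ^ 3" where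
  "flow T s q = q ** mat_exp (s *\<^sub>R T)"

end

theory Submission
  imports Defs
begin

text \<open>Taking logarithms of the diagonal entries identifies \<open>S\<close> with the linear space \<open>\<ss>\<close>. The
  subspaces \<open>W\<close> with \<open>\<nn> \<subseteq> W \<subseteq> \<ss>\<close> correspond to normal subgroups \<open>G\<close> of \<open>S\<close>, and for \<open>W = T\<^sup>\<bottom>\<close> the
  leaves are the cosets \<open>exp(sT) G = G exp(sT)\<close>. Hence left translations, which are isometries of \<open>S\<close>,
  map leaves to leaves, and those by elements of \<open>G\<close> preserve each leaf and act transitively on it:
  this gives equidistance and the isometries. In the left-invariant frame the second fundamental form
  of a leaf is \<open>\<langle>ad T \<xi>, \<eta>\<rangle>\<close>, symmetrized, and right translation by \<open>exp(sT)\<close> becomes \<open>Ad(exp(-sT))\<close>.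
  Both are diagonal in the standard basis of \<open>\<nn>\<close>, and for \<open>\<alpha> = 0\<close> the roots cancel, so the trace of the
  former is \<open>0\<close> and the determinant of the latter is \<open>1\<close>.\<close>

section \<open>Calculus of smooth maps and tangent spaces\<close>

text \<open>The notions of the statement are extrinsic: tangent vectors are velocities of curves in
  a matrix space, \<open>differential\<close> is a derivative relative to a subset, unique only on
  tangent vectors, and \<open>levi_civita\<close> and \<open>second_fundamental_form\<close> are
  definite descriptions quantified over all local fields. Left-invariant fields alone therefore do
  not suffice. Every field is written as X(q) = q \<xi>(q) with \<xi> valued in the fixed linear
  space \<ss>; tangency to a leaf becomes membership in a subspace, which derivatives of \<xi> along
  the leaf do not leave, and so they drop out of the normal component. The chart exponentiates the
  diagonal only, since a logarithm of the full matrix exponential would be harder to handle; to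
  first order at 0 both agree on \<ss>. The condition \<alpha> = 0 acts on minimality and volume
  through t1 = t3: the roots t1 - t2, t2 - t3 and t1 - t3 have real multiplicity two, so the trace
  of ad T is 4 (t1 - t3).\<close>

lemma Ck_on_cong:
  assumes "open U" "\<And>x. x \<in> U \<Longrightarrow> f x = g x" "Ck_on k U f"
  shows "Ck_on k U g"
  using assms(2,3)
proof (induction k arbitrary: f g)
  case 0
  then show ?case by (simp cong: continuous_on_cong)
next
  case (Suc k)
  have D: "(g has_derivative frechet_derivative f (at x)) (at x)" if "x \<in> U" for x
  proof (rule has_derivative_transform_within_open)
    show "(f has_derivative frechet_derivative f (at x)) (at x)"
      using Suc.prems(2) that by (simp add: frechet_derivative_works)
  qed (use assms(1) that Suc.prems(1) in auto)
  then have eq: "frechet_derivative f (at x) = frechet_derivative g (at x)" if "x \<in> U" for x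
    using that by (metis frechet_derivative_at)
  have "Ck_on k U (\<lambda>x. frechet_derivative g (at x) v)" for v
  proof (rule Suc.IH)
    show "Ck_on k U (\<lambda>x. frechet_derivative f (at x) v)" using Suc.prems(2) by simp
  qed (simp add: eq)
  then show ?case using D by (auto intro: differentiableI)
qed

text \<open>\<open>Ck_on\<close> refers to the operator \<open>frechet_derivative\<close>; by
  uniqueness of the derivative, any explicit formula may take its place.\<close>

lemma Ck_on_SucI:
  assumes "open U" "\<And>x. x \<in> U \<Longrightarrow> (f has_derivative f' x) (at x)" "\<And>v. Ck_on k U (\<lambda>x. f' x v)"
  shows "Ck_on (Suc k) U f"
proof -
  have "f' x = frechet_derivative f (at x)" if "x \<in> U" for x
    using assms(2)[OF that] by (metis frechet_derivative_at)
  then have "Ck_on k U (\<lambda>x. frechet_derivative f (at x) v)" for v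
    by (intro Ck_on_cong[OF assms(1) _ assms(3)[of v]]) simp
  then show ?thesis using assms(2) by (auto intro: differentiableI)
qed

lemma Ck_on_subset: "Ck_on k U f \<Longrightarrow> V \<subseteq> U \<Longrightarrow> Ck_on k V f"
  by (induction k arbitrary: f) (auto intro: continuous_on_subset)

lemma Ck_on_SucD: "Ck_on (Suc k) U f \<Longrightarrow> Ck_on k U f"
proof (induction k arbitrary: f)
  case 0
  then show ?case
    by (auto intro!: continuous_at_imp_continuous_on simp: differentiable_imp_continuous_within)
next
  case (Suc k)
  then show ?case by (metis Ck_on.simps(2))
qed

lemma Ck_on_has_derivative:
  "Ck_on (Suc k) U f \<Longrightarrow> x \<in> U \<Longrightarrow> (f has_derivative frechet_derivative f (at x)) (at x)"
  by (simp add: frechet_derivative_works)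

lemma Ck_on_partial: "Ck_on (Suc k) U f \<Longrightarrow> Ck_on k U (\<lambda>x. frechet_derivative f (at x) v)"
  by simp

lemma Ck_on_linear:
  assumes "open U" "bounded_linear L" "Ck_on k U f"
  shows "Ck_on k U (\<lambda>x. L (f x))"
  using assms(3)
proof (induction k arbitrary: f)
  case 0
  then show ?case using bounded_linear.continuous_on[OF assms(2)] by simp
next
  case (Suc k)
  show ?case
    by (rule Ck_on_SucI[OF assms(1)
          bounded_linear.has_derivative[OF assms(2) Ck_on_has_derivative[OF Suc.prems]]])
      (auto intro: Suc.IH[OF Ck_on_partial[OF Suc.prems]])
qed

lemma Ck_on_add:
  assumes "open U" "Ck_on k U f" "Ck_on k U g"
  shows "Ck_on k U (\<lambda>x. f x + g x)"
  using assms(2,3)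
proof (induction k arbitrary: f g)
  case 0
  then show ?case by (simp add: continuous_on_add)
next
  case (Suc k)
  show ?case
    by (rule Ck_on_SucI[OF assms(1) has_derivative_add[OF Ck_on_has_derivative[OF Suc.prems(1)]
            Ck_on_has_derivative[OF Suc.prems(2)]]])
      (auto intro: Suc.IH[OF Ck_on_partial[OF Suc.prems(1)] Ck_on_partial[OF Suc.prems(2)]])
qed

lemma Ck_on_const: "open U \<Longrightarrow> Ck_on k U (\<lambda>x. c)"
  by (induction k arbitrary: c) (auto intro!: Ck_on_SucI)

lemma Ck_on_id: "open U \<Longrightarrow> Ck_on k U (\<lambda>x. x)"
  by (cases k) (auto intro!: Ck_on_SucI Ck_on_const)

lemma Ck_on_sum:
  assumes "open U" "\<And>i. i \<in> I \<Longrightarrow> Ck_on k U (f i)"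
  shows "Ck_on k U (\<lambda>x. \<Sum>i\<in>I. f i x)"
  using assms(2)
  by (induction I rule: infinite_finite_induct) (auto intro: Ck_on_add Ck_on_const assms(1))

text \<open>By the product rule the derivative is a sum of two terms of the same bilinear shape,
  each pairing one function with a derivative of the other, so the induction closes.\<close>

lemma Ck_on_bilinear:
  assumes "open U" "bounded_bilinear b" "Ck_on k U f" "Ck_on k U g"
  shows "Ck_on k U (\<lambda>x. b (f x) (g x))"
  using assms(3,4)
proof (induction k arbitrary: f g)
  case 0
  then show ?case using bounded_bilinear.continuous_on[OF assms(2)] by simp
next
  case (Suc k)
  show ?case
  proof (rule Ck_on_SucI[OF assms(1) bounded_bilinear.FDERIV[OF assms(2)
          Ck_on_has_derivative[OF Suc.prems(1)] Ck_on_has_derivative[OF Suc.prems(2)]]])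
    fix v
    show "Ck_on k U (\<lambda>x. b (f x) (frechet_derivative g (at x) v) + b (frechet_derivative f (at x) v) (g x))"
      by (intro Ck_on_add Suc.IH assms(1) Ck_on_partial Ck_on_SucD[OF Suc.prems(1)]
          Ck_on_SucD[OF Suc.prems(2)] Suc.prems)
  qed
qed

text \<open>Expanding \<open>D f x v\<close> in a basis, the chain rule writes each directional derivative of
  \<open>g \<circ> f\<close> as a sum of products to which the induction hypothesis applies.\<close>

lemma Ck_on_compose:
  fixes f :: "'a::euclidean_space \<Rightarrow> 'b::euclidean_space" and g :: "'b \<Rightarrow> 'c::euclidean_space"
  assumes "open U" "open V" "f ` U \<subseteq> V" "Ck_on k U f" "Ck_on k V g"
  shows "Ck_on k U (\<lambda>x. g (f x))"
  using assms(4,5)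
proof (induction k arbitrary: g)
  case 0
  then show ?case using assms(3) by (auto intro: continuous_on_compose2)
next
  case (Suc k)
  let ?D = "\<lambda>x v. frechet_derivative g (at (f x)) (frechet_derivative f (at x) v)"
  have Df: "(f has_derivative frechet_derivative f (at x)) (at x)" if "x \<in> U" for x
    using Ck_on_has_derivative[OF Suc.prems(1) that] .
  have Dg: "(g has_derivative frechet_derivative g (at (f x))) (at (f x))" if "x \<in> U" for x
    using Ck_on_has_derivative[OF Suc.prems(2)] that assms(3) by blast
  have expand: "?D x v =
      (\<Sum>i\<in>Basis. (frechet_derivative f (at x) v \<bullet> i) *\<^sub>R frechet_derivative g (at (f x)) i)"
    if "x \<in> U" for x v
  proof -
    have "linear (frechet_derivative g (at (f x)))"
      using Dg[OF that] has_derivative_linear by blast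
    then show ?thesis
      by (subst (1) euclidean_representation[of "frechet_derivative f (at x) v", symmetric])
        (simp add: linear_sum linear_scale)
  qed
  show ?case
  proof (rule Ck_on_SucI[OF assms(1)])
    show "((\<lambda>x. g (f x)) has_derivative ?D x) (at x)" if "x \<in> U" for x
      using has_derivative_compose[OF Df[OF that] Dg[OF that]] .
    fix v
    have "Ck_on k U (\<lambda>x. (frechet_derivative f (at x) v \<bullet> i) *\<^sub>R frechet_derivative g (at (f x)) i)" for i
    proof (rule Ck_on_bilinear[OF assms(1) bounded_bilinear_scaleR])
      show "Ck_on k U (\<lambda>x. frechet_derivative f (at x) v \<bullet> i)"
        using Suc.prems(1) by (intro Ck_on_linear[OF assms(1) bounded_linear_inner_left]) simp
      show "Ck_on k U (\<lambda>x. frechet_derivative g (at (f x)) i)"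
        by (intro Suc.IH[of "\<lambda>y. frechet_derivative g (at y) i"] Ck_on_partial
            Ck_on_SucD[OF Suc.prems(1)] Suc.prems(2))
    qed
    then have sums: "Ck_on k U (\<lambda>x. \<Sum>i\<in>Basis.
        (frechet_derivative f (at x) v \<bullet> i) *\<^sub>R frechet_derivative g (at (f x)) i)"
      by (rule Ck_on_sum[OF assms(1)])
    show "Ck_on k U (\<lambda>x. ?D x v)"
      by (rule Ck_on_cong[OF assms(1) _ sums]) (simp only: expand)
  qed
qed

lemma Ck_on_exp: "Ck_on k UNIV (exp :: real \<Rightarrow> real)"
proof (induction k)
  case (Suc k)
  show ?case
  proof (rule Ck_on_SucI)
    show "(exp has_derivative (\<lambda>v. v * exp x)) (at x)" for x :: real
      by (auto intro!: derivative_eq_intros)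
    show "Ck_on k UNIV (\<lambda>x. v * exp x)" for v :: real
      using Ck_on_linear[OF _ bounded_linear_mult_right Suc] by simp
  qed simp
qed (auto intro!: continuous_intros)

text \<open>The derivative - v / x^2 is again built from \<open>inverse\<close> by products, so
  differentiation stays within the same class.\<close>

lemma Ck_on_inverse: "Ck_on k {0<..} (inverse :: real \<Rightarrow> real)"
proof (induction k)
  case (Suc k)
  show ?case
  proof (rule Ck_on_SucI)
    show "(inverse has_derivative (\<lambda>v. - v * (inverse x * inverse x))) (at x)"
      if "x \<in> {0<..}" for x :: real
      using that by (auto intro!: derivative_eq_intros simp: field_simps)
    show "Ck_on k {0<..} (\<lambda>x. - v * (inverse x * inverse x))" for v :: real
      by (intro Ck_on_linear[OF _ bounded_linear_mult_right]
          Ck_on_bilinear[OF _ bounded_bilinear_mult] Suc) auto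
  qed simp
qed (auto intro!: continuous_intros)

lemma Ck_on_ln: "Ck_on k {0<..} (ln :: real \<Rightarrow> real)"
proof (cases k)
  case (Suc k)
  have "Ck_on (Suc k) {0<..} (ln :: real \<Rightarrow> real)"
  proof (rule Ck_on_SucI)
    show "(ln has_derivative (\<lambda>v. v * inverse x)) (at x)" if "x \<in> {0<..}" for x :: real
      using that by (auto intro!: derivative_eq_intros simp: field_simps)
    show "Ck_on k {0<..} (\<lambda>x. v * inverse x)" for v :: real
      by (intro Ck_on_linear[OF _ bounded_linear_mult_right] Ck_on_inverse) auto
  qed simp
  then show ?thesis by (simp only: Suc)
qed (auto intro!: continuous_intros)

lemma smooth_on_open_compose:
  "smooth_on_open U f \<Longrightarrow> smooth_on_open V g \<Longrightarrow> f ` U \<subseteq> V \<Longrightarrow> smooth_on_open U (\<lambda>x. g (f x))"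
  by (auto simp: smooth_on_open_def intro: Ck_on_compose)

lemma smooth_on_open_cong:
  "smooth_on_open U f \<Longrightarrow> (\<And>x. x \<in> U \<Longrightarrow> f x = g x) \<Longrightarrow> smooth_on_open U g"
  by (auto simp: smooth_on_open_def intro: Ck_on_cong)

lemma smooth_on_open_subset:
  "smooth_on_open U f \<Longrightarrow> V \<subseteq> U \<Longrightarrow> open V \<Longrightarrow> smooth_on_open V f"
  by (auto simp: smooth_on_open_def intro: Ck_on_subset)

lemma smooth_on_open_linear:
  "smooth_on_open U f \<Longrightarrow> bounded_linear L \<Longrightarrow> smooth_on_open U (\<lambda>x. L (f x))"
  by (auto simp: smooth_on_open_def intro: Ck_on_linear)

lemma smooth_on_open_bilinear:
  "smooth_on_open U f \<Longrightarrow> smooth_on_open U g \<Longrightarrow> bounded_bilinear b \<Longrightarrow>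
   smooth_on_open U (\<lambda>x. b (f x) (g x))"
  by (auto simp: smooth_on_open_def intro: Ck_on_bilinear)

lemma smooth_on_open_add:
  "smooth_on_open U f \<Longrightarrow> smooth_on_open U g \<Longrightarrow> smooth_on_open U (\<lambda>x. f x + g x)"
  by (auto simp: smooth_on_open_def intro: Ck_on_add)

lemma smooth_on_open_id: "open U \<Longrightarrow> smooth_on_open U (\<lambda>x. x)"
  by (auto simp: smooth_on_open_def intro: Ck_on_id)

lemma smooth_on_open_const: "open U \<Longrightarrow> smooth_on_open U (\<lambda>x. c)"
  by (auto simp: smooth_on_open_def intro: Ck_on_const)

lemma smooth_on_open_exp:
  "smooth_on_open U f \<Longrightarrow> smooth_on_open U (\<lambda>x. exp (f x :: real))"
  by (rule smooth_on_open_compose[where V = UNIV]) (auto simp: smooth_on_open_def Ck_on_exp)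

lemma smooth_on_open_ln:
  "smooth_on_open U f \<Longrightarrow> (\<And>x. x \<in> U \<Longrightarrow> 0 < f x) \<Longrightarrow> smooth_on_open U (\<lambda>x. ln (f x :: real))"
  by (rule smooth_on_open_compose[where V = "{0<..}"]) (auto simp: smooth_on_open_def Ck_on_ln)

lemma smooth_on_open_has_derivative:
  assumes "smooth_on_open U f" "x \<in> U"
  shows "(f has_derivative frechet_derivative f (at x)) (at x)"
  using assms(2) by (rule Ck_on_has_derivative[of 0 U f, rotated])
    (use assms(1) in \<open>auto simp: smooth_on_open_def simp del: Ck_on.simps\<close>)

lemma smooth_on_open_continuous_on: "smooth_on_open U f \<Longrightarrow> continuous_on U f"
  unfolding smooth_on_open_def using Ck_on.simps(1) by blast

lemma smooth_map_cong: "smooth_map A f \<Longrightarrow> (\<And>x. x \<in> A \<Longrightarrow> f x = g x) \<Longrightarrow> smooth_map A g"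
  unfolding smooth_map_def by fastforce

lemma smooth_mapE:
  assumes "smooth_map A f" "p \<in> A"
  obtains U F where "p \<in> U" "smooth_on_open U F" "\<And>x. x \<in> A \<Longrightarrow> x \<in> U \<Longrightarrow> F x = f x"
  using bspec[OF assms(1)[unfolded smooth_map_def] assms(2)] by auto

lemma smooth_mapI:
  assumes "\<And>p. p \<in> A \<Longrightarrow> \<exists>U F. p \<in> U \<and> smooth_on_open U F \<and> (\<forall>x\<in>A \<inter> U. F x = f x)"
  shows "smooth_map A f"
  using assms unfolding smooth_map_def by simp

lemma smooth_map_subset:
  assumes "smooth_map A f" "B \<subseteq> A"
  shows "smooth_map B f"
proof (rule smooth_mapI)
  fix p assume "p \<in> B"
  then have "p \<in> A" using assms(2) by auto
  then obtain U F where "p \<in> U" "smooth_on_open U F" "\<And>x. x \<in> A \<Longrightarrow> x \<in> U \<Longrightarrow> F x = f x"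
    using smooth_mapE[OF assms(1)] by metis
  then show "\<exists>U F. p \<in> U \<and> smooth_on_open U F \<and> (\<forall>x\<in>B \<inter> U. F x = f x)"
    using assms(2) by (intro exI[of _ U] exI[of _ F]) auto
qed

lemma smooth_on_open_imp_smooth_map: "smooth_on_open U f \<Longrightarrow> A \<subseteq> U \<Longrightarrow> smooth_map A f"
  unfolding smooth_map_def by blast

lemma smooth_map_linear: "bounded_linear f \<Longrightarrow> smooth_map A f"
  by (rule smooth_on_open_imp_smooth_map[of UNIV])
    (auto intro: smooth_on_open_linear[OF smooth_on_open_id])

lemma smooth_map_compose:
  assumes "smooth_map A f" "smooth_map B g" "f ` A \<subseteq> B"
  shows "smooth_map A (\<lambda>x. g (f x))"
proof (rule smooth_mapI)
  fix p assume p: "p \<in> A"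
  obtain U F where U: "p \<in> U" "smooth_on_open U F" "\<And>x. x \<in> A \<Longrightarrow> x \<in> U \<Longrightarrow> F x = f x"
    using smooth_mapE[OF assms(1) p] by metis
  have "f p \<in> B" using assms(3) p by blast
  then obtain V G where V: "f p \<in> V" "smooth_on_open V G" "\<And>x. x \<in> B \<Longrightarrow> x \<in> V \<Longrightarrow> G x = g x"
    using smooth_mapE[OF assms(2)] by metis
  \<comment> \<open>G is smooth on V only, so F is restricted to the preimage of V, which is open
    because F is continuous.\<close>
  let ?W = "U \<inter> F -` V"
  have "open ?W"
    using U(2) V(2) by (intro continuous_open_preimage smooth_on_open_continuous_on)
      (auto simp: smooth_on_open_def)
  then have "smooth_on_open ?W F" using U(2) smooth_on_open_subset by blast
  then have "smooth_on_open ?W (\<lambda>x. G (F x))"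
    using V(2) by (rule smooth_on_open_compose) auto
  moreover have "p \<in> ?W" using U V p by auto
  moreover have "\<forall>x\<in>A \<inter> ?W. G (F x) = g (f x)"
  proof
    fix x assume x: "x \<in> A \<inter> ?W"
    then have "F x = f x" using U(3) by auto
    moreover have "f x \<in> B" using x assms(3) by auto
    ultimately show "G (F x) = g (f x)" using V(3)[of "f x"] x by auto
  qed
  ultimately show "\<exists>U F. p \<in> U \<and> smooth_on_open U F \<and> (\<forall>x\<in>A \<inter> U. F x = g (f x))"
    by (intro exI[of _ ?W] exI[of _ "\<lambda>x. G (F x)"]) auto
qed

lemma smooth_map_bilinear:
  assumes "smooth_map A f" "smooth_map A g" "bounded_bilinear b"
  shows "smooth_map A (\<lambda>x. b (f x) (g x))"
proof (rule smooth_mapI)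
  fix p assume p: "p \<in> A"
  obtain U F where U: "p \<in> U" "smooth_on_open U F" "\<And>x. x \<in> A \<Longrightarrow> x \<in> U \<Longrightarrow> F x = f x"
    using smooth_mapE[OF assms(1) p] by metis
  obtain V G where V: "p \<in> V" "smooth_on_open V G" "\<And>x. x \<in> A \<Longrightarrow> x \<in> V \<Longrightarrow> G x = g x"
    using smooth_mapE[OF assms(2) p] by metis
  have "open (U \<inter> V)" using U V by (auto simp: smooth_on_open_def)
  then have "smooth_on_open (U \<inter> V) F" "smooth_on_open (U \<inter> V) G"
    by (auto intro: smooth_on_open_subset[OF U(2)] smooth_on_open_subset[OF V(2)])
  then have "smooth_on_open (U \<inter> V) (\<lambda>x. b (F x) (G x))"
    using assms(3) by (rule smooth_on_open_bilinear)
  then show "\<exists>U F. p \<in> U \<and> smooth_on_open U F \<and> (\<forall>x\<in>A \<inter> U. F x = b (f x) (g x))"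
    using U V by (intro exI[of _ "U \<inter> V"] exI[of _ "\<lambda>x. b (F x) (G x)"]) auto
qed

text \<open>A local smooth extension agrees with f on A near p, so its derivative serves as a
  derivative of f relative to A.\<close>

lemma smooth_map_has_derivative:
  assumes "smooth_map A f" "p \<in> A"
  shows "\<exists>f'. (f has_derivative f') (at p within A)"
proof -
  obtain U F where U: "p \<in> U" "smooth_on_open U F" "\<And>x. x \<in> A \<Longrightarrow> x \<in> U \<Longrightarrow> F x = f x"
    using smooth_mapE[OF assms] by metis
  have "(F has_derivative frechet_derivative F (at p)) (at p within A)"
    using smooth_on_open_has_derivative[OF U(2,1)] has_derivative_at_withinI by blast
  moreover have "eventually (\<lambda>x. F x = f x) (at p within A)"
    using U unfolding smooth_on_open_def by (auto simp: eventually_at_topological)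
  ultimately show ?thesis
    using assms(2) U(1,3) has_derivative_transform_eventually[of F _ p A f] by blast
qed

lemma smooth_map_continuous_on: "smooth_map A f \<Longrightarrow> continuous_on A f"
  using smooth_map_has_derivative has_derivative_continuous
  unfolding continuous_on_eq_continuous_within by blast

text \<open>\<open>diffeomorphism\<close> speaks of \<open>inv_into\<close>. An explicit two-sided
  inverse coincides with it on B, and smoothness transfers along this equality.\<close>

lemma diffeomorphismI:
  assumes "smooth_map A f" "smooth_map B g" "f ` A \<subseteq> B" "g ` B \<subseteq> A"
    and "\<And>x. x \<in> A \<Longrightarrow> g (f x) = x" "\<And>y. y \<in> B \<Longrightarrow> f (g y) = y"
  shows "diffeomorphism A B f"
proof -
  have bij: "bij_betw f A B"
    using assms by (intro bij_betw_byWitness[of A g f B]) auto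
  moreover have "g y = inv_into A f y" if "y \<in> B" for y
    using bij_betw_inv_into_left[OF bij, of "g y"] assms(4,6) that by auto
  ultimately show ?thesis
    using assms(1) smooth_map_cong[OF assms(2), of "inv_into A f"] unfolding diffeomorphism_def
    by auto
qed

lemma diffeomorphism_compose:
  assumes "diffeomorphism A B f" "diffeomorphism B C g"
  shows "diffeomorphism A C (\<lambda>x. g (f x))"
proof (rule diffeomorphismI[where g = "\<lambda>y. inv_into A f (inv_into B g y)"])
  have f: "bij_betw f A B" "smooth_map A f" "smooth_map B (inv_into A f)"
    and g: "bij_betw g B C" "smooth_map B g" "smooth_map C (inv_into B g)"
    using assms unfolding diffeomorphism_def by auto
  have fi: "f ` A = B" "inv_into A f ` B = A" and gi: "g ` B = C" "inv_into B g ` C = B"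
    using f(1) g(1) by (auto simp: bij_betw_imp_surj_on bij_betw_inv_into)
  show "smooth_map A (\<lambda>x. g (f x))" by (rule smooth_map_compose[OF f(2) g(2)]) (simp add: fi)
  show "smooth_map C (\<lambda>y. inv_into A f (inv_into B g y))"
    by (rule smooth_map_compose[OF g(3) f(3)]) (simp add: gi)
  show "(\<lambda>x. g (f x)) ` A \<subseteq> C" "(\<lambda>y. inv_into A f (inv_into B g y)) ` C \<subseteq> A"
    using fi gi image_image[of g f A] image_image[of "inv_into A f" "inv_into B g" C] by simp_all
  show "inv_into A f (inv_into B g (g (f x))) = x" if "x \<in> A" for x
    using bij_betw_inv_into_left[OF f(1) that] bij_betw_inv_into_left[OF g(1) bij_betw_apply[OF f(1) that]]
    by simp
  show "g (f (inv_into A f (inv_into B g y))) = y" if "y \<in> C" for y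
  proof -
    have "inv_into B g y \<in> B" using gi(2) that by blast
    then show ?thesis
      using bij_betw_inv_into_right[OF f(1), of "inv_into B g y"] bij_betw_inv_into_right[OF g(1) that]
      by simp
  qed
qed

section \<open>Tangent vectors and differentials\<close>

lemma tangent_space_mono: "M \<subseteq> M' \<Longrightarrow> tangent_space M p \<subseteq> tangent_space M' p"
  unfolding tangent_space_def by blast

text \<open>A curve through p stays in the neighbourhood U for a short time, and the velocity
  depends only on that short piece.\<close>

lemma tangent_space_local:
  assumes "open U" "p \<in> U"
  shows "tangent_space (M \<inter> U) p = tangent_space M p"
proof
  show "tangent_space (M \<inter> U) p \<subseteq> tangent_space M p" by (rule tangent_space_mono) auto
  show "tangent_space M p \<subseteq> tangent_space (M \<inter> U) p"
  proof
    fix v assume "v \<in> tangent_space M p"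
    then obtain c e where c: "0 < e" "smooth_on_open {-e<..<e} c" "c ` {-e<..<e} \<subseteq> M" "c 0 = p"
      "(c has_vector_derivative v) (at (0::real))"
      unfolding tangent_space_def by blast
    have "isCont c 0" using has_vector_derivative_continuous[OF c(5)] .
    then have "eventually (\<lambda>t. c t \<in> U) (at 0)"
      using assms c(4) by (simp add: isCont_def tendsto_def)
    then obtain d where d: "0 < d" "\<And>t. t \<noteq> 0 \<Longrightarrow> dist t 0 < d \<Longrightarrow> c t \<in> U"
      unfolding eventually_at by auto
    let ?d = "min d e"
    have "c ` {-?d<..<?d} \<subseteq> M \<inter> U"
    proof
      fix y assume "y \<in> c ` {-?d<..<?d}"
      then obtain t where t: "y = c t" "-?d < t" "t < ?d" by auto
      then have "c t \<in> U" using d(2)[of t] assms c(4) by (cases "t = 0") (auto simp: dist_real_def)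
      moreover have "c t \<in> M" using t c(3) by auto
      ultimately show "y \<in> M \<inter> U" using t by auto
    qed
    moreover have "smooth_on_open {-?d<..<?d} c" using c(2) by (rule smooth_on_open_subset) auto
    ultimately show "v \<in> tangent_space (M \<inter> U) p"
      unfolding tangent_space_def using c d by (intro CollectI exI[of _ c] exI[of _ ?d]) auto
  qed
qed

text \<open>The curve runs inside M, so the chain rule applies although f is differentiable only
  relative to M.\<close>

lemma tangent_curve_derivative:
  assumes "0 < e" "smooth_on_open {-e<..<e} c" "c ` {-e<..<e} \<subseteq> M" "c 0 = p"
    "(c has_vector_derivative v) (at (0::real))" "(f has_derivative f') (at p within M)"
  shows "((\<lambda>t. f (c t)) has_vector_derivative f' v) (at 0)"
proof -
  have at: "at 0 within {-e<..<e} = at (0::real)" by (rule at_within_open) (use assms(1) in auto)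
  have "(f has_derivative f') (at (c 0) within c ` {-e<..<e})"
    unfolding assms(4) by (rule has_derivative_subset[OF assms(6,3)])
  moreover have "(c has_derivative (\<lambda>h. h *\<^sub>R v)) (at 0 within {-e<..<e})"
    using assms(5) at by (simp add: has_vector_derivative_def)
  ultimately have "((f \<circ> c) has_derivative (f' \<circ> (\<lambda>h. h *\<^sub>R v))) (at 0 within {-e<..<e})"
    by (intro diff_chain_within) auto
  moreover have "f' \<circ> (\<lambda>h. h *\<^sub>R v) = (\<lambda>h. h *\<^sub>R f' v)"
    using has_derivative_linear[OF assms(6)] by (auto simp: linear_scale)
  ultimately show ?thesis by (simp add: has_vector_derivative_def at o_def)
qed

text \<open>Derivatives relative to M are not unique as linear maps, and
  \<open>frechet_derivative\<close> picks one of them. On the velocity of a curve in M every choice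
  gives the velocity of the image curve, which is unique. Explicit derivatives can thus replace
  \<open>differential\<close> from here on.\<close>

lemma differential_eq:
  assumes "(f has_derivative f') (at p within M)" "v \<in> tangent_space M p"
  shows "differential M f p v = f' v"
proof -
  have "(f has_derivative differential M f p) (at p within M)"
    using differentiableI[OF assms(1)] by (simp add: frechet_derivative_works)
  moreover obtain c e where c: "0 < e" "smooth_on_open {-e<..<e} c" "c ` {-e<..<e} \<subseteq> M" "c 0 = p"
      "(c has_vector_derivative v) (at (0::real))"
    using assms(2) unfolding tangent_space_def by blast
  ultimately show ?thesis
    using tangent_curve_derivative[OF c assms(1)] tangent_curve_derivative[OF c]
      vector_derivative_unique_at by blast
qed

text \<open>Along a curve in M the product of f with any w orthogonal to W is constantly 0, so the
  derivative is orthogonal to w too; the double orthogonal complement of a subspace is the subspace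
  itself.\<close>

lemma has_derivative_tangent_in_subspace:
  fixes f :: "'a::euclidean_space \<Rightarrow> 'b::euclidean_space"
  assumes "(f has_derivative f') (at p within M)" "v \<in> tangent_space M p"
    and "subspace W" "\<And>q. q \<in> M \<Longrightarrow> f q \<in> W"
  shows "f' v \<in> W"
proof -
  obtain c e where c: "0 < e" "smooth_on_open {-e<..<e} c" "c ` {-e<..<e} \<subseteq> M" "c 0 = p"
      "(c has_vector_derivative v) (at (0::real))"
    using assms(2) unfolding tangent_space_def by blast
  have D: "((\<lambda>t. f (c t)) has_vector_derivative f' v) (at 0)"
    using tangent_curve_derivative[OF c assms(1)] .
  have "f' v \<bullet> w = 0" if w: "w \<in> W\<^sup>\<bottom>" for w
  proof -
    have "((\<lambda>t. f (c t) \<bullet> w) has_vector_derivative f' v \<bullet> w) (at 0)"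
      using bounded_linear.has_vector_derivative[OF bounded_linear_inner_left D] .
    moreover have "((\<lambda>t. f (c t) \<bullet> w) has_vector_derivative 0) (at 0)"
    proof (rule has_vector_derivative_transform_within_open[of _ _ _ "{-e<..<e}"])
      show "((\<lambda>t. 0) has_vector_derivative 0) (at (0::real))" by simp
      show "0 = f (c t) \<bullet> w" if "t \<in> {-e<..<e}" for t
        using that w assms(4)[of "c t"] image_subset_iff[THEN iffD1, OF c(3)]
        by (auto simp: orthogonal_comp_def orthogonal_def)
    qed (use c in auto)
    ultimately show ?thesis using vector_derivative_unique_at by blast
  qed
  then have "f' v \<in> (W\<^sup>\<bottom>)\<^sup>\<bottom>"
    by (auto simp: orthogonal_comp_def orthogonal_def inner_commute)
  then show ?thesis using orthogonal_comp_self[OF assms(3)] by simp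
qed

text \<open>The image curve is the natural witness, but its smoothness is known only through a local
  extension. Near 0 the two coincide, so the witness is restricted to a shorter interval.\<close>

lemma differential_in_tangent_space:
  assumes "smooth_map M f" "f ` M \<subseteq> M'" "p \<in> M" "v \<in> tangent_space M p"
  shows "differential M f p v \<in> tangent_space M' (f p)"
proof -
  obtain c e where c: "0 < e" "smooth_on_open {-e<..<e} c" "c ` {-e<..<e} \<subseteq> M" "c 0 = p"
      "(c has_vector_derivative v) (at (0::real))"
    using assms(4) unfolding tangent_space_def by blast
  obtain f' where f': "(f has_derivative f') (at p within M)"
    using smooth_map_has_derivative[OF assms(1,3)] by blast
  have D: "((\<lambda>t. f (c t)) has_vector_derivative f' v) (at 0)"
    using tangent_curve_derivative[OF c f'] .
  have "smooth_map {-e<..<e} (\<lambda>t. f (c t))"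
    by (rule smooth_map_compose[OF smooth_on_open_imp_smooth_map[OF c(2) order_refl] assms(1) c(3)])
  then obtain U F where U: "0 \<in> U" "smooth_on_open U F"
    "\<And>t. t \<in> {-e<..<e} \<Longrightarrow> t \<in> U \<Longrightarrow> F t = f (c t)"
    by (rule smooth_mapE[of _ _ 0]) (use c(1) in auto)
  have "open ({-e<..<e} \<inter> U)" using U(2) by (auto simp: smooth_on_open_def)
  moreover have "0 \<in> {-e<..<e} \<inter> U" using U(1) c(1) by auto
  ultimately obtain d where d: "0 < d" "ball 0 d \<subseteq> {-e<..<e} \<inter> U" by (rule openE)
  then have d: "0 < d" "{-d<..<d} \<subseteq> {-e<..<e} \<inter> U"
    by (auto simp only: ball_eq_greaterThanLessThan diff_0 add_0)
  have "smooth_on_open {-d<..<d} (\<lambda>t. f (c t))"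
    by (rule smooth_on_open_cong[OF smooth_on_open_subset[OF U(2)]]) (use U(3) subsetD[OF d(2)] in auto)
  moreover have "(\<lambda>t. f (c t)) ` {-d<..<d} \<subseteq> M'"
    using subsetD[OF d(2)] image_subset_iff[THEN iffD1, OF c(3)] assms(2) by auto
  ultimately have "f' v \<in> tangent_space M' (f p)"
    unfolding tangent_space_def using c(4) d D
    by (intro CollectI exI[of _ "\<lambda>t. f (c t)"] exI[of _ d]) simp
  then show ?thesis using differential_eq[OF f' assms(4)] by simp
qed

lemma tangent_space_open:
  assumes "open V" "x \<in> V"
  shows "tangent_space V x = UNIV"
proof -
  have "v \<in> tangent_space UNIV x" for v
  proof -
    have "smooth_on_open {-1<..<1} (\<lambda>t::real. x + t *\<^sub>R v)"
      by (rule smooth_on_open_add[OF smooth_on_open_const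
            smooth_on_open_linear[OF smooth_on_open_id bounded_linear_scaleR_left]]) auto
    moreover have "((\<lambda>t. x + t *\<^sub>R v) has_vector_derivative v) (at 0)"
      by (auto intro!: derivative_eq_intros)
    ultimately show ?thesis
      unfolding tangent_space_def by (intro CollectI exI[of _ "\<lambda>t. x + t *\<^sub>R v"] exI[of _ 1]) simp
  qed
  then show ?thesis using tangent_space_local[OF assms, of UNIV] by (simp add: set_eq_iff)
qed

section \<open>Upper triangular matrices with real diagonal\<close>

text \<open>The arguments are the diagonal, then the entries at (1,2), (2,3) and (1,3); the last one
  is the central direction of the Heisenberg algebra \<nn>.\<close>

definition tri :: "real \<Rightarrow> real \<Rightarrow> real \<Rightarrow> complex \<Rightarrow> complex \<Rightarrow> complex \<Rightarrow> complex ^ 3 ^ 3" where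
  "tri a b c x y z =
     vector [vector [of_real a, x, z], vector [0, of_real b, y], vector [0, 0, of_real c]]"

lemma tri_nth [simp]:
  "tri a b c x y z $ 1 $ 1 = of_real a" "tri a b c x y z $ 1 $ 2 = x" "tri a b c x y z $ 1 $ 3 = z"
  "tri a b c x y z $ 2 $ 1 = 0" "tri a b c x y z $ 2 $ 2 = of_real b" "tri a b c x y z $ 2 $ 3 = y"
  "tri a b c x y z $ 3 $ 1 = 0" "tri a b c x y z $ 3 $ 2 = 0" "tri a b c x y z $ 3 $ 3 = of_real c"
  by (simp_all add: tri_def)

lemma matrix_3_eq_iff:
  "(X :: 'a ^ 3 ^ 3) = Y \<longleftrightarrow>
    X $ 1 $ 1 = Y $ 1 $ 1 \<and> X $ 1 $ 2 = Y $ 1 $ 2 \<and> X $ 1 $ 3 = Y $ 1 $ 3 \<and>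
    X $ 2 $ 1 = Y $ 2 $ 1 \<and> X $ 2 $ 2 = Y $ 2 $ 2 \<and> X $ 2 $ 3 = Y $ 2 $ 3 \<and>
    X $ 3 $ 1 = Y $ 3 $ 1 \<and> X $ 3 $ 2 = Y $ 3 $ 2 \<and> X $ 3 $ 3 = Y $ 3 $ 3"
  by (auto simp: vec_eq_iff forall_3)

lemma tri_eq_iff [simp]:
  "tri a b c x y z = tri a' b' c' x' y' z' \<longleftrightarrow>
     a = a' \<and> b = b' \<and> c = c' \<and> x = x' \<and> y = y' \<and> z = z'"
  by (auto simp: matrix_3_eq_iff)

lemma tri_mult:
  "tri a b c x y z ** tri a' b' c' x' y' z' =
     tri (a * a') (b * b') (c * c') (a * x' + x * b') (b * y' + y * c') (a * z' + x * y' + z * c')"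
  by (simp add: matrix_3_eq_iff matrix_matrix_mult_def sum_3)

lemma tri_add:
  "tri a b c x y z + tri a' b' c' x' y' z' = tri (a + a') (b + b') (c + c') (x + x') (y + y') (z + z')"
  by (simp add: matrix_3_eq_iff)

lemma tri_diff:
  "tri a b c x y z - tri a' b' c' x' y' z' = tri (a - a') (b - b') (c - c') (x - x') (y - y') (z - z')"
  by (simp add: matrix_3_eq_iff)

lemma tri_scaleR: "r *\<^sub>R tri a b c x y z = tri (r * a) (r * b) (r * c) (r *\<^sub>R x) (r *\<^sub>R y) (r *\<^sub>R z)"
  by (simp add: matrix_3_eq_iff complex_eq_iff)

lemma mat_1_eq_tri: "(mat 1 :: complex ^ 3 ^ 3) = tri 1 1 1 0 0 0"
  by (simp add: matrix_3_eq_iff mat_def)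

lemma zero_eq_tri: "(0 :: complex ^ 3 ^ 3) = tri 0 0 0 0 0 0"
  by (simp add: matrix_3_eq_iff)

lemma diag3_eq_tri: "diag3 a b c = tri a b c 0 0 0"
  by (simp add: diag3_def tri_def)

lemma \<nn>_eq_tri: "\<nn> = {tri 0 0 0 x y z | x y z. True}"
  by (simp add: \<nn>_def tri_def)

lemma inner_s_tri:
  "inner_s (tri a b c x y z) (tri a' b' c' x' y' z') =
     Re (x * cnj x' + y * cnj y' + z * cnj z') + 2 * (a * a' + b * b' + c * c')"
  by (simp add: inner_s_def trace_def conjugate_transpose_def diagonal_part_def
      off_diagonal_part_def matrix_matrix_mult_def sum_3)

lemma bounded_bilinear_matrix_mult:
  "bounded_bilinear ((**) :: complex ^ 'n ^ 'n \<Rightarrow> complex ^ 'n ^ 'n \<Rightarrow> complex ^ 'n ^ 'n)"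
  unfolding bilinear_conv_bounded_bilinear[symmetric] bilinear_def linear_iff
  by (auto simp: vec_eq_iff matrix_matrix_mult_def sum.distrib algebra_simps
      scaleR_sum_right)

lemma inner_s_eq_sum:
  "inner_s X Y = (\<Sum>i\<in>UNIV. \<Sum>j\<in>UNIV.
     if i = j then 2 * Re (X $ i $ j * Y $ i $ j) else Re (X $ i $ j * cnj (Y $ i $ j)))"
  by (simp add: inner_s_def trace_def conjugate_transpose_def diagonal_part_def
      off_diagonal_part_def matrix_matrix_mult_def sum_3)

lemma bounded_bilinear_inner_s: "bounded_bilinear inner_s"
  unfolding bilinear_conv_bounded_bilinear[symmetric] bilinear_def linear_iff inner_s_eq_sum sum_3
  by (auto simp: algebra_simps)

interpretation matrix_mult: bounded_bilinear "(**) :: complex ^ 'n ^ 'n \<Rightarrow> complex ^ 'n ^ 'n \<Rightarrow> complex ^ 'n ^ 'n"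
  by (rule bounded_bilinear_matrix_mult)

interpretation inner_s: bounded_bilinear inner_s
  by (rule bounded_bilinear_inner_s)

text \<open>\<open>matrix_inv\<close> is a choice operator; a known two-sided inverse forces its
  value.\<close>

lemma matrix_inv_unique:
  fixes A B :: "'a::semiring_1 ^ 'n ^ 'n"
  assumes "A ** B = mat 1" "B ** A = mat 1"
  shows "matrix_inv A = B"
proof -
  have "A ** matrix_inv A = mat 1 \<and> matrix_inv A ** A = mat 1"
    unfolding matrix_inv_def using assms by (metis (mono_tags, lifting) someI_ex)
  then show ?thesis using assms by (metis matrix_mul_assoc matrix_mul_lid matrix_mul_rid)
qed

lemma bounded_linear_entry: "bounded_linear (\<lambda>X :: 'a::real_normed_vector ^ 'n ^ 'm. X $ i $ j)"
  by (rule bounded_linear_compose[OF bounded_linear_vec_nth bounded_linear_vec_nth])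

lemma smooth_entry:
  "smooth_on_open U f \<Longrightarrow> smooth_on_open U (\<lambda>p. (f p :: complex ^ 3 ^ 3) $ i $ j)"
  by (rule smooth_on_open_linear[OF _ bounded_linear_entry])

lemma smooth_Re: "smooth_on_open U f \<Longrightarrow> smooth_on_open U (\<lambda>p. Re (f p))"
  by (rule smooth_on_open_linear[OF _ bounded_linear_Re])

lemma smooth_tri:
  assumes "smooth_on_open U a" "smooth_on_open U b" "smooth_on_open U c"
    "smooth_on_open U x" "smooth_on_open U y" "smooth_on_open U z"
  shows "smooth_on_open U (\<lambda>p. tri (a p) (b p) (c p) (x p) (y p) (z p))"
proof -
  have lin: "linear (\<lambda>t. tri t 0 0 0 0 0)" "linear (\<lambda>t. tri 0 t 0 0 0 0)"
    "linear (\<lambda>t. tri 0 0 t 0 0 0)" "linear (\<lambda>t. tri 0 0 0 t 0 0)"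
    "linear (\<lambda>t. tri 0 0 0 0 t 0)" "linear (\<lambda>t. tri 0 0 0 0 0 t)"
    by (auto simp: linear_iff tri_add tri_scaleR)
  \<comment> \<open>Each entry enters through its own linear embedding into the matrices, so the
    matrix is a sum of six smooth terms.\<close>
  have "smooth_on_open U (\<lambda>p. tri (a p) 0 0 0 0 0 + tri 0 (b p) 0 0 0 0 + tri 0 0 (c p) 0 0 0
      + tri 0 0 0 (x p) 0 0 + tri 0 0 0 0 (y p) 0 + tri 0 0 0 0 0 (z p))"
    by (intro smooth_on_open_add)
      (rule smooth_on_open_linear[OF _ linear_conv_bounded_linear[THEN iffD1]], fact assms, fact lin)+
  then show ?thesis by (simp add: tri_add)
qed

text \<open>The exponential and the logarithm are applied to the diagonal only. On \<open>\<ss>\<close> this is a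
  global chart of \<open>S\<close> in which every group between \<open>N\<close> and \<open>S\<close> is a linear subspace.\<close>

definition diag_exp :: "complex ^ 3 ^ 3 \<Rightarrow> complex ^ 3 ^ 3" where
  "diag_exp X = tri (exp (Re (X $ 1 $ 1))) (exp (Re (X $ 2 $ 2))) (exp (Re (X $ 3 $ 3)))
     (X $ 1 $ 2) (X $ 2 $ 3) (X $ 1 $ 3)"

definition diag_ln :: "complex ^ 3 ^ 3 \<Rightarrow> complex ^ 3 ^ 3" where
  "diag_ln X = tri (ln (Re (X $ 1 $ 1))) (ln (Re (X $ 2 $ 2))) (ln (Re (X $ 3 $ 3)))
     (X $ 1 $ 2) (X $ 2 $ 3) (X $ 1 $ 3)"

text \<open>The adjugate of an upper triangular matrix with real diagonal: a polynomial formula for the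
  inverse on \<open>S\<close>.\<close>

definition tri_adj :: "complex ^ 3 ^ 3 \<Rightarrow> complex ^ 3 ^ 3" where
  "tri_adj X = tri (Re (X $ 2 $ 2) * Re (X $ 3 $ 3)) (Re (X $ 1 $ 1) * Re (X $ 3 $ 3))
     (Re (X $ 1 $ 1) * Re (X $ 2 $ 2)) (X $ 1 $ 2 * (- X $ 3 $ 3)) (X $ 2 $ 3 * (- X $ 1 $ 1))
     (X $ 1 $ 2 * X $ 2 $ 3 + X $ 1 $ 3 * (- X $ 2 $ 2))"

lemma diag_exp_tri [simp]: "diag_exp (tri a b c x y z) = tri (exp a) (exp b) (exp c) x y z"
  by (simp add: diag_exp_def)

lemma diag_ln_tri [simp]: "diag_ln (tri a b c x y z) = tri (ln a) (ln b) (ln c) x y z"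
  by (simp add: diag_ln_def)

lemma smooth_diag_exp: "smooth_on_open UNIV diag_exp"
proof -
  have [simp]: "smooth_on_open UNIV (\<lambda>X :: complex ^ 3 ^ 3. X $ i $ j)" for i j
    by (rule smooth_entry[OF smooth_on_open_id]) simp
  have "smooth_on_open UNIV (\<lambda>X. diag_exp X)" unfolding diag_exp_def
    by (intro smooth_tri) (simp_all add: smooth_on_open_exp smooth_Re)
  then show ?thesis by simp
qed

lemma smooth_diag_ln:
  "smooth_on_open {X. 0 < Re (X $ 1 $ 1) \<and> 0 < Re (X $ 2 $ 2) \<and> 0 < Re (X $ 3 $ 3)} diag_ln"
    (is "smooth_on_open ?U _")
proof -
  have "open ?U" by (intro open_Collect_conj open_Collect_less continuous_intros)
  then have [simp]: "smooth_on_open ?U (\<lambda>X :: complex ^ 3 ^ 3. X $ i $ j)" for i j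
    by (rule smooth_entry[OF smooth_on_open_id])
  have "smooth_on_open ?U (\<lambda>X. diag_ln X)" unfolding diag_ln_def
    by (intro smooth_tri smooth_on_open_ln) (simp_all add: smooth_Re)
  then show ?thesis by simp
qed

lemma smooth_tri_adj: "smooth_on_open UNIV tri_adj"
proof -
  have e: "smooth_on_open UNIV (\<lambda>X :: complex ^ 3 ^ 3. X $ i $ j)" for i j
    by (rule smooth_entry[OF smooth_on_open_id]) simp
  have n: "smooth_on_open UNIV (\<lambda>X :: complex ^ 3 ^ 3. - X $ i $ j)" for i j
    using smooth_on_open_linear[OF e bounded_linear_minus[OF bounded_linear_ident]] by simp
  have "smooth_on_open UNIV (\<lambda>X. tri_adj X)" unfolding tri_adj_def
    by (intro smooth_tri smooth_on_open_add
        smooth_on_open_bilinear[OF _ _ bounded_bilinear_mult] smooth_Re e n)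
  then show ?thesis by simp
qed

section \<open>The Lie algebra \<ss> and the group S in coordinates\<close>

definition sol_algebra :: "(complex ^ 3 ^ 3) set" where
  "sol_algebra = {tri a b c x y z | a b c x y z. a + b + c = 0}"

definition sol_group :: "(complex ^ 3 ^ 3) set" where
  "sol_group = {tri a b c x y z | a b c x y z. 0 < a \<and> 0 < b \<and> 0 < c \<and> a * b * c = 1}"

lemma sol_algebraE:
  assumes "X \<in> sol_algebra"
  obtains a b c x y z where "X = tri a b c x y z" "a + b + c = 0"
  using assms unfolding sol_algebra_def by blast

lemma sol_groupE:
  assumes "p \<in> sol_group"
  obtains a b c x y z where "p = tri a b c x y z" "0 < a" "0 < b" "0 < c" "a * b * c = 1"
  using assms unfolding sol_group_def by blast

lemma tri_in_sol_algebra [simp]: "tri a b c x y z \<in> sol_algebra \<longleftrightarrow> a + b + c = 0"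
  unfolding sol_algebra_def by auto

lemma tri_in_sol_group [simp]:
  "tri a b c x y z \<in> sol_group \<longleftrightarrow> 0 < a \<and> 0 < b \<and> 0 < c \<and> a * b * c = 1"
  unfolding sol_group_def by auto

lemma subspace_sol_algebra: "subspace sol_algebra"
  unfolding subspace_def
  by (auto simp: zero_eq_tri tri_add tri_scaleR elim!: sol_algebraE simp flip: distrib_left)

lemma diag_exp_sol: "X \<in> sol_algebra \<Longrightarrow> diag_exp X \<in> sol_group"
  by (auto elim!: sol_algebraE simp flip: exp_add)

lemma diag_ln_sol: "p \<in> sol_group \<Longrightarrow> diag_ln p \<in> sol_algebra"
  by (auto elim!: sol_groupE simp flip: ln_mult_pos)

lemma diag_exp_ln [simp]: "p \<in> sol_group \<Longrightarrow> diag_exp (diag_ln p) = p"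
  by (auto elim!: sol_groupE)

lemma diag_ln_exp [simp]: "X \<in> sol_algebra \<Longrightarrow> diag_ln (diag_exp X) = X"
  by (auto elim!: sol_algebraE)

lemma sol_group_one: "mat 1 \<in> sol_group"
  by (simp add: mat_1_eq_tri)

lemma sol_group_mult: "p \<in> sol_group \<Longrightarrow> q \<in> sol_group \<Longrightarrow> p ** q \<in> sol_group"
  by (auto elim!: sol_groupE simp: tri_mult) (metis mult.assoc mult.left_commute mult_1)

lemma tri_adj_tri:
  "tri_adj (tri a b c x y z) = tri (b * c) (a * c) (a * b) (- (x * c)) (- (y * a)) (x * y - z * b)"
  by (simp add: tri_adj_def)

lemma sol_group_adj:
  assumes "p \<in> sol_group"
  shows "tri_adj p \<in> sol_group"
proof -
  obtain a b c x y z where p: "p = tri a b c x y z" "0 < a" "0 < b" "0 < c" "a * b * c = 1"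
    using assms by (rule sol_groupE)
  have "b * c * (a * c) * (a * b) = (a * b * c) * (a * b * c)" by simp
  then show ?thesis using p by (simp add: tri_adj_tri)
qed

lemma tri_adj_inverse:
  assumes "p \<in> sol_group"
  shows tri_adj_right: "p ** tri_adj p = mat 1" and tri_adj_left: "tri_adj p ** p = mat 1"
proof -
  obtain a b c x y z where p: "p = tri a b c x y z" "a * b * c = 1"
    using assms by (rule sol_groupE)
  then have "a * (b * c) = 1" "b * (a * c) = 1" "c * (a * b) = 1" by (simp_all add: mult_ac)
  then show "p ** tri_adj p = mat 1" "tri_adj p ** p = mat 1"
    by (auto simp: p(1) tri_adj_tri tri_mult mat_1_eq_tri mult.commute) (simp_all add: algebra_simps)
qed

lemma matrix_inv_sol: "p \<in> sol_group \<Longrightarrow> matrix_inv p = tri_adj p"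
  by (intro matrix_inv_unique tri_adj_right tri_adj_left)

lemma tri_adj_cancel [simp]:
  assumes "p \<in> sol_group"
  shows "tri_adj p ** (p ** X) = X" "p ** (tri_adj p ** X) = X"
    "X ** p ** tri_adj p = X" "X ** tri_adj p ** p = X"
  using tri_adj_left[OF assms] tri_adj_right[OF assms]
  by (simp_all add: matrix_mul_assoc[of _ p] matrix_mul_assoc[of _ "tri_adj p"]
      flip: matrix_mul_assoc[of X])

section \<open>The groups between \<open>N\<close> and \<open>S\<close> and their cosets\<close>

lemma mat_exp_diagonal: "mat_exp (tri a b c 0 0 0) = tri (exp a) (exp b) (exp c) 0 0 0"
proof -
  let ?E1 = "tri 1 0 0 0 0 0" and ?E2 = "tri 0 1 0 0 0 0" and ?E3 = "tri 0 0 1 0 0 0"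
  have pow: "((**) (tri a b c 0 0 0) ^^ k) (mat 1) = tri (a ^ k) (b ^ k) (c ^ k) 0 0 0" for k
    by (induction k) (simp_all add: mat_1_eq_tri tri_mult)
  have exp: "(\<lambda>k. (1 / fact k) * r ^ k) sums exp r" for r :: real
    using exp_converges[of r] by (simp add: divide_inverse mult.commute)
  have "(\<lambda>k. ((1 / fact k) * a ^ k) *\<^sub>R ?E1 + ((1 / fact k) * b ^ k) *\<^sub>R ?E2 + ((1 / fact k) * c ^ k) *\<^sub>R ?E3)
      sums (exp a *\<^sub>R ?E1 + exp b *\<^sub>R ?E2 + exp c *\<^sub>R ?E3)"
    by (intro sums_add bounded_linear.sums[OF bounded_linear_scaleR_left] exp)
  then have "(\<lambda>k. (1 / fact k) *\<^sub>R ((**) (tri a b c 0 0 0) ^^ k) (mat 1))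
      sums tri (exp a) (exp b) (exp c) 0 0 0"
    by (simp add: pow tri_scaleR tri_add)
  then show ?thesis unfolding mat_exp_def by (rule sums_unique[symmetric])
qed

text \<open>The cube of the matrix is 0, so the series stops after the quadratic term, whose only
  nonzero entry x y / 2 sits at (1,3).\<close>

lemma mat_exp_nilpotent: "mat_exp (tri 0 0 0 x y z) = tri 1 1 1 x y (z + x * y / 2)"
proof -
  let ?X = "tri 0 0 0 x y z"
  let ?f = "\<lambda>k. (1 / fact k) *\<^sub>R ((**) ?X ^^ k) (mat 1)"
  have three: "((**) ?X ^^ (k + 3)) (mat 1) = 0" for k
    by (induction k) (simp_all add: numeral_3_eq_3 mat_1_eq_tri tri_mult zero_eq_tri)
  have "?f k = 0" if "k \<notin> {..<3}" for k
    using three[of "k - 3"] that by simp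
  then have "mat_exp ?X = sum ?f {..<3}"
    unfolding mat_exp_def by (intro suminf_finite) auto
  also have "\<dots> = tri 1 1 1 x y (z + x * y / 2)"
    by (simp add: numeral_3_eq_3 mat_1_eq_tri tri_mult tri_scaleR tri_add)
      (simp add: scaleR_conv_of_real)
  finally show ?thesis .
qed

lemma group_GL: "group (GL_group :: (complex ^ 'n ^ 'n) monoid)"
proof (rule groupI)
  fix X :: "complex ^ 'n ^ 'n"
  assume "X \<in> carrier GL_group"
  then show "\<exists>Y\<in>carrier GL_group. Y \<otimes>\<^bsub>GL_group\<^esub> X = \<one>\<^bsub>GL_group\<^esub>"
    unfolding GL_group_def invertible_def by auto
next
  have "invertible (mat 1 :: complex ^ 'n ^ 'n)"
    unfolding invertible_def by (auto intro!: exI[of _ "mat 1"])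
  then show "\<one>\<^bsub>GL_group\<^esub> \<in> carrier (GL_group :: (complex ^ 'n ^ 'n) monoid)"
    by (simp add: GL_group_def)
qed (auto simp: GL_group_def matrix_mul_assoc invertible_mult)

lemma sol_group_in_GL: "p \<in> sol_group \<Longrightarrow> p \<in> carrier GL_group"
  using tri_adj_left tri_adj_right by (auto simp: GL_group_def invertible_def)

lemma inv_GL_sol:
  assumes "p \<in> sol_group"
  shows "inv\<^bsub>GL_group\<^esub> p = tri_adj p"
  using group.inv_equality[OF group_GL, of "tri_adj p" p] assms
  by (simp add: sol_group_in_GL sol_group_adj) (simp add: GL_group_def tri_adj_left)

lemma subgroup_GL_I:
  assumes "G \<subseteq> sol_group" "mat 1 \<in> G"
    and "\<And>p q. p \<in> G \<Longrightarrow> q \<in> G \<Longrightarrow> p ** q \<in> G" "\<And>p. p \<in> G \<Longrightarrow> tri_adj p \<in> G"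
  shows "subgroup G GL_group"
proof (rule group.subgroupI[OF group_GL])
  show "G \<subseteq> carrier GL_group" using assms(1) sol_group_in_GL by auto
  show "inv\<^bsub>GL_group\<^esub> p \<in> G" if "p \<in> G" for p
    using inv_GL_sol[of p] assms(1,4) that by auto
qed (use assms in \<open>auto simp: GL_group_def\<close>)

definition unipotent_group :: "(complex ^ 3 ^ 3) set" where
  "unipotent_group = {tri 1 1 1 x y z | x y z. True}"

definition diagonal_group :: "(complex ^ 3 ^ 3) set" where
  "diagonal_group = {tri a b c 0 0 0 | a b c. 0 < a \<and> 0 < b \<and> 0 < c \<and> a * b * c = 1}"

lemma subgroup_unipotent: "subgroup unipotent_group GL_group"
  by (rule subgroup_GL_I) (auto simp: unipotent_group_def mat_1_eq_tri tri_mult tri_adj_tri)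

lemma subgroup_diagonal: "subgroup diagonal_group GL_group"
proof (rule subgroup_GL_I)
  show "p ** q \<in> diagonal_group" if "p \<in> diagonal_group" "q \<in> diagonal_group" for p q
    using sol_group_mult[of p q] that by (auto simp: diagonal_group_def tri_mult)
  show "tri_adj p \<in> diagonal_group" if "p \<in> diagonal_group" for p
    using sol_group_adj[of p] that by (auto simp: diagonal_group_def tri_adj_tri)
qed (auto simp: diagonal_group_def mat_1_eq_tri)

lemma group_N_eq: "group_N = unipotent_group"
  unfolding group_N_def connected_lie_subgroup_def
proof
  show "generate GL_group (mat_exp ` \<nn>) \<subseteq> unipotent_group"
    by (rule group.generate_subgroup_incl[OF group_GL _ subgroup_unipotent])
      (auto simp: \<nn>_eq_tri mat_exp_nilpotent unipotent_group_def)
  show "unipotent_group \<subseteq> generate GL_group (mat_exp ` \<nn>)"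
  proof
    fix p assume "p \<in> unipotent_group"
    \<comment> \<open>Subtracting x y / 2 undoes the quadratic term of the exponential, so
      \<open>mat_exp\<close> maps \<nn> onto all of the unipotent matrices.\<close>
    then obtain x y z where "p = mat_exp (tri 0 0 0 x y (z - x * y / 2))"
      by (auto simp: mat_exp_nilpotent unipotent_group_def)
    then have "p \<in> mat_exp ` \<nn>" by (auto simp: \<nn>_eq_tri)
    then show "p \<in> generate GL_group (mat_exp ` \<nn>)" by (rule generate.incl)
  qed
qed

lemma group_A_eq: "group_A = diagonal_group"
  unfolding group_A_def connected_lie_subgroup_def
proof
  show "generate GL_group (mat_exp ` \<aa>) \<subseteq> diagonal_group"
    by (rule group.generate_subgroup_incl[OF group_GL _ subgroup_diagonal])
      (auto simp: \<aa>_def diag3_eq_tri mat_exp_diagonal diagonal_group_def simp flip: exp_add)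
  show "diagonal_group \<subseteq> generate GL_group (mat_exp ` \<aa>)"
  proof
    fix p assume "p \<in> diagonal_group"
    then obtain a b c where p: "p = tri a b c 0 0 0" "0 < a" "0 < b" "0 < c" "a * b * c = 1"
      by (auto simp: diagonal_group_def)
    then have "p = mat_exp (tri (ln a) (ln b) (ln c) 0 0 0)" by (simp add: mat_exp_diagonal)
    moreover have "ln a + ln b + ln c = 0" using p by (simp flip: ln_mult_pos)
    ultimately have "p \<in> mat_exp ` \<aa>" unfolding \<aa>_def diag3_eq_tri by blast
    then show "p \<in> generate GL_group (mat_exp ` \<aa>)" by (rule generate.incl)
  qed
qed

lemma group_S_eq: "group_S = sol_group"
proof
  show "group_S \<subseteq> sol_group"
    by (auto simp: group_S_def group_N_eq group_A_eq unipotent_group_def diagonal_group_def tri_mult)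
  show "sol_group \<subseteq> group_S"
  proof
    fix p assume "p \<in> sol_group"
    then obtain a b c x y z where p: "p = tri a b c x y z" "0 < a" "0 < b" "0 < c" "a * b * c = 1"
      by (rule sol_groupE)
    \<comment> \<open>Right multiplication by a diagonal matrix scales columns, so the unipotent
      factor is found by dividing the second column by b and the third by c.\<close>
    then have "p = tri 1 1 1 (x / b) (y / c) (z / c) ** tri a b c 0 0 0"
      by (simp add: tri_mult)
    moreover have "tri a b c 0 0 0 \<in> group_A" using p by (auto simp: group_A_eq diagonal_group_def)
    moreover have "tri 1 1 1 (x / b) (y / c) (z / c) \<in> group_N"
      by (auto simp: group_N_eq unipotent_group_def)
    ultimately show "p \<in> group_S" unfolding group_S_def by blast
  qed
qed

text \<open>For W between \<nn> and \<ss> this is N times the exponentials of the diagonal matrices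
  in W, because the strictly upper entries are then unrestricted.\<close>

definition tri_group :: "(complex ^ 3 ^ 3) set \<Rightarrow> (complex ^ 3 ^ 3) set" where
  "tri_group W = diag_exp ` W"

lemma tri_group_sol: "tri_group sol_algebra = sol_group"
  unfolding tri_group_def
proof
  show "sol_group \<subseteq> diag_exp ` sol_algebra"
  proof
    fix p assume "p \<in> sol_group"
    then show "p \<in> diag_exp ` sol_algebra"
      by (intro image_eqI[of p diag_exp "diag_ln p"]) (simp_all add: diag_ln_sol)
  qed
qed (auto simp: diag_exp_sol)

text \<open>Multiplying n by exp(tH) scales its columns by positive factors, and the strictly upper
  entries are arbitrary; rescaling them passes between the two descriptions.\<close>

lemma S_H_eq: "S_H (tri u v w 0 0 0) = tri_group {tri (t * u) (t * v) (t * w) x y z | t x y z. True}"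
proof
  show "S_H (tri u v w 0 0 0) \<subseteq> tri_group {tri (t * u) (t * v) (t * w) x y z | t x y z. True}"
  proof
    fix p assume "p \<in> S_H (tri u v w 0 0 0)"
    then obtain x y z t where "p = tri 1 1 1 x y z ** mat_exp (t *\<^sub>R tri u v w 0 0 0)"
      by (auto simp: S_H_def group_N_eq unipotent_group_def)
    then have "p = diag_exp (tri (t * u) (t * v) (t * w) (x * exp (t * v)) (y * exp (t * w)) (z * exp (t * w)))"
      by (simp add: tri_scaleR mat_exp_diagonal tri_mult exp_of_real)
    then show "p \<in> tri_group {tri (t * u) (t * v) (t * w) x y z | t x y z. True}"
      unfolding tri_group_def by blast
  qed
  show "tri_group {tri (t * u) (t * v) (t * w) x y z | t x y z. True} \<subseteq> S_H (tri u v w 0 0 0)"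
  proof
    fix p assume "p \<in> tri_group {tri (t * u) (t * v) (t * w) x y z | t x y z. True}"
    then obtain t x y z where "p = diag_exp (tri (t * u) (t * v) (t * w) x y z)"
      unfolding tri_group_def by blast
    then have "p = tri 1 1 1 (x / exp (t * v)) (y / exp (t * w)) (z / exp (t * w)) ** mat_exp (t *\<^sub>R tri u v w 0 0 0)"
      by (simp add: tri_scaleR mat_exp_diagonal tri_mult exp_of_real)
    then show "p \<in> S_H (tri u v w 0 0 0)"
      unfolding S_H_def group_N_eq unipotent_group_def by blast
  qed
qed

text \<open>The diagonal part of \<^const>\<open>diag_ln\<close> is a homomorphism; it decides membership in the groups
  between \<open>N\<close> and \<open>S\<close>.\<close>

definition log_part :: "complex ^ 3 ^ 3 \<Rightarrow> complex ^ 3 ^ 3" where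
  "log_part p = tri (ln (Re (p $ 1 $ 1))) (ln (Re (p $ 2 $ 2))) (ln (Re (p $ 3 $ 3))) 0 0 0"

lemma log_part_tri [simp]: "log_part (tri a b c x y z) = tri (ln a) (ln b) (ln c) 0 0 0"
  by (simp add: log_part_def)

lemma log_part_mult:
  "p \<in> sol_group \<Longrightarrow> q \<in> sol_group \<Longrightarrow> log_part (p ** q) = log_part p + log_part q"
  by (auto elim!: sol_groupE simp: tri_mult tri_add ln_mult_pos)

lemma log_part_one: "log_part (mat 1) = 0"
  by (simp add: mat_1_eq_tri zero_eq_tri)

lemma log_part_adj:
  assumes "p \<in> sol_group"
  shows "log_part (tri_adj p) = - log_part p"
  using log_part_mult[OF assms sol_group_adj[OF assms]] tri_adj_right[OF assms]
  by (simp add: log_part_one add_eq_0_iff)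

text \<open>Since [\<ss>, \<ss>] lies in \<nn>, a subspace containing \<nn> is automatically an
  ideal, so linear conditions suffice. The instances are \<ss> itself and the orthogonal complement
  of T; each result on cosets thereby serves both S and its leaves.\<close>

locale sol_ideal =
  fixes W :: "(complex ^ 3 ^ 3) set"
  assumes subspace: "subspace W" and contains_\<nn>: "\<nn> \<subseteq> W" and subset_sol: "W \<subseteq> sol_algebra"
begin

lemma tri_in_iff: "tri a b c x y z \<in> W \<longleftrightarrow> tri a b c 0 0 0 \<in> W"
proof -
  have N: "tri 0 0 0 x y z \<in> W" for x y z
    using contains_\<nn> by (auto simp: \<nn>_eq_tri)
  show ?thesis
    using subspace_add[OF subspace _ N[of x y z], of "tri a b c 0 0 0"]
      subspace_add[OF subspace _ N[of "-x" "-y" "-z"], of "tri a b c x y z"]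
    by (auto simp: tri_add)
qed

lemma tri_group_subset: "tri_group W \<subseteq> sol_group"
  using subset_sol diag_exp_sol by (auto simp: tri_group_def)

lemma tri_group_iff_diag_ln:
  assumes "p \<in> sol_group"
  shows "p \<in> tri_group W \<longleftrightarrow> diag_ln p \<in> W"
proof
  assume "p \<in> tri_group W"
  then show "diag_ln p \<in> W" using subset_sol by (auto simp: tri_group_def)
next
  assume "diag_ln p \<in> W"
  then show "p \<in> tri_group W"
    unfolding tri_group_def using assms by (intro image_eqI[of p diag_exp "diag_ln p"]) simp_all
qed

text \<open>Strictly upper entries do not affect membership in W, so \<open>diag_ln\<close> may be
  replaced by the homomorphism \<open>log_part\<close>. Closure under products and inverses then
  becomes linear algebra.\<close>

lemma tri_group_iff:
  assumes "p \<in> sol_group"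
  shows "p \<in> tri_group W \<longleftrightarrow> log_part p \<in> W"
  unfolding tri_group_iff_diag_ln[OF assms] diag_ln_def log_part_def by (rule tri_in_iff)

lemma one_in_tri_group: "mat 1 \<in> tri_group W"
  by (simp add: tri_group_iff[OF sol_group_one] log_part_one subspace_0[OF subspace])

lemma mult_in_tri_group:
  assumes "p \<in> tri_group W" "q \<in> tri_group W"
  shows "p ** q \<in> tri_group W"
proof -
  have "p \<in> sol_group" "q \<in> sol_group" using assms tri_group_subset by auto
  then show ?thesis
    using assms by (simp add: tri_group_iff sol_group_mult log_part_mult subspace_add[OF subspace])
qed

lemma adj_in_tri_group:
  assumes "p \<in> tri_group W"
  shows "tri_adj p \<in> tri_group W"
proof -
  have "p \<in> sol_group" using assms tri_group_subset by auto
  then show ?thesis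
    using assms by (simp add: tri_group_iff sol_group_adj log_part_adj subspace_neg[OF subspace])
qed

definition coset :: "complex ^ 3 ^ 3 \<Rightarrow> (complex ^ 3 ^ 3) set" where
  "coset p = (**) p ` tri_group W"

text \<open>The values of \<open>log_part\<close> are added, so the criterion does not distinguish
  left from right multiplication; this is how normality of the subgroup enters.\<close>

lemma coset_iff:
  assumes "p \<in> sol_group"
  shows "q \<in> coset p \<longleftrightarrow> q \<in> sol_group \<and> log_part q - log_part p \<in> W"
proof
  assume "q \<in> coset p"
  then obtain g where g: "g \<in> tri_group W" "q = p ** g" by (auto simp: coset_def)
  then have "g \<in> sol_group" using tri_group_subset by auto
  then show "q \<in> sol_group \<and> log_part q - log_part p \<in> W"
    using g assms by (simp add: sol_group_mult log_part_mult tri_group_iff)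
next
  assume q: "q \<in> sol_group \<and> log_part q - log_part p \<in> W"
  then have "tri_adj p ** q \<in> tri_group W"
    using assms by (simp add: tri_group_iff sol_group_mult sol_group_adj log_part_mult log_part_adj)
  then have "p ** (tri_adj p ** q) \<in> coset p" by (simp add: coset_def)
  then show "q \<in> coset p" using assms by simp
qed

lemma coset_subset: "p \<in> sol_group \<Longrightarrow> coset p \<subseteq> sol_group"
  using coset_iff by auto

lemma self_in_coset: "p \<in> sol_group \<Longrightarrow> p \<in> coset p"
  using coset_iff subspace_0[OF subspace] by simp

lemma coset_eq:
  assumes "p \<in> sol_group" "q \<in> coset p"
  shows "coset q = coset p"
proof -
  have q: "q \<in> sol_group" "log_part q - log_part p \<in> W" using assms coset_iff by auto
  have "log_part r - log_part q \<in> W \<longleftrightarrow> log_part r - log_part p \<in> W" for r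
    using subspace_add[OF subspace q(2), of "log_part r - log_part q"]
      subspace_diff[OF subspace _ q(2), of "log_part r - log_part p"] by auto
  then show ?thesis using coset_iff[OF assms(1)] coset_iff[OF q(1)] by auto
qed

lemma coset_one: "coset (mat 1) = tri_group W"
  by (auto simp: coset_def)

lemma left_mult_coset: "(**) p ` coset q = coset (p ** q)"
  by (simp add: coset_def image_image matrix_mul_assoc)

text \<open>Right translation shifts \<open>log_part\<close> by the constant
  \<open>log_part a\<close>, so it permutes the cosets, although in general it is not an
  isometry.\<close>

lemma right_mult_coset:
  assumes "p \<in> sol_group" "a \<in> sol_group"
  shows "(\<lambda>q. q ** a) ` coset p = coset (p ** a)"
proof
  show "(\<lambda>q. q ** a) ` coset p \<subseteq> coset (p ** a)"
    using assms by (auto simp: coset_iff sol_group_mult log_part_mult)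
  show "coset (p ** a) \<subseteq> (\<lambda>q. q ** a) ` coset p"
  proof
    fix q assume "q \<in> coset (p ** a)"
    then have q: "q \<in> sol_group" "log_part q - (log_part p + log_part a) \<in> W"
      using assms by (auto simp: coset_iff sol_group_mult log_part_mult)
    then have "q ** tri_adj a \<in> coset p"
      using assms by (simp add: coset_iff sol_group_mult log_part_mult sol_group_adj log_part_adj
          algebra_simps)
    moreover have "q = q ** tri_adj a ** a" using assms by simp
    ultimately show "q \<in> (\<lambda>q. q ** a) ` coset p" by blast
  qed
qed

end

lemma sol_ideal_sol_algebra: "sol_ideal sol_algebra"
  by unfold_locales (auto simp: subspace_sol_algebra \<nn>_eq_tri)

section \<open>Cosets as submanifolds\<close>

lemma diffeomorphism_imp_homeomorphic:
  assumes "diffeomorphism A B f"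
  shows "A homeomorphic B"
proof (rule homeomorphicI[where f = f and g = "inv_into A f"])
  have f: "bij_betw f A B" "smooth_map A f" "smooth_map B (inv_into A f)"
    using assms by (auto simp: diffeomorphism_def)
  show "f ` A = B" "inv_into A f ` B = A"
    using f(1) bij_betw_inv_into[OF f(1)] by (auto simp: bij_betw_def)
  show "continuous_on A f" "continuous_on B (inv_into A f)"
    using f smooth_map_continuous_on by auto
  show "inv_into A f (f x) = x" if "x \<in> A" for x using bij_betw_inv_into_left[OF f(1) that] .
  show "f (inv_into A f y) = y" if "y \<in> B" for y using bij_betw_inv_into_right[OF f(1) that] .
qed

lemma sol_algebra_real_diagonal: "X \<in> sol_algebra \<Longrightarrow> \<exists>a b c x y z. X = tri a b c x y z"
  unfolding sol_algebra_def by auto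

lemma diag_exp_0: "diag_exp 0 = mat 1"
  by (simp add: zero_eq_tri mat_1_eq_tri)

lemma diag_ln_1: "diag_ln (mat 1) = 0"
  by (simp add: zero_eq_tri mat_1_eq_tri)

lemma diag_exp_curve:
  assumes "w \<in> sol_algebra"
  shows "((\<lambda>t. diag_exp (t *\<^sub>R w)) has_vector_derivative w) (at 0)"
proof -
  obtain a b c x y z where w: "w = tri a b c x y z"
    using sol_algebra_real_diagonal[OF assms] by blast
  let ?E1 = "tri 1 0 0 0 0 0" and ?E2 = "tri 0 1 0 0 0 0" and ?E3 = "tri 0 0 1 0 0 0"
  let ?N = "tri 0 0 0 x y z"
  have "((\<lambda>t. exp (t * a) *\<^sub>R ?E1 + exp (t * b) *\<^sub>R ?E2 + exp (t * c) *\<^sub>R ?E3 + t *\<^sub>R ?N)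
      has_vector_derivative (a *\<^sub>R ?E1 + b *\<^sub>R ?E2 + c *\<^sub>R ?E3 + ?N)) (at 0)"
    by (auto intro!: derivative_eq_intros)
  then show ?thesis by (simp add: w tri_scaleR tri_add)
qed

text \<open>The values on \<ss> are read off from explicit curves. On the whole matrix space the
  derivative is not the identity, since \<open>diag_exp\<close> discards the lower entries and the
  imaginary parts of the diagonal; hence the restriction to \<ss>.\<close>

lemma diag_exp_has_derivative_0:
  obtains D where "(diag_exp has_derivative D) (at 0)" "\<And>w. w \<in> sol_algebra \<Longrightarrow> D w = w"
proof -
  let ?D = "frechet_derivative diag_exp (at 0)"
  have D: "(diag_exp has_derivative ?D) (at 0)"
    by (rule smooth_on_open_has_derivative[OF smooth_diag_exp]) simp
  moreover have "?D w = w" if "w \<in> sol_algebra" for w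
  proof -
    have "((\<lambda>t. t *\<^sub>R w) has_derivative (\<lambda>h. h *\<^sub>R w)) (at 0)"
      by (auto intro!: derivative_eq_intros)
    moreover have "(diag_exp has_derivative ?D) (at (0 *\<^sub>R w))" using D by simp
    ultimately have "((\<lambda>t. diag_exp (t *\<^sub>R w)) has_derivative (\<lambda>h. ?D (h *\<^sub>R w))) (at 0)"
      by (rule has_derivative_compose)
    then have "((\<lambda>t. diag_exp (t *\<^sub>R w)) has_vector_derivative ?D w) (at 0)"
      using linear_scale[OF has_derivative_linear[OF D]] by (simp add: has_vector_derivative_def)
    then show ?thesis
      using diag_exp_curve[OF that] vector_derivative_unique_at by blast
  qed
  ultimately show ?thesis using that by blast
qed

lemma smooth_map_diag_ln: "smooth_map sol_group diag_ln"
  by (rule smooth_on_open_imp_smooth_map[OF smooth_diag_ln]) (auto elim!: sol_groupE)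

lemma smooth_map_tri_adj: "smooth_map A tri_adj"
  by (rule smooth_on_open_imp_smooth_map[OF smooth_tri_adj]) simp

lemma smooth_map_diag_exp: "smooth_map A diag_exp"
  by (rule smooth_on_open_imp_smooth_map[OF smooth_diag_exp]) simp

lemma bounded_linear_left_mult: "bounded_linear ((**) a :: complex ^ 'n ^ 'n \<Rightarrow> complex ^ 'n ^ 'n)"
  by (rule matrix_mult.bounded_linear_right)

lemma bounded_linear_right_mult: "bounded_linear (\<lambda>X :: complex ^ 'n ^ 'n. X ** (a :: complex ^ 'n ^ 'n))"
  by (rule matrix_mult.bounded_linear_left)

context sol_ideal
begin

text \<open>Left translation to the identity followed by \<open>diag_ln\<close> is a single chart
  for the whole coset, with values in a vector space; it also settles connectedness and simple
  connectedness.\<close>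

lemma diffeomorphism_coset:
  assumes "p \<in> sol_group"
  shows "diffeomorphism (coset p) W (\<lambda>q. diag_ln (tri_adj p ** q))"
proof (rule diffeomorphismI[where g = "\<lambda>w. p ** diag_exp w"])
  have sub: "(**) (tri_adj p) ` coset p \<subseteq> sol_group"
    using coset_subset[OF assms] sol_group_mult sol_group_adj[OF assms] by auto
  show "smooth_map (coset p) (\<lambda>q. diag_ln (tri_adj p ** q))"
    by (rule smooth_map_compose[OF smooth_map_linear[OF bounded_linear_left_mult] smooth_map_diag_ln sub])
  show "smooth_map W (\<lambda>w. p ** diag_exp w)"
    by (rule smooth_map_compose[OF smooth_map_diag_exp smooth_map_linear[OF bounded_linear_left_mult]])
      (rule subset_UNIV)
  show "(\<lambda>q. diag_ln (tri_adj p ** q)) ` coset p \<subseteq> W"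
  proof
    fix w assume "w \<in> (\<lambda>q. diag_ln (tri_adj p ** q)) ` coset p"
    then obtain g where "g \<in> tri_group W" "w = diag_ln g"
      using assms by (auto simp: coset_def)
    then show "w \<in> W" using tri_group_subset tri_group_iff_diag_ln by blast
  qed
  show "(\<lambda>w. p ** diag_exp w) ` W \<subseteq> coset p" by (auto simp: coset_def tri_group_def)
  show "p ** diag_exp (diag_ln (tri_adj p ** q)) = q" if "q \<in> coset p" for q
    using subsetD[OF sub, of "tri_adj p ** q"] assms that by simp
  show "diag_ln (tri_adj p ** (p ** diag_exp w)) = w" if "w \<in> W" for w
    using subset_sol assms that by auto
qed

lemma submanifold_coset:
  assumes "p \<in> sol_group"
  shows "submanifold (dim W) (coset p)"
  unfolding submanifold_def
proof (intro ballI exI conjI)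
  show "openin (top_of_set (coset p)) (coset p)" "openin (top_of_set W) W" by simp_all
  show "diffeomorphism (coset p) W (\<lambda>q. diag_ln (tri_adj p ** q))"
    by (rule diffeomorphism_coset[OF assms])
qed (simp_all add: subspace)

lemma coset_homeomorphic_W:
  assumes "p \<in> sol_group"
  shows "coset p homeomorphic W"
  by (rule diffeomorphism_imp_homeomorphic[OF diffeomorphism_coset[OF assms]])

lemma simply_connected_coset:
  assumes "p \<in> sol_group"
  shows "simply_connected (coset p)"
  using homeomorphic_simply_connected_eq[OF coset_homeomorphic_W[OF assms]]
    convex_imp_simply_connected[OF subspace_imp_convex[OF subspace]] by simp

lemma connected_coset: "p \<in> sol_group \<Longrightarrow> connected (coset p)"
  by (rule simply_connected_imp_connected[OF simply_connected_coset])

text \<open>One inclusion differentiates the identity \<open>q = p ** diag_exp (f q)\<close>, where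
  f is the chart: the derivative of f takes tangent vectors into W, and there the derivative of
  \<open>diag_exp\<close> at 0 is the identity. The other is witnessed by the curves
  \<open>p ** diag_exp (t w)\<close>.\<close>

lemma tangent_space_coset_self:
  assumes p: "p \<in> sol_group"
  shows "tangent_space (coset p) p = (**) p ` W"
proof
  obtain D where D: "(diag_exp has_derivative D) (at 0)" "\<And>w. w \<in> sol_algebra \<Longrightarrow> D w = w"
    using diag_exp_has_derivative_0 by blast
  let ?f = "\<lambda>q. diag_ln (tri_adj p ** q)"
  have f: "smooth_map (coset p) ?f" "?f ` coset p = W"
    using diffeomorphism_coset[OF p] by (auto simp: diffeomorphism_def bij_betw_def)
  show "tangent_space (coset p) p \<subseteq> (**) p ` W"
  proof
    fix v assume v: "v \<in> tangent_space (coset p) p"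
    obtain f' where f': "(?f has_derivative f') (at p within coset p)"
      using smooth_map_has_derivative[OF f(1) self_in_coset[OF p]] by blast
    have W: "f' v \<in> W"
      by (rule has_derivative_tangent_in_subspace[OF f' v subspace]) (use f(2) in blast)
    have "?f p = 0" by (simp add: tri_adj_left[OF p] diag_ln_1)
    then have "(diag_exp has_derivative D) (at (?f p))" using D(1) by simp
    then have chain: "((\<lambda>q. p ** diag_exp (?f q)) has_derivative (\<lambda>v. p ** D (f' v))) (at p within coset p)"
      by (intro bounded_linear.has_derivative[OF bounded_linear_left_mult]
          has_derivative_compose[OF f'])
    have inv: "q = p ** diag_exp (?f q)" if "q \<in> coset p" for q
    proof -
      have "tri_adj p ** q \<in> sol_group"
        using coset_subset[OF p] that sol_group_mult sol_group_adj p by blast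
      then show ?thesis using p by simp
    qed
    have "((\<lambda>q. q) has_derivative (\<lambda>v. p ** D (f' v))) (at p within coset p)"
      by (rule has_derivative_transform[OF self_in_coset[OF p] inv chain])
    then have "v = p ** D (f' v)"
      using differential_eq[OF _ v] has_derivative_ident by metis
    also have "D (f' v) = f' v" using D(2) W subset_sol by blast
    finally show "v \<in> (**) p ` W" using W by blast
  qed
  show "(**) p ` W \<subseteq> tangent_space (coset p) p"
  proof
    fix v assume "v \<in> (**) p ` W"
    then obtain w where w: "w \<in> W" "v = p ** w" by blast
    let ?c = "\<lambda>t::real. p ** diag_exp (t *\<^sub>R w)"
    have "smooth_on_open {-1<..<1} (\<lambda>t::real. t *\<^sub>R w)"
      by (rule smooth_on_open_linear[OF smooth_on_open_id bounded_linear_scaleR_left]) simp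
    then have "smooth_on_open {-1<..<1} ?c"
      by (rule smooth_on_open_linear[OF smooth_on_open_compose[OF _ smooth_diag_exp]
            bounded_linear_left_mult]) simp
    moreover have "?c ` {-1<..<1} \<subseteq> coset p"
      using w(1) subspace_scale[OF subspace] by (auto simp: coset_def tri_group_def)
    moreover have "?c 0 = p" by (simp add: diag_exp_0)
    moreover have "(?c has_vector_derivative v) (at 0)"
      unfolding w(2) using w(1) subset_sol
      by (intro bounded_linear.has_vector_derivative[OF bounded_linear_left_mult] diag_exp_curve) auto
    ultimately show "v \<in> tangent_space (coset p) p"
      unfolding tangent_space_def by (intro CollectI exI[of _ ?c] exI[of _ 1]) simp
  qed
qed

lemma tangent_space_coset:
  assumes "p \<in> sol_group" "q \<in> coset p"
  shows "tangent_space (coset p) q = (**) q ` W"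
  using tangent_space_coset_self[of q] coset_eq[OF assms] coset_subset[OF assms(1)] assms(2) by auto

end

interpretation sol: sol_ideal sol_algebra
  by (rule sol_ideal_sol_algebra)

lemma sol_coset: "p \<in> sol_group \<Longrightarrow> sol.coset p = sol_group"
  using sol.coset_eq[OF sol_group_one, of p] sol.coset_one by (simp add: tri_group_sol)

lemma submanifold_sol_group: "submanifold (dim sol_algebra) sol_group"
  using sol.submanifold_coset[OF sol_group_one] by (simp add: sol_coset sol_group_one)

lemma tangent_space_sol_group: "p \<in> sol_group \<Longrightarrow> tangent_space sol_group p = (**) p ` sol_algebra"
  using sol.tangent_space_coset_self[of p] by (simp add: sol_coset)

section \<open>Left invariance of metric and distance\<close>

lemma metric_S_left_mult: "p \<in> sol_group \<Longrightarrow> metric_S p (p ** U) (p ** V) = inner_s U V"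
  by (simp add: metric_S_def matrix_inv_sol)

lemma metric_S_left_invariant:
  assumes "a \<in> sol_group" "p \<in> sol_group"
  shows "metric_S (a ** p) (a ** U) (a ** V) = metric_S p U V"
proof -
  have "metric_S (a ** p) (a ** p ** (tri_adj p ** U)) (a ** p ** (tri_adj p ** V)) =
      inner_s (tri_adj p ** U) (tri_adj p ** V)"
    by (rule metric_S_left_mult[OF sol_group_mult[OF assms]])
  moreover have "a ** p ** (tri_adj p ** X) = a ** X" for X :: "complex ^ 3 ^ 3"
    using assms(2) by (simp flip: matrix_mul_assoc)
  ultimately show ?thesis using assms(2) by (simp add: metric_S_def matrix_inv_sol)
qed

lemma riem_dist_left_mult_le:
  assumes a: "a \<in> sol_group"
    and "\<gamma> piecewise_C1_differentiable_on {0..1}" "path_image \<gamma> \<subseteq> sol_group"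
    and "((\<lambda>t. let v = vector_derivative \<gamma> (at t) in sqrt (metric_S (\<gamma> t) v v)) has_integral l) {0..1}"
  defines "\<delta> \<equiv> \<lambda>t. a ** \<gamma> t"
  shows "\<delta> piecewise_C1_differentiable_on {0..1} \<and> path_image \<delta> \<subseteq> sol_group \<and>
    ((\<lambda>t. let v = vector_derivative \<delta> (at t) in sqrt (metric_S (\<delta> t) v v)) has_integral l) {0..1}"
proof -
  obtain F D where F: "continuous_on {0..1} \<gamma>" "finite F"
    "\<And>t. t \<in> {0..1} - F \<Longrightarrow> (\<gamma> has_vector_derivative D t) (at t)" "continuous_on ({0..1} - F) D"
    using assms(2) unfolding piecewise_C1_differentiable_on_def C1_differentiable_on_def by blast
  have \<delta>: "(\<delta> has_vector_derivative a ** D t) (at t)" if "t \<in> {0..1} - F" for t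
    unfolding \<delta>_def by (rule bounded_linear.has_vector_derivative[OF bounded_linear_left_mult F(3)[OF that]])
  have "\<delta> piecewise_C1_differentiable_on {0..1}"
    unfolding piecewise_C1_differentiable_on_def C1_differentiable_on_def
  proof (intro conjI exI[of _ F] exI[of _ "\<lambda>t. a ** D t"] ballI)
    show "continuous_on {0..1} \<delta>" unfolding \<delta>_def
      by (rule bounded_linear.continuous_on[OF bounded_linear_left_mult F(1)])
    show "continuous_on ({0..1} - F) (\<lambda>t. a ** D t)"
      by (rule bounded_linear.continuous_on[OF bounded_linear_left_mult F(4)])
  qed (use F(2) \<delta> in auto)
  moreover have "path_image \<delta> \<subseteq> sol_group"
    using assms(3) sol_group_mult[OF a] by (auto simp: path_image_def \<delta>_def)
  moreover have "((\<lambda>t. let v = vector_derivative \<delta> (at t) in sqrt (metric_S (\<delta> t) v v)) has_integral l) {0..1}"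
  \<comment> \<open>At the finitely many points of F the curve need not be differentiable and
    \<open>vector_derivative\<close> carries no information; they do not affect the
    integral.\<close>
  proof (rule has_integral_spike_finite[OF F(2) _ assms(4)])
    fix t assume t: "t \<in> {0..1} - F"
    then have "vector_derivative \<delta> (at t) = a ** vector_derivative \<gamma> (at t)"
      using vector_derivative_at[OF \<delta>[OF t]] vector_derivative_at[OF F(3)[OF t]] by simp
    moreover have "\<gamma> t \<in> sol_group" using t assms(3) by (auto simp: path_image_def)
    ultimately show "(let v = vector_derivative \<delta> (at t) in sqrt (metric_S (\<delta> t) v v)) =
        (let v = vector_derivative \<gamma> (at t) in sqrt (metric_S (\<gamma> t) v v))"
      by (simp add: Let_def \<delta>_def metric_S_left_invariant[OF a])
  qed
  ultimately show ?thesis by blast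
qed

lemma riem_dist_left_mult:
  assumes a: "a \<in> sol_group"
  shows "riem_dist sol_group metric_S (a ** p) (a ** q) = riem_dist sol_group metric_S p q"
proof -
  let ?L = "\<lambda>p q. {l. \<exists>\<gamma>. \<gamma> piecewise_C1_differentiable_on {0..1} \<and> path_image \<gamma> \<subseteq> sol_group \<and>
      pathstart \<gamma> = p \<and> pathfinish \<gamma> = q \<and>
      ((\<lambda>t. let v = vector_derivative \<gamma> (at t) in sqrt (metric_S (\<gamma> t) v v)) has_integral l) {0..1}}"
  have le: "?L p q \<subseteq> ?L (b ** p) (b ** q)" if b: "b \<in> sol_group" for b p q
  proof
    fix l assume "l \<in> ?L p q"
    then obtain \<gamma> where \<gamma>: "\<gamma> piecewise_C1_differentiable_on {0..1}" "path_image \<gamma> \<subseteq> sol_group"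
      "pathstart \<gamma> = p" "pathfinish \<gamma> = q"
      "((\<lambda>t. let v = vector_derivative \<gamma> (at t) in sqrt (metric_S (\<gamma> t) v v)) has_integral l) {0..1}"
      by blast
    have "pathstart (\<lambda>t. b ** \<gamma> t) = b ** p" "pathfinish (\<lambda>t. b ** \<gamma> t) = b ** q"
      using \<gamma>(3,4) by (auto simp: pathstart_def pathfinish_def)
    then show "l \<in> ?L (b ** p) (b ** q)"
      using riem_dist_left_mult_le[OF b \<gamma>(1,2,5)] by (intro CollectI exI[of _ "\<lambda>t. b ** \<gamma> t"]) simp
  qed
  \<comment> \<open>The inclusion for a gives one direction, the inclusion for the inverse of a the
    other.\<close>
  have "?L (a ** p) (a ** q) = ?L p q"
    using le[OF a, of p q] le[OF sol_group_adj[OF a], of "a ** p" "a ** q"] a by simp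
  then show ?thesis unfolding riem_dist_def by simp
qed

lemma riem_dist_set_left_mult:
  "a \<in> sol_group \<Longrightarrow>
    riem_dist_set sol_group metric_S (a ** p) ((**) a ` L) = riem_dist_set sol_group metric_S p L"
  by (simp add: riem_dist_set_def image_image riem_dist_left_mult)

context sol_ideal
begin

lemma riem_dist_set_coset:
  assumes "p \<in> sol_group" "r \<in> sol_group" "q \<in> coset p"
  shows "riem_dist_set sol_group metric_S q (coset r) = riem_dist_set sol_group metric_S p (coset r)"
proof -
  \<comment> \<open>p and q lie in one left coset; by normality q p^{-1} belongs to the subgroup as
    well, hence maps the coset of r onto itself while moving p to q.\<close>
  let ?a = "q ** tri_adj p"
  have q: "q \<in> sol_group" "log_part q - log_part p \<in> W" using assms coset_iff by auto
  then have a: "?a \<in> sol_group" and log: "log_part ?a \<in> W"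
    using assms by (simp_all add: sol_group_mult sol_group_adj log_part_mult log_part_adj)
  have "?a ** r \<in> coset r"
    using assms(2) a log by (simp add: coset_iff sol_group_mult log_part_mult)
  then have "(**) ?a ` coset r = coset r"
    unfolding left_mult_coset by (rule coset_eq[OF assms(2)])
  moreover have "?a ** p = q" using assms(1) by simp
  ultimately show ?thesis using riem_dist_set_left_mult[OF a, of p "coset r"] by simp
qed

lemma equidistant_cosets:
  assumes "p \<in> sol_group" "r \<in> sol_group"
  shows "equidistant sol_group metric_S (coset p) (coset r)"
  unfolding equidistant_def
  using riem_dist_set_coset[OF assms] riem_dist_set_coset[OF assms(2,1)] by simp

lemma riem_isometric_cosets:
  assumes "p \<in> sol_group" "r \<in> sol_group"
  shows "riem_isometric (coset p) metric_S (coset r) metric_S"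
  unfolding riem_isometric_def
proof (intro exI conjI ballI)
  \<comment> \<open>Left translation by ?a sends p to r, hence one coset onto the other; ?b is the
    inverse element.\<close>
  let ?a = "r ** tri_adj p" and ?b = "p ** tri_adj r"
  have a: "?a \<in> sol_group" using assms by (simp add: sol_group_mult sol_group_adj)
  have ab: "?a ** (?b ** X) = X" "?b ** (?a ** X) = X" for X :: "complex ^ 3 ^ 3"
    using assms by (simp_all add: matrix_mul_assoc tri_adj_right)
  have "(**) ?a ` coset p = coset r" "(**) ?b ` coset r = coset p"
    unfolding left_mult_coset using assms by simp_all
  then show "diffeomorphism (coset p) (coset r) ((**) ?a)"
    using ab by (intro diffeomorphismI[where g = "(**) ?b"] smooth_map_linear bounded_linear_left_mult) auto
  fix q u v assume q: "q \<in> coset p" and uv: "u \<in> tangent_space (coset p) q" "v \<in> tangent_space (coset p) q"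
  have "((**) ?a has_derivative (**) ?a) (at q within coset p)"
    by (rule bounded_linear_imp_has_derivative[OF bounded_linear_left_mult])
  then have "differential (coset p) ((**) ?a) q u = ?a ** u" "differential (coset p) ((**) ?a) q v = ?a ** v"
    using uv differential_eq by blast+
  moreover have "q \<in> sol_group" using q coset_subset assms(1) by blast
  ultimately show "metric_S (?a ** q) (differential (coset p) ((**) ?a) q u)
      (differential (coset p) ((**) ?a) q v) = metric_S q u v"
    using metric_S_left_invariant[OF a] by simp
qed

end

section \<open>The foliation\<close>

lemma orthonormal_basis_expansion:
  assumes "orthonormal_basis V b B" "bounded_bilinear b" "u \<in> V"
  shows "u = (\<Sum>e\<in>B. b u e *\<^sub>R e)"
proof -
  interpret b: bounded_bilinear b by fact
  have B: "finite B" "span B = V" "\<And>e f. e \<in> B \<Longrightarrow> f \<in> B \<Longrightarrow> b e f = (if e = f then 1 else 0)"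
    using assms(1) by (auto simp: orthonormal_basis_def)
  have "u \<in> span B" using assms(3) B(2) by simp
  then obtain c where c: "u = (\<Sum>e\<in>B. c e *\<^sub>R e)" by (auto simp: span_finite[OF B(1)])
  have "b u f = c f" if "f \<in> B" for f
  proof -
    have "b u f = (\<Sum>e\<in>B. c e * b e f)" by (simp add: c b.sum_left b.scaleR_left)
    also have "\<dots> = (\<Sum>e\<in>B. if e = f then c e else 0)"
      using B(3) that by (intro sum.cong) auto
    finally show ?thesis using that B(1) by simp
  qed
  then show ?thesis using c by simp
qed

text \<open>The forms that occur, \<open>inner_s\<close> and \<open>metric_S p\<close>, are not the
  inner product of the type class and are definite only on a subspace, so these facts are derived
  for a general bounded bilinear form.\<close>

lemma orthonormal_basis_parseval:
  assumes "orthonormal_basis V b B" "bounded_bilinear b" "u \<in> V"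
  shows "b v u = (\<Sum>e\<in>B. b v e * b u e)"
proof -
  interpret b: bounded_bilinear b by fact
  have "b v u = b v (\<Sum>e\<in>B. b u e *\<^sub>R e)"
    using orthonormal_basis_expansion[OF assms] by simp
  then show ?thesis by (simp add: b.sum_right b.scaleR_right mult.commute)
qed

lemma orthonormal_basis_dim:
  assumes "orthonormal_basis V b B" "bounded_bilinear b"
  shows "dim V = card B"
proof -
  interpret b: bounded_bilinear b by fact
  have B: "finite B" "span B = V" "\<And>e f. e \<in> B \<Longrightarrow> f \<in> B \<Longrightarrow> b e f = (if e = f then 1 else 0)"
    using assms(1) by (auto simp: orthonormal_basis_def)
  have "c f = 0" if "(\<Sum>e\<in>B. c e *\<^sub>R e) = 0" "f \<in> B" for c f
  proof -
    have "0 = b (\<Sum>e\<in>B. c e *\<^sub>R e) f" by (simp add: that b.zero_left)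
    also have "\<dots> = (\<Sum>e\<in>B. c e * b e f)" by (simp add: b.sum_left b.scaleR_left)
    also have "\<dots> = (\<Sum>e\<in>B. if e = f then c e else 0)"
      using B(3) that(2) by (intro sum.cong) auto
    finally show ?thesis using that(2) B(1) by simp
  qed
  then have "independent B" by (auto simp: dependent_finite[OF B(1)])
  then show ?thesis using dim_span_eq_card_independent B(2) by metis
qed

text \<open>A basis over the reals: each of the three complex entries of \<nn> contributes the
  directions 1 and \<i>, both of unit length.\<close>

definition nil_basis :: "(complex ^ 3 ^ 3) set" where
  "nil_basis = {tri 0 0 0 1 0 0, tri 0 0 0 \<i> 0 0, tri 0 0 0 0 1 0, tri 0 0 0 0 \<i> 0,
     tri 0 0 0 0 0 1, tri 0 0 0 0 0 \<i>}"

lemma nil_expansion: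
  "tri 0 0 0 x y z = Re x *\<^sub>R tri 0 0 0 1 0 0 + Im x *\<^sub>R tri 0 0 0 \<i> 0 0 + Re y *\<^sub>R tri 0 0 0 0 1 0
     + Im y *\<^sub>R tri 0 0 0 0 \<i> 0 + Re z *\<^sub>R tri 0 0 0 0 0 1 + Im z *\<^sub>R tri 0 0 0 0 0 \<i>"
  by (simp add: tri_scaleR tri_add complex_eq_iff)

lemma nil_in_span: "tri 0 0 0 x y z \<in> span nil_basis"
  unfolding nil_expansion[of x y z]
  by (intro span_add span_scale span_base) (simp_all add: nil_basis_def)

text \<open>An orthonormal frame \<open>T, H\<close> of \<open>\<aa>\<close>, given by the diagonals. Together, the assumptions
  say that \<open>\<surd>2 (t\<^sub>1, t\<^sub>2, t\<^sub>3)\<close>, \<open>\<surd>2 (h\<^sub>1, h\<^sub>2, h\<^sub>3)\<close>, \<open>(1, 1, 1) / \<surd>3\<close> are the rows of an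
  orthogonal matrix.\<close>

locale diagonal_frame =
  fixes t1 t2 t3 h1 h2 h3 :: real
  assumes t_sum: "t1 + t2 + t3 = 0" and h_sum: "h1 + h2 + h3 = 0"
    and tt: "2 * (t1 * t1 + t2 * t2 + t3 * t3) = 1"
    and hh: "2 * (h1 * h1 + h2 * h2 + h3 * h3) = 1"
    and th: "t1 * h1 + t2 * h2 + t3 * h3 = 0"
    and c11: "t1 * t1 + h1 * h1 = 1 / 3" and c22: "t2 * t2 + h2 * h2 = 1 / 3"
    and c33: "t3 * t3 + h3 * h3 = 1 / 3" and c12: "t1 * t2 + h1 * h2 = - 1 / 6"
    and c13: "t1 * t3 + h1 * h3 = - 1 / 6" and c23: "t2 * t3 + h2 * h3 = - 1 / 6"
begin

definition T :: "complex ^ 3 ^ 3" where "T = tri t1 t2 t3 0 0 0"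
definition H :: "complex ^ 3 ^ 3" where "H = tri h1 h2 h3 0 0 0"
definition W :: "(complex ^ 3 ^ 3) set" where "W = {X \<in> sol_algebra. inner_s T X = 0}"

lemma T_in_sol: "T \<in> sol_algebra"
  by (simp add: T_def t_sum)

lemma inner_T_T: "inner_s T T = 1"
  using tt by (simp add: T_def inner_s_tri)

text \<open>\<open>c11\<close> to \<open>c33\<close> are the completeness relations of the frame. By
  them the projection of (a, b, c) to the span of T and H differs from it only by a multiple of a +
  b + c, which is 0.\<close>

lemma diagonal_expansion:
  assumes "a + b + c = 0"
  defines "r \<equiv> 2 * (a * t1 + b * t2 + c * t3)" and "s \<equiv> 2 * (a * h1 + b * h2 + c * h3)"
  shows "a = r * t1 + s * h1" "b = r * t2 + s * h2" "c = r * t3 + s * h3"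
proof -
  have "r * t1 + s * h1 = 2 * (a * (t1 * t1 + h1 * h1) + b * (t1 * t2 + h1 * h2) + c * (t1 * t3 + h1 * h3))"
    "r * t2 + s * h2 = 2 * (a * (t1 * t2 + h1 * h2) + b * (t2 * t2 + h2 * h2) + c * (t2 * t3 + h2 * h3))"
    "r * t3 + s * h3 = 2 * (a * (t1 * t3 + h1 * h3) + b * (t2 * t3 + h2 * h3) + c * (t3 * t3 + h3 * h3))"
    by (simp_all add: r_def s_def algebra_simps)
  then show "a = r * t1 + s * h1" "b = r * t2 + s * h2" "c = r * t3 + s * h3"
    unfolding c11 c12 c13 c22 c23 c33 using assms(1) by simp_all
qed

lemma W_eq: "W = {tri (s * h1) (s * h2) (s * h3) x y z | s x y z. True}"
proof
  show "W \<subseteq> {tri (s * h1) (s * h2) (s * h3) x y z | s x y z. True}"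
  proof
    fix X assume X: "X \<in> W"
    then obtain a b c x y z where eq: "X = tri a b c x y z" "a + b + c = 0"
      unfolding W_def by (blast elim: sol_algebraE)
    have r: "2 * (a * t1 + b * t2 + c * t3) = 0"
      using X by (simp add: W_def eq(1) T_def inner_s_tri algebra_simps)
    show "X \<in> {tri (s * h1) (s * h2) (s * h3) x y z | s x y z. True}"
      using diagonal_expansion[OF eq(2)] eq(1) unfolding r by auto
  qed
  have "s * h1 + s * h2 + s * h3 = 0" for s
    using h_sum by (simp flip: distrib_left)
  moreover have "t1 * (s * h1) + t2 * (s * h2) + t3 * (s * h3) = s * (t1 * h1 + t2 * h2 + t3 * h3)" for s
    by (simp add: algebra_simps)
  ultimately show "{tri (s * h1) (s * h2) (s * h3) x y z | s x y z. True} \<subseteq> W"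
    using th by (auto simp: W_def T_def inner_s_tri)
qed

sublocale sol_ideal W
proof
  show "subspace W"
    unfolding W_def subspace_def using subspace_sol_algebra
    by (auto simp: inner_s.add_right inner_s.scaleR_right inner_s.zero_right
        subspace_0 subspace_add subspace_scale)
  show "\<nn> \<subseteq> W" by (auto simp: \<nn>_eq_tri W_def T_def inner_s_tri)
  show "W \<subseteq> sol_algebra" by (auto simp: W_def)
qed

lemma S_H_eq_tri_group: "S_H H = tri_group W"
  by (simp add: H_def S_H_eq W_eq)

lemma S_H_eq_coset: "S_H H = coset (mat 1)"
  by (simp add: S_H_eq_tri_group coset_one)

definition flow_elem :: "real \<Rightarrow> complex ^ 3 ^ 3" where
  "flow_elem s = tri (exp (s * t1)) (exp (s * t2)) (exp (s * t3)) 0 0 0"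

lemma flow_eq: "flow T s = (\<lambda>q. q ** flow_elem s)"
  by (simp add: flow_def fun_eq_iff T_def tri_scaleR mat_exp_diagonal flow_elem_def)

lemma flow_elem_in_sol: "flow_elem s \<in> sol_group"
proof -
  have "s * t1 + s * t2 + s * t3 = 0" using t_sum by (simp flip: distrib_left)
  then show ?thesis by (simp add: flow_elem_def flip: exp_add)
qed

lemma flow_elem_add: "flow_elem r ** flow_elem s = flow_elem (r + s)"
  by (simp add: flow_elem_def tri_mult exp_add distrib_right)

lemma flow_elem_0: "flow_elem 0 = mat 1"
  by (simp add: flow_elem_def mat_1_eq_tri)

lemma flow_image_coset:
  "p \<in> sol_group \<Longrightarrow> flow T s ` coset p = coset (p ** flow_elem s)"
  unfolding flow_eq by (rule right_mult_coset[OF _ flow_elem_in_sol])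

lemma flow_image_S_H: "flow T s ` S_H H = coset (flow_elem s)"
  by (simp add: S_H_eq_coset flow_image_coset sol_group_one)

text \<open>T is diagonal, so pairing with T does not distinguish \<open>log_part\<close> from
  \<open>diag_ln\<close>. In the chart the leaves become level sets of a linear function, which
  yields both the partition and the slices.\<close>

lemma leaf_iff: "q \<in> coset (flow_elem s) \<longleftrightarrow> q \<in> sol_group \<and> inner_s T (diag_ln q) = s"
proof -
  have "log_part (flow_elem s) = s *\<^sub>R T"
    by (simp add: flow_elem_def T_def tri_scaleR)
  moreover have "log_part q \<in> sol_algebra" if "q \<in> sol_group"
    using sol.tri_group_iff[OF that] that by (simp add: tri_group_sol)
  moreover have "inner_s T (log_part q) = inner_s T (diag_ln q)"
    by (simp add: T_def diag_ln_def log_part_def inner_s_tri)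
  ultimately show ?thesis
    using coset_iff[OF flow_elem_in_sol, of q s] T_in_sol subspace_diff[OF subspace_sol_algebra]
      subspace_scale[OF subspace_sol_algebra]
    by (auto simp: W_def inner_s.diff_right inner_s.scaleR_right inner_T_T)
qed

lemma partition_leaves: "partition_on sol_group {coset (flow_elem s) | s. True}"
proof (rule partition_onI)
  show "\<Union>{coset (flow_elem s) | s. True} = sol_group" using leaf_iff by auto
  show "disjnt L L'" if "L \<in> {coset (flow_elem s) | s. True}" "L' \<in> {coset (flow_elem s) | s. True}" "L \<noteq> L'"
    for L L' using that leaf_iff by (auto simp: disjnt_iff)
  show "{} \<notin> {coset (flow_elem s) | s. True}"
    using self_in_coset[OF flow_elem_in_sol] by blast
qed

text \<open>In the global chart \<ss> splits orthogonally into W and the line of T; the second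
  coordinate is the leaf parameter.\<close>

lemma diffeomorphism_foliation_chart:
  "diffeomorphism sol_group (W \<times> UNIV)
     (\<lambda>q. (diag_ln q - inner_s T (diag_ln q) *\<^sub>R T, inner_s T (diag_ln q)))" (is "diffeomorphism _ _ ?\<psi>")
proof (rule diffeomorphismI[where g = "\<lambda>(w, s). diag_exp (w + s *\<^sub>R T)"])
  have lin: "bounded_linear (\<lambda>X. (X - inner_s T X *\<^sub>R T, inner_s T X))"
    by (intro bounded_linear_Pair bounded_linear_sub bounded_linear_ident
        bounded_linear_compose[OF bounded_linear_scaleR_left] inner_s.bounded_linear_right)
  show "smooth_map sol_group ?\<psi>"
    using smooth_map_compose[OF smooth_map_diag_ln smooth_map_linear[OF lin] subset_UNIV] by simp
  have "bounded_linear (\<lambda>y :: (complex ^ 3 ^ 3) \<times> real. fst y + snd y *\<^sub>R T)"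
    by (intro bounded_linear_add bounded_linear_fst bounded_linear_snd
        bounded_linear_compose[OF bounded_linear_scaleR_left])
  from smooth_map_compose[OF smooth_map_linear[OF this] smooth_map_diag_exp subset_UNIV]
  show "smooth_map (W \<times> UNIV) (\<lambda>(w, s). diag_exp (w + s *\<^sub>R T))"
    unfolding case_prod_unfold .
  have sol: "w + s *\<^sub>R T \<in> sol_algebra" if "w \<in> W" for w s
    using that T_in_sol subset_sol subspace_add[OF subspace_sol_algebra]
      subspace_scale[OF subspace_sol_algebra] by blast
  show "?\<psi> ` sol_group \<subseteq> W \<times> UNIV"
    using diag_ln_sol T_in_sol
    by (auto simp: W_def inner_s.diff_right inner_s.scaleR_right inner_T_T
        subspace_diff[OF subspace_sol_algebra] subspace_scale[OF subspace_sol_algebra])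
  show "(\<lambda>(w, s). diag_exp (w + s *\<^sub>R T)) ` (W \<times> UNIV) \<subseteq> sol_group"
    using sol diag_exp_sol by auto
  show "(case ?\<psi> q of (w, s) \<Rightarrow> diag_exp (w + s *\<^sub>R T)) = q" if "q \<in> sol_group" for q
    using that by simp
  show "?\<psi> (case y of (w, s) \<Rightarrow> diag_exp (w + s *\<^sub>R T)) = y" if "y \<in> W \<times> UNIV" for y
  proof -
    obtain w s where y: "y = (w, s)" by fastforce
    then have "inner_s T w = 0" using that by (simp add: W_def)
    then show ?thesis
      using sol that by (simp add: y inner_s.add_right inner_s.scaleR_right inner_T_T)
  qed
qed

abbreviation W_basis :: "(complex ^ 3 ^ 3) set" where "W_basis \<equiv> insert H nil_basis"

lemma H_not_nil: "H \<notin> nil_basis" "T \<notin> nil_basis" "T \<noteq> H"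
proof -
  show "H \<notin> nil_basis" "T \<notin> nil_basis" by (auto simp: H_def T_def nil_basis_def)
  show "T \<noteq> H" using tt th by (auto simp: H_def T_def)
qed

lemma card_bases: "card W_basis = 7" "card (insert T W_basis) = 8"
proof -
  have "card nil_basis = 6" by (simp add: nil_basis_def)
  moreover have "finite nil_basis" by (simp add: nil_basis_def)
  ultimately show "card W_basis = 7" "card (insert T W_basis) = 8" using H_not_nil by simp_all
qed

lemma orthonormal_nil_basis:
  assumes "e \<in> nil_basis"
  shows "f \<in> nil_basis \<Longrightarrow> inner_s e f = (if e = f then 1 else 0)"
    and "inner_s H e = 0" "inner_s e H = 0" "inner_s T e = 0" "inner_s e T = 0"
  using assms by (auto simp: nil_basis_def inner_s_tri H_def T_def)

lemma inner_H: "inner_s H H = 1" "inner_s T H = 0" "inner_s H T = 0"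
  using hh th by (simp_all add: H_def T_def inner_s_tri mult.commute)

lemma orthonormal_basis_W: "orthonormal_basis W inner_s W_basis"
  unfolding orthonormal_basis_def
proof (intro conjI)
  show "finite W_basis" by (simp add: nil_basis_def)
  show "\<forall>e\<in>W_basis. \<forall>f\<in>W_basis. inner_s e f = (if e = f then 1 else 0)"
    using orthonormal_nil_basis inner_H H_not_nil by auto
  show "span W_basis = W"
  proof
    have "H \<in> W" by (auto simp: W_eq H_def intro!: exI[of _ 1])
    moreover have "nil_basis \<subseteq> W" by (auto simp: nil_basis_def W_def T_def inner_s_tri)
    ultimately show "span W_basis \<subseteq> W" by (intro span_minimal subspace) auto
    show "W \<subseteq> span W_basis"
    proof
      fix X assume "X \<in> W"
      then obtain s x y z where "X = tri (s * h1) (s * h2) (s * h3) x y z" by (auto simp: W_eq)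
      then have X: "X = s *\<^sub>R H + tri 0 0 0 x y z" by (simp add: H_def tri_scaleR tri_add)
      have "tri 0 0 0 x y z \<in> span W_basis"
        using nil_in_span span_mono[OF subset_insertI] by blast
      moreover have "s *\<^sub>R H \<in> span W_basis" by (simp add: span_scale span_base)
      ultimately show "X \<in> span W_basis" unfolding X by (simp add: span_add)
    qed
  qed
qed

lemma sol_decomposition:
  assumes "X \<in> sol_algebra"
  shows "X - inner_s T X *\<^sub>R T \<in> W"
  using assms T_in_sol by (simp add: W_def inner_s.diff_right inner_s.scaleR_right inner_T_T
        subspace_diff[OF subspace_sol_algebra] subspace_scale[OF subspace_sol_algebra])

lemma orthonormal_basis_sol: "orthonormal_basis sol_algebra inner_s (insert T W_basis)"
  unfolding orthonormal_basis_def
proof (intro conjI)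
  show "finite (insert T W_basis)" by (simp add: nil_basis_def)
  show "\<forall>e\<in>insert T W_basis. \<forall>f\<in>insert T W_basis. inner_s e f = (if e = f then 1 else 0)"
    using orthonormal_nil_basis inner_H inner_T_T H_not_nil by auto
  have W: "span W_basis = W" using orthonormal_basis_W by (simp add: orthonormal_basis_def)
  show "span (insert T W_basis) = sol_algebra"
  proof
    have "W_basis \<subseteq> sol_algebra" using span_superset[of W_basis] subset_sol unfolding W by (rule order_trans)
    then show "span (insert T W_basis) \<subseteq> sol_algebra"
      using T_in_sol by (intro span_minimal subspace_sol_algebra) auto
    show "sol_algebra \<subseteq> span (insert T W_basis)"
    proof
      fix X assume "X \<in> sol_algebra"
      then have "X - inner_s T X *\<^sub>R T \<in> span W_basis" using sol_decomposition W by simp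
      then show "X \<in> span (insert T W_basis)" unfolding span_insert by blast
    qed
  qed
qed

lemma dim_W: "dim W = 7" and dim_sol: "dim sol_algebra = 8"
  using orthonormal_basis_dim[OF orthonormal_basis_W bounded_bilinear_inner_s]
    orthonormal_basis_dim[OF orthonormal_basis_sol bounded_bilinear_inner_s] card_bases by simp_all

text \<open>One chart with U = S serves at every point. Leaves are connected, so each is its own
  only component, and \<open>leaf_iff\<close> identifies it with a slice.\<close>

lemma codim_one_foliation_leaves: "codim_one_foliation sol_group {coset (flow_elem s) | s. True}"
  unfolding codim_one_foliation_def
proof (rule exI[of _ 7], intro conjI ballI)
  show "submanifold (Suc 7) sol_group" using submanifold_sol_group dim_sol by simp
  show "partition_on sol_group {coset (flow_elem s) | s. True}" by (rule partition_leaves)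
  show "connected L" if "L \<in> {coset (flow_elem s) | s. True}" for L
    using that connected_coset[OF flow_elem_in_sol] by auto
  fix p assume p: "p \<in> sol_group"
  let ?\<psi> = "\<lambda>q. (diag_ln q - inner_s T (diag_ln q) *\<^sub>R T, inner_s T (diag_ln q))"
  have comp: "\<exists>c\<in>UNIV. C = {q \<in> sol_group. snd (?\<psi> q) = c}"
    if L: "L \<in> {coset (flow_elem s) | s. True}" and C: "C \<in> components (L \<inter> sol_group)" for L C
  proof -
    obtain s where s: "L = coset (flow_elem s)" using L by blast
    have "L \<inter> sol_group = L" using s coset_subset[OF flow_elem_in_sol] by blast
    moreover have "components L = {L}"
      unfolding components_eq_sing_iff s
      using connected_coset[OF flow_elem_in_sol] self_in_coset[OF flow_elem_in_sol] by blast
    ultimately have "C = coset (flow_elem s)" using C s by simp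
    then show ?thesis using leaf_iff by auto
  qed
  show "\<exists>U V B I \<psi>. openin (top_of_set sol_group) U \<and> p \<in> U \<and>
     subspace (V :: (complex ^ 3 ^ 3) set) \<and> dim V = 7 \<and> openin (top_of_set V) B \<and> connected B \<and>
     open (I :: real set) \<and> connected I \<and> diffeomorphism U (B \<times> I) \<psi> \<and>
     (\<forall>L\<in>{coset (flow_elem s) | s. True}. \<forall>C\<in>components (L \<inter> U). \<exists>c\<in>I. C = {q \<in> U. snd (\<psi> q) = c})"
    using p diffeomorphism_foliation_chart comp subspace dim_W
      convex_connected[OF subspace_imp_convex[OF subspace]]
    by (intro exI[of _ sol_group] exI[of _ W] exI[of _ W] exI[of _ UNIV] exI[of _ ?\<psi>]) auto
qed

end

lemma diagonal_frame_angle: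
  "diagonal_frame (sin \<alpha> / 2 - cos \<alpha> / (2 * sqrt 3)) (cos \<alpha> / sqrt 3) (- sin \<alpha> / 2 - cos \<alpha> / (2 * sqrt 3))
     (cos \<alpha> / 2 + sin \<alpha> / (2 * sqrt 3)) (- sin \<alpha> / sqrt 3) (- cos \<alpha> / 2 + sin \<alpha> / (2 * sqrt 3))"
proof -
  \<comment> \<open>m and n absorb sqrt 3, so the conditions of the frame turn into polynomial
    identities in s, c, m, n that follow from the quadratic relations below.\<close>
  define s c m n where "s = sin \<alpha>" "c = cos \<alpha>" "m = cos \<alpha> / sqrt 3" "n = sin \<alpha> / sqrt 3"
  note defs = this
  have sc: "c * c = 1 - s * s"
    using sin_cos_squared_add[of \<alpha>] by (simp add: defs power2_eq_square)
  moreover have "m * m = (1 - s * s) / 3" using sc by (simp add: defs)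
  moreover have "n * n = s * s / 3" "m * n = s * c / 3" "c * n = s * m" by (simp_all add: defs)
  ultimately have "diagonal_frame (s / 2 - m / 2) m (- s / 2 - m / 2) (c / 2 + n / 2) (- n) (- c / 2 + n / 2)"
    by unfold_locales (simp_all add: field_simps)
  moreover have "cos \<alpha> / (2 * sqrt 3) = m / 2" "cos \<alpha> / sqrt 3 = m" "sin \<alpha> / (2 * sqrt 3) = n / 2" "- sin \<alpha> / sqrt 3 = - n"
    by (simp_all add: defs)
  ultimately show ?thesis by (simp only: defs(1,2))
qed

section \<open>The Damek-Ricci space\<close>

lemma tri_uminus: "- tri a b c x y z = tri (- a) (- b) (- c) (- x) (- y) (- z)"
  by (simp add: matrix_3_eq_iff)

lemma (in sol_ideal) subgroup_tri_group: "subgroup (tri_group W) GL_group"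
  by (rule subgroup_GL_I[OF tri_group_subset one_in_tri_group mult_in_tri_group adj_in_tri_group])

lemma derived_subset:
  assumes "K \<subseteq> sol_group" "subgroup U GL_group"
    and "\<And>p q. p \<in> K \<Longrightarrow> q \<in> K \<Longrightarrow> p ** q ** tri_adj p ** tri_adj q \<in> U"
  shows "derived GL_group K \<subseteq> U"
  unfolding derived_def
proof (rule group.generate_subgroup_incl[OF group_GL _ assms(2)])
  show "derived_set GL_group K \<subseteq> U"
  proof
    fix h assume "h \<in> derived_set GL_group K"
    then obtain p q where pq: "p \<in> K" "q \<in> K"
      "h = p \<otimes>\<^bsub>GL_group\<^esub> q \<otimes>\<^bsub>GL_group\<^esub> inv\<^bsub>GL_group\<^esub> p \<otimes>\<^bsub>GL_group\<^esub> inv\<^bsub>GL_group\<^esub> q"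
      by blast
    then have "h = p ** q ** tri_adj p ** tri_adj q"
      using assms(1) by (simp add: inv_GL_sol subset_iff) (simp add: GL_group_def)
    then show "h \<in> U" using assms(3) pq by simp
  qed
qed

lemma unipotent_subset: "unipotent_group \<subseteq> sol_group"
  by (auto simp: unipotent_group_def)

text \<open>Diagonals commute and cancel in a commutator. With inverses written as adjugates, each
  diagonal entry is the product of the two determinants, which are 1.\<close>

lemma derived_sol: "derived GL_group sol_group \<subseteq> unipotent_group"
proof (rule derived_subset[OF order_refl subgroup_unipotent])
  fix p q assume p: "p \<in> sol_group" and q: "q \<in> sol_group"
  obtain a b c x y z where p: "p = tri a b c x y z" "a * b * c = 1" using p by (rule sol_groupE)
  obtain a' b' c' x' y' z' where q: "q = tri a' b' c' x' y' z'" "a' * b' * c' = 1" using q by (rule sol_groupE)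
  have "(a * a') * (b * c) * (b' * c') = (a * b * c) * (a' * b' * c')"
    "(b * b') * (a * c) * (a' * c') = (a * b * c) * (a' * b' * c')"
    "(c * c') * (a * b) * (a' * b') = (a * b * c) * (a' * b' * c')" by simp_all
  then show "p ** q ** tri_adj p ** tri_adj q \<in> unipotent_group"
    using p(2) q(2) by (simp add: p(1) q(1) tri_adj_tri tri_mult unipotent_group_def)
qed

definition center_group :: "(complex ^ 3 ^ 3) set" where
  "center_group = {tri 1 1 1 0 0 z | z. True}"

lemma subgroup_center: "subgroup center_group GL_group"
  by (rule subgroup_GL_I) (auto simp: center_group_def mat_1_eq_tri tri_mult tri_adj_tri)

lemma derived_unipotent: "derived GL_group unipotent_group \<subseteq> center_group"
  by (rule derived_subset[OF unipotent_subset subgroup_center])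
    (auto simp: unipotent_group_def center_group_def tri_mult tri_adj_tri)

lemma derived_center: "derived GL_group center_group \<subseteq> {mat 1}"
  by (rule derived_subset)
    (auto simp: center_group_def tri_mult tri_adj_tri mat_1_eq_tri
      intro: subgroup_GL_I[of "{tri 1 1 1 0 0 0}"])

text \<open>The derived series is bounded by the chain S, N, centre of N, 1, so three derivations
  suffice. It is computed in \<open>GL_group\<close> and transferred to the group with carrier G,
  where the derived sets of subsets of G agree.\<close>

lemma solvable_subgroup_sol:
  assumes "subgroup G GL_group" "G \<subseteq> sol_group"
  shows "solvable (GL_group\<lparr>carrier := G\<rparr>)"
proof -
  let ?d = "derived (GL_group :: (complex ^ 3 ^ 3) monoid)"
  let ?d' = "derived (GL_group\<lparr>carrier := G\<rparr>)"
  have con: "?d' K = ?d K" if "K \<subseteq> G" for K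
    using group.derived_consistent[OF group_GL that assms(1)] .
  have incl: "?d K \<subseteq> G" if "K \<subseteq> G" for K
    using group.derived_incl[OF group_GL that assms(1)] .
  have mono: "?d K \<subseteq> ?d L" if "K \<subseteq> L" for K L
    using group.mono_derived[OF group_GL that] .
  have "?d (?d (?d G)) \<subseteq> ?d (?d (?d sol_group))" using mono assms(2) by simp
  also have "\<dots> \<subseteq> ?d (?d unipotent_group)" using mono derived_sol by simp
  also have "\<dots> \<subseteq> ?d center_group" using mono derived_unipotent by simp
  also have "\<dots> \<subseteq> {mat 1}" by (rule derived_center)
  finally have le: "?d (?d (?d G)) \<subseteq> {mat 1}" .
  have "\<one>\<^bsub>GL_group\<^esub> \<in> ?d (?d (?d G))" unfolding derived_def by (rule generate.one)
  then have "?d (?d (?d G)) = {\<one>\<^bsub>GL_group\<^esub>}" using le by (auto simp: GL_group_def)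
  then have "(?d' ^^ 3) G = {\<one>\<^bsub>GL_group\<^esub>}"
    by (simp add: numeral_3_eq_3 con incl)
  then show ?thesis
    using group.solvable_iff_trivial_derived_seq[OF group.subgroup_imp_group[OF group_GL assms(1)]]
    by (intro iffD2[OF group.solvable_iff_trivial_derived_seq[OF group.subgroup_imp_group[OF group_GL assms(1)]]] exI[of _ 3]) simp
qed

lemma metric_S_one: "metric_S (mat 1) = inner_s"
  using metric_S_left_mult[OF sol_group_one] by (simp add: fun_eq_iff)

text \<open>The diagonal D contributes twice the real part of the trace of D^2, which is a sum of
  squares because D is real on \<ss>.\<close>

lemma inner_s_pos:
  assumes "X \<in> sol_algebra" "X \<noteq> 0"
  shows "0 < inner_s X X"
proof -
  obtain a b c x y z where X: "X = tri a b c x y z" using assms(1) by (rule sol_algebraE)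
  have "inner_s X X = (Re x)\<^sup>2 + (Im x)\<^sup>2 + (Re y)\<^sup>2 + (Im y)\<^sup>2 + (Re z)\<^sup>2 + (Im z)\<^sup>2 + 2 * (a\<^sup>2 + b\<^sup>2 + c\<^sup>2)"
    by (simp add: X inner_s_tri power2_eq_square)
  moreover have "0 \<le> r\<^sup>2" "r \<noteq> 0 \<Longrightarrow> 0 < r\<^sup>2" for r :: real by simp_all
  moreover have "a \<noteq> 0 \<or> b \<noteq> 0 \<or> c \<noteq> 0 \<or> Re x \<noteq> 0 \<or> Im x \<noteq> 0 \<or> Re y \<noteq> 0 \<or> Im y \<noteq> 0 \<or> Re z \<noteq> 0 \<or> Im z \<noteq> 0"
    using assms(2) by (auto simp: X zero_eq_tri complex_eq_iff)
  ultimately show ?thesis by (smt (verit))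
qed

lemma inner_s_commute: "X \<in> sol_algebra \<Longrightarrow> Y \<in> sol_algebra \<Longrightarrow> inner_s X Y = inner_s Y X"
  by (auto elim!: sol_algebraE simp: inner_s_tri)

lemma (in sol_ideal) left_invariant_tri_group: "left_invariant_on (tri_group W) metric_S"
  unfolding left_invariant_on_def inner_product_on_def metric_S_one
proof (intro conjI ballI allI impI)
  have tan: "tangent_space (tri_group W) (mat 1) = W"
    using tangent_space_coset_self[OF sol_group_one] by (simp add: coset_one)
  show "inner_s u v = inner_s v u"
    if "u \<in> tangent_space (tri_group W) (mat 1)" "v \<in> tangent_space (tri_group W) (mat 1)" for u v
    using that subset_sol inner_s_commute unfolding tan by blast
  show "0 < inner_s u u" if "u \<in> tangent_space (tri_group W) (mat 1)" "u \<noteq> 0" for u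
    using that subset_sol inner_s_pos unfolding tan by blast
  show "metric_S (a ** p) (a ** u) (a ** v) = metric_S p u v"
    if "a \<in> tri_group W" "p \<in> tri_group W" for a p u v
    using that tri_group_subset metric_S_left_invariant by blast
qed (simp_all add: inner_s.add_left inner_s.scaleR_left)

text \<open>\<vv> consists of the entries (1,2) and (2,3), \<zz> of the entry (1,3); on them the
  roots take the values 1/2, 1/2 and 1 at diag(1/2, 0, -1/2).\<close>

lemma (in sol_ideal) damek_ricci_tri_group:
  assumes W: "W = {tri (s / 2) 0 (- s / 2) x y z | s x y z. True}"
  shows "damek_ricci_space (tri_group W) metric_S"
proof -
  let ?v = "{tri 0 0 0 x y 0 | x y. True}" and ?z = "{tri 0 0 0 0 0 z | z. True}"
  let ?H = "tri (1 / 2) 0 (- 1 / 2) 0 0 0"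
  have tan: "tangent_space (tri_group W) (mat 1) = {U + Z + t *\<^sub>R ?H | U Z t. U \<in> ?v \<and> Z \<in> ?z}"
  proof -
    have W_tan: "tangent_space (tri_group W) (mat 1) = W"
      using tangent_space_coset_self[OF sol_group_one] by (simp add: coset_one)
    have W_iff: "X \<in> W \<longleftrightarrow> (\<exists>U Z t. X = U + Z + t *\<^sub>R ?H \<and> U \<in> ?v \<and> Z \<in> ?z)" for X
    proof
      assume "X \<in> W"
      then obtain s x y z where "X = tri (s / 2) 0 (- s / 2) x y z" unfolding W by blast
      then have "X = tri 0 0 0 x y 0 + tri 0 0 0 0 0 z + s *\<^sub>R ?H" by (simp add: tri_add tri_scaleR)
      then show "\<exists>U Z t. X = U + Z + t *\<^sub>R ?H \<and> U \<in> ?v \<and> Z \<in> ?z" by blast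
    next
      assume "\<exists>U Z t. X = U + Z + t *\<^sub>R ?H \<and> U \<in> ?v \<and> Z \<in> ?z"
      then obtain x y z t where "X = tri 0 0 0 x y 0 + tri 0 0 0 0 0 z + t *\<^sub>R ?H" by blast
      then have "X = tri (t / 2) 0 (- t / 2) x y z" by (simp add: tri_add tri_scaleR)
      then show "X \<in> W" unfolding W by blast
    qed
    show ?thesis
      unfolding W_tan set_eq_iff by (simp only: W_iff mem_Collect_eq simp_thms)
  qed
  have J: "\<exists>J. linear J \<and> J ` ?v \<subseteq> ?v \<and>
      (\<forall>U1\<in>?v. \<forall>U2\<in>?v. inner_s (J U1) U2 = inner_s Z (commutator U1 U2)) \<and>
      (\<forall>U\<in>?v. J (J U) = - inner_s Z Z *\<^sub>R U)" if "Z \<in> ?z" for Z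
  proof -
    obtain \<zeta> where Z: "Z = tri 0 0 0 0 0 \<zeta>" using \<open>Z \<in> ?z\<close> by blast
    \<comment> \<open>Solving for J in Re (\<zeta> cnj (x1 y2 - x2 y1)) gives (x, y) \<mapsto> (-
      \<zeta> cnj y, \<zeta> cnj x). The conjugations make its square the scalar - |\<zeta>|^2
      rather than - \<zeta>^2.\<close>
    let ?J = "\<lambda>X :: complex ^ 3 ^ 3. tri 0 0 0 (- \<zeta> * cnj (X $ 2 $ 3)) (\<zeta> * cnj (X $ 1 $ 2)) 0"
    have "\<zeta> * cnj \<zeta> = of_real (inner_s Z Z)"
      by (simp add: Z inner_s_tri complex_mult_cnj power2_eq_square)
    then have sq: "\<zeta> * (cnj \<zeta> * x) = of_real (inner_s Z Z) * x" for x
      by (simp flip: mult.assoc)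
    have "linear ?J" by (rule linearI) (simp_all add: tri_add tri_scaleR algebra_simps)
    moreover have "?J ` ?v \<subseteq> ?v" by auto
    moreover have "\<forall>U1\<in>?v. \<forall>U2\<in>?v. inner_s (?J U1) U2 = inner_s Z (commutator U1 U2)"
      by (auto simp: Z commutator_def tri_mult tri_diff inner_s_tri algebra_simps)
    moreover have "\<forall>U\<in>?v. ?J (?J U) = - inner_s Z Z *\<^sub>R U"
      by (auto simp: sq tri_scaleR scaleR_conv_of_real[where 'a = complex] tri_uminus)
    ultimately show ?thesis by blast
  qed
  show ?thesis
    unfolding damek_ricci_space_def Let_def metric_S_one
  proof (intro conjI)
    show "subgroup (tri_group W) GL_group" by (rule subgroup_tri_group)
    show "\<exists>d. submanifold d (tri_group W)"
      using submanifold_coset[OF sol_group_one] by (auto simp: coset_one)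
    show "simply_connected (tri_group W)"
      using simply_connected_coset[OF sol_group_one] by (simp add: coset_one)
    show "solvable (GL_group\<lparr>carrier := tri_group W\<rparr>)"
      by (rule solvable_subgroup_sol[OF subgroup_tri_group tri_group_subset])
    show "left_invariant_on (tri_group W) metric_S" by (rule left_invariant_tri_group)
    have "subspace ?v" "subspace ?z"
      by (auto simp: subspace_def zero_eq_tri tri_add tri_scaleR)
    note sub = this
    show "\<exists>\<vv> \<zz> H. subspace \<vv> \<and> subspace \<zz> \<and>
        tangent_space (tri_group W) (mat 1) = {U + Z + t *\<^sub>R H | U Z t. U \<in> \<vv> \<and> Z \<in> \<zz>} \<and>
        (\<forall>U\<in>\<vv>. \<forall>Z\<in>\<zz>. inner_s U Z = 0) \<and> (\<forall>U\<in>\<vv>. inner_s U H = 0) \<and> (\<forall>Z\<in>\<zz>. inner_s Z H = 0) \<and>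
        inner_s H H = 1 \<and>
        (\<forall>U\<^sub>1\<in>\<vv>. \<forall>U\<^sub>2\<in>\<vv>. commutator U\<^sub>1 U\<^sub>2 \<in> \<zz>) \<and>
        (\<forall>U\<in>\<vv>. \<forall>Z\<in>\<zz>. commutator U Z = 0) \<and>
        (\<forall>Z\<^sub>1\<in>\<zz>. \<forall>Z\<^sub>2\<in>\<zz>. commutator Z\<^sub>1 Z\<^sub>2 = 0) \<and>
        (\<forall>Z\<in>\<zz>. \<exists>J. linear J \<and> J ` \<vv> \<subseteq> \<vv> \<and>
           (\<forall>U\<^sub>1\<in>\<vv>. \<forall>U\<^sub>2\<in>\<vv>. inner_s (J U\<^sub>1) U\<^sub>2 = inner_s Z (commutator U\<^sub>1 U\<^sub>2)) \<and>
           (\<forall>U\<in>\<vv>. J (J U) = - (inner_s Z Z) *\<^sub>R U)) \<and>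
        (\<forall>U\<in>\<vv>. commutator H U = (1/2) *\<^sub>R U) \<and>
        (\<forall>Z\<in>\<zz>. commutator H Z = Z)"
    proof (rule exI[of _ ?v], rule exI[of _ ?z], rule exI[of _ ?H], intro conjI)
      show "subspace ?v" "subspace ?z" by (rule sub)+
      show "tangent_space (tri_group W) (mat 1) = {U + Z + t *\<^sub>R ?H | U Z t. U \<in> ?v \<and> Z \<in> ?z}"
        by (rule tan)
      show "\<forall>Z\<in>?z. \<exists>J. linear J \<and> J ` ?v \<subseteq> ?v \<and>
           (\<forall>U1\<in>?v. \<forall>U2\<in>?v. inner_s (J U1) U2 = inner_s Z (commutator U1 U2)) \<and>
           (\<forall>U\<in>?v. J (J U) = - (inner_s Z Z) *\<^sub>R U)"
        using J by (rule ballI)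
    qed (auto simp: inner_s_tri commutator_def tri_mult tri_diff tri_scaleR zero_eq_tri
        scaleR_conv_of_real[where 'a = complex])
  qed
qed

section \<open>Minimality\<close>

text \<open>The representing vector is the sum of the basis vectors e weighted by F e. It supplies
  the existence that the definite description in \<open>levi_civita\<close> requires.\<close>

lemma riesz_on:
  assumes "orthonormal_basis V b B" "bounded_bilinear b" "linear F"
    and sym: "\<And>u v. u \<in> V \<Longrightarrow> v \<in> V \<Longrightarrow> b u v = b v u"
  obtains w where "w \<in> V" "\<And>v. v \<in> V \<Longrightarrow> b w v = F v"
proof
  interpret b: bounded_bilinear b by fact
  have V: "V = span B" using assms(1) by (simp add: orthonormal_basis_def)
  let ?w = "\<Sum>e\<in>B. F e *\<^sub>R e"
  show "?w \<in> V" unfolding V by (intro span_sum span_scale span_base)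
  show "b ?w v = F v" if "v \<in> V" for v
  proof -
    have "F v = F (\<Sum>e\<in>B. b v e *\<^sub>R e)"
      using orthonormal_basis_expansion[OF assms(1,2) that] by simp
    also have "\<dots> = (\<Sum>e\<in>B. b v e * F e)" by (simp add: linear_sum[OF assms(3)] linear_scale[OF assms(3)])
    also have "\<dots> = (\<Sum>e\<in>B. F e * b e v)"
      using sym[OF that] V by (intro sum.cong) (simp_all add: span_base)
    finally show ?thesis by (simp add: b.sum_left b.scaleR_left)
  qed
qed

lemma ex_orthonormal_basis_sol: "\<exists>B. orthonormal_basis sol_algebra inner_s B"
  using diagonal_frame.orthonormal_basis_sol[OF diagonal_frame_angle] by blast

section \<open>The Levi-Civita connection in a left-invariant frame\<close>

lemma commutator_add_right: "commutator X (Y + Z) = commutator X Y + commutator X Z"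
  by (simp add: commutator_def matrix_mult.add_left matrix_mult.add_right)

lemma commutator_scaleR_right: "commutator X (r *\<^sub>R Y) = r *\<^sub>R commutator X Y"
  by (simp add: commutator_def matrix_mult.scaleR_left matrix_mult.scaleR_right scaleR_diff_right)

text \<open>The Koszul formula for left-invariant fields with values \<open>\<xi>\<close>, \<open>\<eta>\<close>, \<open>\<zeta>\<close> at the identity.\<close>

definition koszul_inv :: "complex ^ 3 ^ 3 \<Rightarrow> complex ^ 3 ^ 3 \<Rightarrow> complex ^ 3 ^ 3 \<Rightarrow> real" where
  "koszul_inv \<xi> \<eta> \<zeta> =
     (inner_s (commutator \<xi> \<eta>) \<zeta> - inner_s (commutator \<xi> \<zeta>) \<eta> - inner_s (commutator \<eta> \<zeta>) \<xi>) / 2"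

text \<open>This is the functional that a covariant derivative has to represent; \<theta> stands for
  the derivative of the components of the differentiated field.\<close>

lemma linear_koszul_inv: "linear (\<lambda>\<zeta>. inner_s \<theta> \<zeta> + koszul_inv \<xi> \<eta> \<zeta>)"
  by (rule linearI)
    (simp_all add: koszul_inv_def commutator_add_right commutator_scaleR_right inner_s.add_left
      inner_s.add_right inner_s.scaleR_left inner_s.scaleR_right field_simps)

text \<open>Left translation trivializes the tangent bundle, and \<xi> is the component function of
  X in the fixed space \<ss>. Its derivative is recorded at p alone, where the Koszul formula is
  evaluated.\<close>

definition frame_field ::
  "(complex ^ 3 ^ 3) set \<Rightarrow> (complex ^ 3 ^ 3 \<Rightarrow> complex ^ 3 ^ 3) \<Rightarrow> complex ^ 3 ^ 3 \<Rightarrow>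
   (complex ^ 3 ^ 3 \<Rightarrow> complex ^ 3 ^ 3) \<Rightarrow> (complex ^ 3 ^ 3 \<Rightarrow> complex ^ 3 ^ 3) \<Rightarrow> bool" where
  "frame_field M X p \<xi> \<xi>' \<longleftrightarrow>
     (\<forall>q\<in>M. X q = q ** \<xi> q \<and> \<xi> q \<in> sol_algebra) \<and> (\<xi> has_derivative \<xi>') (at p within M)"

text \<open>\<open>second_fundamental_form\<close> admits fields on any neighbourhood U of p, so the
  connection has to be computed on the open piece of S inside U.\<close>

locale sol_open =
  fixes U :: "(complex ^ 3 ^ 3) set" and p :: "complex ^ 3 ^ 3"
  assumes open_U: "open U" and p_U: "p \<in> U" and p_sol: "p \<in> sol_group"
begin

abbreviation "M \<equiv> sol_group \<inter> U"

lemma p_M: "p \<in> M" using p_U p_sol by simp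

lemma tangent_space_M: "q \<in> M \<Longrightarrow> tangent_space M q = (**) q ` sol_algebra"
  using tangent_space_local[OF open_U, of q sol_group] tangent_space_sol_group[of q] by simp

text \<open>The components are smooth because \<open>tri_adj\<close> is polynomial and agrees with
  the inverse on S.\<close>

lemma vector_field_frame:
  assumes "vector_field M X"
  obtains \<xi> \<xi>' where "frame_field M X p \<xi> \<xi>'"
proof -
  let ?\<xi> = "\<lambda>q. tri_adj q ** X q"
  have X: "smooth_map M X" "\<And>q. q \<in> M \<Longrightarrow> X q \<in> tangent_space M q"
    using assms by (auto simp: vector_field_def)
  have "smooth_map M ?\<xi>"
    by (rule smooth_map_bilinear[OF smooth_map_tri_adj X(1) bounded_bilinear_matrix_mult])
  then obtain \<xi>' where "(?\<xi> has_derivative \<xi>') (at p within M)"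
    using smooth_map_has_derivative[OF _ p_M] by blast
  moreover have "X q = q ** ?\<xi> q \<and> ?\<xi> q \<in> sol_algebra" if "q \<in> M" for q
    using X(2)[OF that] that unfolding tangent_space_M[OF that] by auto
  ultimately have "frame_field M X p ?\<xi> \<xi>'" unfolding frame_field_def by blast
  then show ?thesis by (rule that)
qed

lemma invariant_vector_field:
  assumes "\<zeta> \<in> sol_algebra"
  shows "vector_field M (\<lambda>q. q ** \<zeta>)" "frame_field M (\<lambda>q. q ** \<zeta>) p (\<lambda>q. \<zeta>) (\<lambda>v. 0)"
  using assms tangent_space_M
  by (auto simp: vector_field_def frame_field_def intro!: smooth_map_linear bounded_linear_right_mult)

lemma frame_derivative_in_sol:
  assumes "frame_field M X p \<xi> \<xi>'" "v \<in> tangent_space M p"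
  shows "\<xi>' v \<in> sol_algebra"
proof (rule has_derivative_tangent_in_subspace[OF _ assms(2) subspace_sol_algebra])
  show "(\<xi> has_derivative \<xi>') (at p within M)" using assms(1) by (simp add: frame_field_def)
  show "\<xi> q \<in> sol_algebra" if "q \<in> M" for q using assms(1) that by (simp add: frame_field_def)
qed

lemma differential_frame:
  assumes "frame_field M X p \<xi> \<xi>'" "v \<in> tangent_space M p"
  shows "differential M X p v = v ** \<xi> p + p ** \<xi>' v"
proof -
  have \<xi>: "(\<xi> has_derivative \<xi>') (at p within M)" and eq: "\<And>q. q \<in> M \<Longrightarrow> X q = q ** \<xi> q"
    using assms(1) by (auto simp: frame_field_def)
  have prod: "((\<lambda>q. q ** \<xi> q) has_derivative (\<lambda>v. p ** \<xi>' v + v ** \<xi> p)) (at p within M)"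
    by (rule bounded_bilinear.FDERIV[OF bounded_bilinear_matrix_mult has_derivative_ident \<xi>])
  have "(X has_derivative (\<lambda>v. p ** \<xi>' v + v ** \<xi> p)) (at p within M)"
    by (rule has_derivative_transform[OF p_M eq prod])
  from differential_eq[OF this assms(2)] show ?thesis by (simp add: add.commute)
qed

lemma differential_metric:
  assumes "frame_field M Y p \<eta> \<eta>'" "frame_field M Z p \<zeta> \<zeta>'" "v \<in> tangent_space M p"
  shows "differential M (\<lambda>q. metric_S q (Y q) (Z q)) p v = inner_s (\<eta> p) (\<zeta>' v) + inner_s (\<eta>' v) (\<zeta> p)"
proof -
  have d: "(\<eta> has_derivative \<eta>') (at p within M)" "(\<zeta> has_derivative \<zeta>') (at p within M)"
    using assms by (auto simp: frame_field_def)
  have eq: "metric_S q (Y q) (Z q) = inner_s (\<eta> q) (\<zeta> q)" if "q \<in> M" for q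
    using assms(1,2) that by (simp add: frame_field_def metric_S_left_mult)
  have prod: "((\<lambda>q. inner_s (\<eta> q) (\<zeta> q)) has_derivative (\<lambda>v. inner_s (\<eta> p) (\<zeta>' v) + inner_s (\<eta>' v) (\<zeta> p)))
      (at p within M)"
    by (rule bounded_bilinear.FDERIV[OF bounded_bilinear_inner_s d])
  have "((\<lambda>q. metric_S q (Y q) (Z q)) has_derivative
      (\<lambda>v. inner_s (\<eta> p) (\<zeta>' v) + inner_s (\<eta>' v) (\<zeta> p))) (at p within M)"
    by (rule has_derivative_transform[OF p_M eq prod])
  from differential_eq[OF this assms(3)] show ?thesis .
qed

lemma frame_field_at_p:
  assumes "frame_field M X p \<xi> \<xi>'"
  shows "X p = p ** \<xi> p" "\<xi> p \<in> sol_algebra" "X p \<in> tangent_space M p"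
  using assms p_M tangent_space_M[OF p_M] by (auto simp: frame_field_def)

lemma lie_bracket_frame:
  assumes "frame_field M X p \<xi> \<xi>'" "frame_field M Y p \<eta> \<eta>'"
  shows "lie_bracket M X Y p = p ** (commutator (\<xi> p) (\<eta> p) + \<eta>' (X p) - \<xi>' (Y p))"
proof -
  note X = frame_field_at_p[OF assms(1)] and Y = frame_field_at_p[OF assms(2)]
  have "lie_bracket M X Y p =
      (X p ** \<eta> p + p ** \<eta>' (X p)) - (Y p ** \<xi> p + p ** \<xi>' (Y p))"
    unfolding lie_bracket_def
    by (simp only: differential_frame[OF assms(2) X(3)] differential_frame[OF assms(1) Y(3)])
  moreover have "X p ** \<eta> p = p ** (\<xi> p ** \<eta> p)" "Y p ** \<xi> p = p ** (\<eta> p ** \<xi> p)"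
    by (simp_all only: X(1) Y(1) matrix_mul_assoc)
  ultimately show ?thesis
    by (simp only: commutator_def matrix_mult.add_right matrix_mult.diff_right) simp
qed

text \<open>All derivatives of the frame components cancel, except the one of \<open>Y\<close> along \<open>X\<close>.\<close>

lemma koszul_frame:
  assumes X: "frame_field M X p \<xi> \<xi>'" and Y: "frame_field M Y p \<eta> \<eta>'" and Z: "frame_field M Z p \<zeta> \<zeta>'"
  shows "koszul M metric_S X Y Z p = inner_s (\<eta>' (X p)) (\<zeta> p) + koszul_inv (\<xi> p) (\<eta> p) (\<zeta> p)"
proof -
  note Xp = frame_field_at_p[OF X] and Yp = frame_field_at_p[OF Y] and Zp = frame_field_at_p[OF Z]
  have metric: "metric_S p (p ** V) (X p) = inner_s V (\<xi> p)" "metric_S p (p ** V) (Y p) = inner_s V (\<eta> p)"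
    "metric_S p (p ** V) (Z p) = inner_s V (\<zeta> p)" for V
    by (simp_all only: Xp(1) Yp(1) Zp(1) metric_S_left_mult[OF p_sol])
  have sol: "\<xi>' v \<in> sol_algebra" "\<eta>' v \<in> sol_algebra" "\<zeta>' v \<in> sol_algebra"
    if "v \<in> tangent_space M p" for v
    using frame_derivative_in_sol that X Y Z by blast+
  have sym: "inner_s (\<eta> p) (\<zeta>' (X p)) = inner_s (\<zeta>' (X p)) (\<eta> p)"
    "inner_s (\<xi> p) (\<zeta>' (Y p)) = inner_s (\<zeta>' (Y p)) (\<xi> p)"
    "inner_s (\<xi> p) (\<eta>' (Z p)) = inner_s (\<eta>' (Z p)) (\<xi> p)"
    using inner_s_commute sol Xp Yp Zp by blast+
  show ?thesis
    unfolding koszul_def differential_metric[OF Y Z Xp(3)] differential_metric[OF X Z Yp(3)]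
      differential_metric[OF X Y Zp(3)] lie_bracket_frame[OF X Y] lie_bracket_frame[OF X Z]
      lie_bracket_frame[OF Y Z] metric sym koszul_inv_def
    by (simp add: inner_s.add_left inner_s.diff_left field_simps)
qed

text \<open>Existence is the Riesz vector \<omega>. For uniqueness it is enough to test with
  left-invariant fields, whose values fill the tangent space, and to use that \<open>inner_s\<close>
  is positive on \<ss>.\<close>

lemma levi_civita_frame:
  assumes X: "vector_field M X" "frame_field M X p \<xi> \<xi>'"
    and Y: "vector_field M Y" "frame_field M Y p \<eta> \<eta>'"
  obtains \<omega> where "\<omega> \<in> sol_algebra" "levi_civita M metric_S X Y p = p ** \<omega>"
    "\<And>\<zeta>. \<zeta> \<in> sol_algebra \<Longrightarrow> inner_s \<omega> \<zeta> = inner_s (\<eta>' (X p)) \<zeta> + koszul_inv (\<xi> p) (\<eta> p) \<zeta>"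
proof -
  obtain B where B: "orthonormal_basis sol_algebra inner_s B" using ex_orthonormal_basis_sol by blast
  obtain \<omega> where \<omega>: "\<omega> \<in> sol_algebra"
    "\<And>\<zeta>. \<zeta> \<in> sol_algebra \<Longrightarrow> inner_s \<omega> \<zeta> = inner_s (\<eta>' (X p)) \<zeta> + koszul_inv (\<xi> p) (\<eta> p) \<zeta>"
    using riesz_on[OF B bounded_bilinear_inner_s linear_koszul_inv inner_s_commute] by metis
  have "levi_civita M metric_S X Y p = p ** \<omega>"
    unfolding levi_civita_def
  proof (rule the_equality, intro conjI allI impI)
    show "p ** \<omega> \<in> tangent_space M p" using \<omega>(1) tangent_space_M[OF p_M] by blast
    fix Z assume "vector_field M Z"
    then obtain \<zeta> \<zeta>' where Z: "frame_field M Z p \<zeta> \<zeta>'" by (rule vector_field_frame)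
    show "metric_S p (p ** \<omega>) (Z p) = koszul M metric_S X Y Z p"
      unfolding koszul_frame[OF X(2) Y(2) Z] frame_field_at_p(1)[OF Z] metric_S_left_mult[OF p_sol]
      by (rule \<omega>(2)[OF frame_field_at_p(2)[OF Z]])
  next
    fix w assume w: "w \<in> tangent_space M p \<and>
      (\<forall>Z. vector_field M Z \<longrightarrow> metric_S p w (Z p) = koszul M metric_S X Y Z p)"
    then obtain \<omega>' where \<omega>': "\<omega>' \<in> sol_algebra" "w = p ** \<omega>'" using tangent_space_M[OF p_M] by auto
    have eq: "inner_s \<omega>' \<zeta> = inner_s \<omega> \<zeta>" if "\<zeta> \<in> sol_algebra" for \<zeta>
    proof -
      have "metric_S p w (p ** \<zeta>) = koszul M metric_S X Y (\<lambda>q. q ** \<zeta>) p"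
        using spec[OF conjunct2[OF w], of "\<lambda>q. q ** \<zeta>"] invariant_vector_field(1)[OF that] by simp
      then show ?thesis
        unfolding koszul_frame[OF X(2) Y(2) invariant_vector_field(2)[OF that]] \<omega>'(2)
          metric_S_left_mult[OF p_sol] using \<omega>(2)[OF that] by simp
    qed
    have sol: "\<omega>' - \<omega> \<in> sol_algebra" using \<omega> \<omega>' by (simp add: subspace_diff[OF subspace_sol_algebra])
    have "inner_s (\<omega>' - \<omega>) (\<omega>' - \<omega>) = 0" by (simp add: inner_s.diff_left eq[OF sol])
    then have "\<omega>' - \<omega> = 0" using inner_s_pos[OF sol] by force
    then show "w = p ** \<omega>" using \<omega>'(2) by simp
  qed
  then show ?thesis using that \<omega> by blast
qed

end

lemma bounded_bilinear_metric_S: "bounded_bilinear (metric_S p)"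
  unfolding metric_S_def[abs_def]
  by (rule bounded_bilinear.comp[OF bounded_bilinear_inner_s bounded_linear_left_mult bounded_linear_left_mult])

lemma left_mult_inj:
  assumes "p \<in> sol_group" "p ** X = p ** Y"
  shows "(X :: complex ^ 3 ^ 3) = Y"
  using arg_cong[OF assms(2), of "(**) (tri_adj p)"] assms(1) by simp

section \<open>Second fundamental form and mean curvature of the leaves\<close>

context diagonal_frame
begin

text \<open>Y is tangent to the leaf along the leaf, so its component function maps the leaf into W,
  and so does its derivative in the tangent direction X p. That term is orthogonal to T, hence the
  normal component depends only on the values of X and Y at p.\<close>

lemma normal_component:
  assumes "open U" "p \<in> U" "a \<in> sol_group" "p \<in> coset a"
    and X: "vector_field (sol_group \<inter> U) X" and Y: "vector_field (sol_group \<inter> U) Y"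
    and tan: "\<And>q. q \<in> coset a \<inter> U \<Longrightarrow> X q \<in> tangent_space (coset a) q \<and> Y q \<in> tangent_space (coset a) q"
    and "X p = p ** \<xi>0" "Y p = p ** \<eta>0"
  obtains \<omega> where "\<omega> \<in> sol_algebra" "levi_civita (sol_group \<inter> U) metric_S X Y p = p ** \<omega>"
    "inner_s T \<omega> = koszul_inv \<xi>0 \<eta>0 T"
proof -
  have p: "p \<in> sol_group" using assms(3,4) coset_subset by blast
  interpret sol_open U p by unfold_locales (use assms p in auto)
  obtain \<xi> \<xi>' where \<xi>: "frame_field M X p \<xi> \<xi>'" using vector_field_frame[OF X] by blast
  obtain \<eta> \<eta>' where \<eta>: "frame_field M Y p \<eta> \<eta>'" using vector_field_frame[OF Y] by blast
  obtain \<omega> where \<omega>: "\<omega> \<in> sol_algebra" "levi_civita M metric_S X Y p = p ** \<omega>"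
    "\<And>\<zeta>. \<zeta> \<in> sol_algebra \<Longrightarrow> inner_s \<omega> \<zeta> = inner_s (\<eta>' (X p)) \<zeta> + koszul_inv (\<xi> p) (\<eta> p) \<zeta>"
    using levi_civita_frame[OF X \<xi> Y \<eta>] by blast
  have "\<xi> p = \<xi>0" "\<eta> p = \<eta>0"
    using frame_field_at_p(1)[OF \<xi>] frame_field_at_p(1)[OF \<eta>] assms(8,9) left_mult_inj[OF p] by auto
  moreover have "\<eta>' (X p) \<in> W"
  proof (rule has_derivative_tangent_in_subspace[where f = \<eta> and f' = \<eta>' and v = "X p" and p = p
        and M = "coset a \<inter> U", OF _ _ subspace])
    have "coset a \<inter> U \<subseteq> M" using coset_subset[OF assms(3)] by blast
    then show "(\<eta> has_derivative \<eta>') (at p within coset a \<inter> U)"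
      using \<eta> has_derivative_subset unfolding frame_field_def by blast
    show "X p \<in> tangent_space (coset a \<inter> U) p"
      using tan[of p] assms(2,4) tangent_space_local[OF assms(1,2)] by blast
    fix q assume q: "q \<in> coset a \<inter> U"
    then have "q \<in> M" using coset_subset[OF assms(3)] by blast
    then have Yq: "Y q = q ** \<eta> q" "q \<in> sol_group" using \<eta> by (auto simp: frame_field_def)
    have "Y q \<in> (**) q ` W" using tan[OF q] tangent_space_coset[OF assms(3)] q by blast
    then obtain w where "w \<in> W" "q ** \<eta> q = q ** w" unfolding Yq(1) by blast
    then show "\<eta> q \<in> W" using left_mult_inj[OF Yq(2), of "\<eta> q" w] by simp
  qed
  then have "inner_s (\<eta>' (X p)) T = 0"
    using inner_s_commute[OF _ T_in_sol] by (auto simp: W_def)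
  ultimately have "inner_s T \<omega> = koszul_inv \<xi>0 \<eta>0 T"
    using \<omega>(3)[OF T_in_sol] inner_s_commute[OF T_in_sol \<omega>(1)] by simp
  then show ?thesis using that \<omega> by blast
qed

text \<open>Write a normal vector as p \<omega>. Removing the T-component of \<omega> leaves an
  element of W orthogonal to itself, hence 0.\<close>

lemma normal_space_coset:
  assumes a: "a \<in> sol_group" "p \<in> coset a"
  shows "w \<in> normal_space sol_group metric_S (coset a) p \<longleftrightarrow> (\<exists>k. w = p ** (k *\<^sub>R T))"
proof
  have p: "p \<in> sol_group" using a coset_subset by blast
  assume w: "w \<in> normal_space sol_group metric_S (coset a) p"
  then obtain \<omega> where \<omega>: "\<omega> \<in> sol_algebra" "w = p ** \<omega>"
    using tangent_space_sol_group[OF p] by (auto simp: normal_space_def)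
  let ?d = "\<omega> - inner_s T \<omega> *\<^sub>R T"
  have d: "?d \<in> W" by (rule sol_decomposition[OF \<omega>(1)])
  then have "p ** ?d \<in> tangent_space (coset a) p" using tangent_space_coset[OF a] by blast
  then have "inner_s \<omega> ?d = 0"
    using w metric_S_left_mult[OF p] by (auto simp: normal_space_def \<omega>(2))
  moreover have "inner_s T ?d = 0" using d by (simp add: W_def)
  ultimately have "inner_s ?d ?d = 0" by (simp only: inner_s.diff_left inner_s.scaleR_left) simp
  then have "?d = 0" using inner_s_pos[of ?d] d subset_sol by force
  then have "\<omega> = inner_s T \<omega> *\<^sub>R T" by simp
  then show "\<exists>k. w = p ** (k *\<^sub>R T)" using \<omega>(2) by (intro exI[of _ "inner_s T \<omega>"]) (rule subst)
next
  have p: "p \<in> sol_group" using a coset_subset by blast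
  assume "\<exists>k. w = p ** (k *\<^sub>R T)"
  then obtain k where w: "w = p ** (k *\<^sub>R T)" by blast
  have "k *\<^sub>R T \<in> sol_algebra" using T_in_sol subspace_scale[OF subspace_sol_algebra] by blast
  moreover have "inner_s (k *\<^sub>R T) X = 0" if "X \<in> W" for X
    using that by (simp add: W_def inner_s.scaleR_left)
  ultimately show "w \<in> normal_space sol_group metric_S (coset a) p"
    unfolding normal_space_def tangent_space_coset[OF a] tangent_space_sol_group[OF p] w
    using metric_S_left_mult[OF p] by auto
qed

text \<open>The definite description needs a witness and uniqueness: left-invariant fields on all of
  S provide the former, and by \<open>normal_component\<close> every other choice of extensions
  yields the same multiple of T.\<close>

lemma second_fundamental_form_coset:
  assumes a: "a \<in> sol_group" "p \<in> coset a" and "\<xi> \<in> W" "\<eta> \<in> W"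
  shows "second_fundamental_form sol_group metric_S (coset a) p (p ** \<xi>) (p ** \<eta>) =
    p ** (koszul_inv \<xi> \<eta> T *\<^sub>R T)"
  unfolding second_fundamental_form_def
proof (rule the_equality, intro conjI)
  have p: "p \<in> sol_group" using a coset_subset by blast
  have sol: "\<xi> \<in> sol_algebra" "\<eta> \<in> sol_algebra" using assms(3,4) subset_sol by auto
  have diff: "p ** \<omega> - p ** (k *\<^sub>R T) \<in> tangent_space (coset a) p \<longleftrightarrow> inner_s T \<omega> = k"
    if "\<omega> \<in> sol_algebra" for \<omega> k
  proof -
    have "p ** \<omega> - p ** (k *\<^sub>R T) = p ** (\<omega> - k *\<^sub>R T)" by (simp add: matrix_mult.diff_right)
    then have "p ** \<omega> - p ** (k *\<^sub>R T) \<in> tangent_space (coset a) p \<longleftrightarrow> \<omega> - k *\<^sub>R T \<in> W"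
      unfolding tangent_space_coset[OF a] using left_mult_inj[OF p] by auto
    also have "\<dots> \<longleftrightarrow> inner_s T \<omega> = k"
      using that T_in_sol by (simp add: W_def inner_s.diff_right inner_s.scaleR_right inner_T_T
          subspace_diff[OF subspace_sol_algebra] subspace_scale[OF subspace_sol_algebra])
    finally show ?thesis .
  qed
  show "p ** (koszul_inv \<xi> \<eta> T *\<^sub>R T) \<in> normal_space sol_group metric_S (coset a) p"
    using normal_space_coset[OF a] by blast
  let ?P = "\<lambda>w U X Y. open U \<and> p \<in> U \<and>
       vector_field (sol_group \<inter> U) X \<and> vector_field (sol_group \<inter> U) Y \<and>
       (\<forall>q\<in>coset a \<inter> U. X q \<in> tangent_space (coset a) q \<and> Y q \<in> tangent_space (coset a) q) \<and>
       X p = p ** \<xi> \<and> Y p = p ** \<eta> \<and>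
       levi_civita (sol_group \<inter> U) metric_S X Y p - w \<in> tangent_space (coset a) p"
  let ?X = "\<lambda>q. q ** \<xi>" and ?Y = "\<lambda>q. q ** \<eta>"
  interpret sol_open UNIV p by unfold_locales (use p in auto)
  have vf: "vector_field (sol_group \<inter> UNIV) ?X" "vector_field (sol_group \<inter> UNIV) ?Y"
    using invariant_vector_field(1) sol by blast+
  have tan: "?X q \<in> tangent_space (coset a) q \<and> ?Y q \<in> tangent_space (coset a) q" if "q \<in> coset a \<inter> UNIV" for q
    using tangent_space_coset[OF a(1), of q] assms(3,4) that by auto
  obtain \<omega> where \<omega>: "\<omega> \<in> sol_algebra" "levi_civita (sol_group \<inter> UNIV) metric_S ?X ?Y p = p ** \<omega>"
    "inner_s T \<omega> = koszul_inv \<xi> \<eta> T"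
    using normal_component[OF open_UNIV UNIV_I a vf tan refl refl] by blast
  have "?P (p ** (koszul_inv \<xi> \<eta> T *\<^sub>R T)) UNIV ?X ?Y"
    using vf tan \<omega>(2) diff[OF \<omega>(1)] \<omega>(3) by simp
  then show "\<exists>U X Y. ?P (p ** (koszul_inv \<xi> \<eta> T *\<^sub>R T)) U X Y" by blast
  fix w assume "w \<in> normal_space sol_group metric_S (coset a) p \<and> (\<exists>U X Y. ?P w U X Y)"
  then obtain k U X Y where w: "w = p ** (k *\<^sub>R T)" and P: "?P w U X Y"
    using normal_space_coset[OF a] by blast
  obtain \<omega> where "\<omega> \<in> sol_algebra" "levi_civita (sol_group \<inter> U) metric_S X Y p = p ** \<omega>"
    "inner_s T \<omega> = koszul_inv \<xi> \<eta> T"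
    using normal_component[of U p a X Y \<xi> \<eta>] P a by blast
  then show "w = p ** (koszul_inv \<xi> \<eta> T *\<^sub>R T)" using P diff w by auto
qed

text \<open>The bracket of \<xi> with itself vanishes, and the expression reduces to the product of
  [T, \<xi>] with \<xi>, a sum of roots times squared absolute values of entries. The squares are
  written as products with basis vectors so that they can be summed over an arbitrary orthonormal
  basis.\<close>

lemma koszul_inv_T:
  assumes "t1 = t3" "\<xi> \<in> W"
  shows "koszul_inv \<xi> \<xi> T = (t1 - t2) * ((inner_s (tri 0 0 0 1 0 0) \<xi>)\<^sup>2 + (inner_s (tri 0 0 0 \<i> 0 0) \<xi>)\<^sup>2
    - (inner_s (tri 0 0 0 0 1 0) \<xi>)\<^sup>2 - (inner_s (tri 0 0 0 0 \<i> 0) \<xi>)\<^sup>2)"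
proof -
  obtain a b c x y z where \<xi>: "\<xi> = tri a b c x y z" using assms(2) subset_sol by (blast elim: sol_algebraE)
  have "koszul_inv \<xi> \<xi> T = (t1 - t2) * ((Re x)\<^sup>2 + (Im x)\<^sup>2) + (t2 - t3) * ((Re y)\<^sup>2 + (Im y)\<^sup>2)
      + (t1 - t3) * ((Re z)\<^sup>2 + (Im z)\<^sup>2)"
    by (simp add: \<xi> koszul_inv_def commutator_def inner_s.zero_left T_def tri_mult tri_diff inner_s_tri
        power2_eq_square field_simps)
  then show ?thesis
    using assms(1) by (simp add: \<xi> inner_s_tri algebra_simps)
qed

lemma orthonormal_basis_left_mult:
  assumes "p \<in> sol_group" "orthonormal_basis V inner_s B"
  shows "orthonormal_basis ((**) p ` V) (metric_S p) ((**) p ` B)"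
proof -
  have "span ((**) p ` B) = (**) p ` span B"
    by (rule linear_span_image[OF bounded_linear.linear[OF bounded_linear_left_mult]])
  then show ?thesis
    using assms left_mult_inj[OF assms(1)]
    by (auto simp: orthonormal_basis_def metric_S_left_mult)
qed

text \<open>When \<open>t\<^sub>1 = t\<^sub>3\<close>, \<open>ad T\<close> acts on \<open>\<nn>\<close> with the eigenvalues \<open>t\<^sub>1 - t\<^sub>2\<close>, \<open>t\<^sub>2 - t\<^sub>1\<close>, \<open>0\<close>, each on a
  complex line, so its trace vanishes.\<close>

lemma mean_curvature_coset:
  assumes "t1 = t3" and a: "a \<in> sol_group" "p \<in> coset a"
  shows "mean_curvature sol_group metric_S (coset a) p = 0"
proof -
  have p: "p \<in> sol_group" using a coset_subset by blast
  define B where "B = (SOME B. orthonormal_basis (tangent_space (coset a) p) (metric_S p) B)"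
  have "\<exists>B. orthonormal_basis (tangent_space (coset a) p) (metric_S p) B"
    unfolding tangent_space_coset[OF a] using orthonormal_basis_left_mult[OF p orthonormal_basis_W] by blast
  then have B: "orthonormal_basis ((**) p ` W) (metric_S p) B"
    unfolding B_def tangent_space_coset[OF a] by (rule someI_ex)
  \<comment> \<open>B comes from a choice operator, so only its orthonormality is known. By Parseval
    the sum is the squared length of w, whatever B is.\<close>
  have norm: "(\<Sum>e\<in>B. (metric_S p (p ** w) e)\<^sup>2) = 1" if "w \<in> nil_basis" for w
  proof -
    have "w \<in> W" using that by (auto simp: nil_basis_def W_def T_def inner_s_tri)
    then have "metric_S p (p ** w) (p ** w) = (\<Sum>e\<in>B. metric_S p (p ** w) e * metric_S p (p ** w) e)"
      by (intro orthonormal_basis_parseval[OF B bounded_bilinear_metric_S]) simp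
    then show ?thesis
      using orthonormal_nil_basis(1)[OF that that] by (simp add: metric_S_left_mult[OF p] power2_eq_square)
  qed
  let ?m = "\<lambda>w e. (metric_S p (p ** w) e)\<^sup>2"
  let ?q = "\<lambda>e. (t1 - t2) * (?m (tri 0 0 0 1 0 0) e + ?m (tri 0 0 0 \<i> 0 0) e
      - ?m (tri 0 0 0 0 1 0) e - ?m (tri 0 0 0 0 \<i> 0) e)"
  have "second_fundamental_form sol_group metric_S (coset a) p e e = p ** (?q e *\<^sub>R T)" if "e \<in> B" for e
  proof -
    have "e \<in> (**) p ` W" using B that span_base unfolding orthonormal_basis_def by blast
    then obtain \<xi> where \<xi>: "\<xi> \<in> W" "e = p ** \<xi>" by blast
    show ?thesis
      unfolding \<xi>(2) second_fundamental_form_coset[OF a \<xi>(1) \<xi>(1)] koszul_inv_T[OF assms(1) \<xi>(1)]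
        metric_S_left_mult[OF p] ..
  qed
  then have "mean_curvature sol_group metric_S (coset a) p = (\<Sum>e\<in>B. p ** (?q e *\<^sub>R T))"
    unfolding mean_curvature_def B_def[symmetric] by (rule sum.cong[OF refl])
  also have "\<dots> = p ** ((\<Sum>e\<in>B. ?q e) *\<^sub>R T)"
    by (simp add: matrix_mult.sum_right scaleR_sum_left)
  \<comment> \<open>Four sums equal to 1 enter with the signs +, +, -, -.\<close>
  also have "(\<Sum>e\<in>B. ?q e) = 0"
    by (simp add: norm nil_basis_def sum_subtractf sum.distrib flip: sum_distrib_left)
  finally show ?thesis by simp
qed

lemma minimal_coset:
  assumes "t1 = t3" "a \<in> sol_group"
  shows "minimal_hypersurface sol_group metric_S (coset a)"
  unfolding minimal_hypersurface_def
  using coset_subset[OF assms(2)] submanifold_sol_group submanifold_coset[OF assms(2)]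
    mean_curvature_coset[OF assms] dim_W dim_sol by (auto intro!: exI[of _ 7])

end

section \<open>Volume\<close>

lemma diffeomorphism_restrict:
  assumes "diffeomorphism M M' f" "U \<subseteq> M"
  shows "diffeomorphism U (f ` U) f"
proof (rule diffeomorphismI[where g = "inv_into M f"])
  have f: "bij_betw f M M'" "smooth_map M f" "smooth_map M' (inv_into M f)"
    using assms(1) by (auto simp: diffeomorphism_def)
  have inv: "inv_into M f (f x) = x" if "x \<in> U" for x
    using bij_betw_inv_into_left[OF f(1)] that assms(2) by blast
  show "smooth_map U f" by (rule smooth_map_subset[OF f(2) assms(2)])
  have "f ` U \<subseteq> M'" using f(1) assms(2) by (auto simp: bij_betw_def)
  then show "smooth_map (f ` U) (inv_into M f)" by (rule smooth_map_subset[OF f(3)])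
  show "inv_into M f ` f ` U \<subseteq> U" using inv by auto
  show "inv_into M f (f x) = x" if "x \<in> U" for x by (rule inv[OF that])
  show "f (inv_into M f y) = y" if "y \<in> f ` U" for y using inv that by auto
qed simp

lemma diffeomorphism_openin_image:
  assumes "diffeomorphism M M' f" "openin (top_of_set M) U"
  shows "openin (top_of_set M') (f ` U)"
proof (rule homeomorphism_imp_open_map[OF _ assms(2)])
  have f: "bij_betw f M M'" "smooth_map M f" "smooth_map M' (inv_into M f)"
    using assms(1) by (auto simp: diffeomorphism_def)
  then show "homeomorphism M M' f (inv_into M f)"
    unfolding homeomorphism_def
    using bij_betw_inv_into_left[OF f(1)] bij_betw_inv_into_right[OF f(1)]
      bij_betw_imp_surj_on[OF f(1)] bij_betw_imp_surj_on[OF bij_betw_inv_into[OF f(1)]]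
      smooth_map_continuous_on[OF f(2)] smooth_map_continuous_on[OF f(3)] by simp
qed

lemma local_parametrization_compose:
  assumes "diffeomorphism M M' f" "local_parametrization M V \<psi>"
  shows "local_parametrization M' V (\<lambda>x. f (\<psi> x))"
proof -
  have \<psi>: "open V" "openin (top_of_set M) (\<psi> ` V)" "diffeomorphism V (\<psi> ` V) \<psi>"
    using assms(2) by (auto simp: local_parametrization_def)
  have "\<psi> ` V \<subseteq> M" using \<psi>(2) by (rule openin_imp_subset)
  then have "diffeomorphism (\<psi> ` V) (f ` \<psi> ` V) f"
    by (rule diffeomorphism_restrict[OF assms(1)])
  then have "diffeomorphism V (f ` \<psi> ` V) (\<lambda>x. f (\<psi> x))"
    by (rule diffeomorphism_compose[OF \<psi>(3)])
  then show ?thesis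
    using \<psi>(1) diffeomorphism_openin_image[OF assms(1) \<psi>(2)]
    by (simp add: local_parametrization_def image_image)
qed

text \<open>f carries each admissible family for A to one for the image, with the same coordinate
  domains and the same integrals; only the charts are composed with f. The opposite inequality is
  left to the inverse map.\<close>

lemma riem_volume_mono_diffeomorphism:
  fixes \<nu> :: "'n::finite itself"
  assumes f: "diffeomorphism M M' f" and A: "A \<subseteq> M"
    and det: "\<And>V (\<psi> :: real ^ 'n \<Rightarrow> _) x. local_parametrization M V \<psi> \<Longrightarrow> x \<in> V \<Longrightarrow>
      det (gram_matrix g' (\<lambda>x. f (\<psi> x)) x) = det (gram_matrix g \<psi> x)"
  shows "riem_volume \<nu> M g A \<le> riem_volume \<nu> M' g' (f ` A)"
  unfolding riem_volume_def
proof (rule Sup_subset_mono, rule subsetI)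
  fix l assume "l \<in> {(\<Sum>i<k. \<integral>\<^sup>+x\<in>B i. ennreal (sqrt (det (gram_matrix g (\<psi> i) x))) \<partial>lborel)
          | (k::nat) V B (\<psi> :: nat \<Rightarrow> real ^ 'n \<Rightarrow> _).
            (\<forall>i<k. local_parametrization M (V i) (\<psi> i) \<and>
                   B i \<in> sets borel \<and> B i \<subseteq> V i \<and> \<psi> i ` B i \<subseteq> A) \<and>
            disjoint_family_on (\<lambda>i. \<psi> i ` B i) {..<k}}"
  then obtain k :: nat and V B and \<psi> :: "nat \<Rightarrow> real ^ 'n \<Rightarrow> _" where
    l: "l = (\<Sum>i<k. \<integral>\<^sup>+x\<in>B i. ennreal (sqrt (det (gram_matrix g (\<psi> i) x))) \<partial>lborel)"
    and all: "\<forall>i<k. local_parametrization M (V i) (\<psi> i) \<and>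
                   B i \<in> sets borel \<and> B i \<subseteq> V i \<and> \<psi> i ` B i \<subseteq> A"
    and disj: "disjoint_family_on (\<lambda>i. \<psi> i ` B i) {..<k}"
    unfolding mem_Collect_eq by (elim exE conjE) (rule that)
  from all have P: "\<And>i. i < k \<Longrightarrow> local_parametrization M (V i) (\<psi> i)" "\<And>i. i < k \<Longrightarrow> B i \<in> sets borel"
      "\<And>i. i < k \<Longrightarrow> B i \<subseteq> V i" "\<And>i. i < k \<Longrightarrow> \<psi> i ` B i \<subseteq> A"
    by simp_all
  let ?\<psi> = "\<lambda>i x. f (\<psi> i x)"
  have inj: "inj_on f M" using f by (auto simp: diffeomorphism_def bij_betw_def)
  have "l = (\<Sum>i<k. \<integral>\<^sup>+x\<in>B i. ennreal (sqrt (det (gram_matrix g' (?\<psi> i) x))) \<partial>lborel)"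
    unfolding l
  proof (intro sum.cong refl nn_integral_cong)
    fix i x assume "i \<in> {..<k}"
    then have i: "i < k" by simp
    show "ennreal (sqrt (det (gram_matrix g (\<psi> i) x))) * indicator (B i) x =
        ennreal (sqrt (det (gram_matrix g' (?\<psi> i) x))) * indicator (B i) x"
    proof (cases "x \<in> B i")
      case True
      then have "x \<in> V i" using P(3)[OF i] by blast
      then show ?thesis using det[OF P(1)[OF i]] by simp
    qed simp
  qed
  moreover have "\<forall>i<k. local_parametrization M' (V i) (?\<psi> i) \<and> B i \<in> sets borel \<and> B i \<subseteq> V i \<and>
      ?\<psi> i ` B i \<subseteq> f ` A"
  proof (intro allI impI conjI)
    fix i assume i: "i < k"
    show "local_parametrization M' (V i) (?\<psi> i)"
      by (rule local_parametrization_compose[OF f P(1)[OF i]])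
    show "?\<psi> i ` B i \<subseteq> f ` A" using P(4)[OF i] by blast
  qed (use P in auto)
  moreover have "disjoint_family_on (\<lambda>i. ?\<psi> i ` B i) {..<k}"
    unfolding disjoint_family_on_def
  proof (intro ballI impI)
    fix i j assume ij: "i \<in> {..<k}" "j \<in> {..<k}" "i \<noteq> j"
    then have "\<psi> i ` B i \<inter> \<psi> j ` B j = {}" using disj by (auto simp: disjoint_family_on_def)
    moreover have "\<psi> i ` B i \<subseteq> M" "\<psi> j ` B j \<subseteq> M" using P(4) A ij by blast+
    ultimately have "f ` (\<psi> i ` B i) \<inter> f ` (\<psi> j ` B j) = {}"
      using inj_on_image_Int[OF inj] by (metis image_empty)
    then show "?\<psi> i ` B i \<inter> ?\<psi> j ` B j = {}" by (simp add: image_image)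
  qed
  ultimately show "l \<in> {(\<Sum>i<k. \<integral>\<^sup>+x\<in>B i. ennreal (sqrt (det (gram_matrix g' (\<psi> i) x))) \<partial>lborel)
          | (k::nat) V B (\<psi> :: nat \<Rightarrow> real ^ 'n \<Rightarrow> _).
            (\<forall>i<k. local_parametrization M' (V i) (\<psi> i) \<and>
                   B i \<in> sets borel \<and> B i \<subseteq> V i \<and> \<psi> i ` B i \<subseteq> f ` A) \<and>
            disjoint_family_on (\<lambda>i. \<psi> i ` B i) {..<k}}"
    by (intro CollectI exI[of _ k] exI[of _ V] exI[of _ B] exI[of _ ?\<psi>] conjI)
qed

text \<open>In an orthonormal basis the Gram matrix is \<open>\<Theta> \<Theta>\<^sup>T\<close>, and the scaling multiplies \<open>\<Theta>\<close> by a
  diagonal matrix of determinant one.\<close>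

lemma det_gram_diagonal_scaling:
  fixes f :: "'n::finite \<Rightarrow> 'a::real_normed_vector"
  assumes B: "orthonormal_basis V b B" and b: "bounded_bilinear b" and f: "bij_betw f UNIV B"
    and u: "\<And>i. u i \<in> V" "\<And>i. u' i \<in> V"
    and scale: "\<And>i k. b (u' i) (f k) = l k * b (u i) (f k)" and l: "(\<Prod>k\<in>UNIV. l k) = 1"
  shows "det (\<chi> i j. b (u' i) (u' j) :: real ^ 'n ^ 'n) = det (\<chi> i j. b (u i) (u j))"
proof -
  have parseval: "b x y = (\<Sum>k\<in>UNIV. b x (f k) * b y (f k))" if "y \<in> V" for x y
    using orthonormal_basis_parseval[OF B b that, of x] sum.reindex_bij_betw[OF f, of "\<lambda>e. b x e * b y e"]
    by simp
  define \<Theta> D :: "real ^ 'n ^ 'n" where "\<Theta> = (\<chi> i k. b (u i) (f k))" and "D = (\<chi> i k. if i = k then l k else 0)"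
  have 1: "(\<chi> i j. b (u i) (u j)) = \<Theta> ** transpose \<Theta>"
    by (simp add: vec_eq_iff matrix_matrix_mult_def transpose_def \<Theta>_def parseval[OF u(1)])
  have "(\<chi> i k. b (u' i) (f k)) = \<Theta> ** D"
    by (simp add: vec_eq_iff matrix_matrix_mult_def \<Theta>_def D_def scale if_distrib[of "(*) _"] mult.commute
        cong: if_cong)
  then have 2: "(\<chi> i j. b (u' i) (u' j)) = (\<Theta> ** D) ** transpose (\<Theta> ** D)"
    by (simp flip: \<open>_ = \<Theta> ** D\<close> add: vec_eq_iff matrix_matrix_mult_def transpose_def parseval[OF u(2)])
  have "det D = 1" using l by (subst det_diagonal) (simp_all add: D_def)
  then show ?thesis unfolding 1 2 by (simp add: det_mul det_transpose)
qed

context sol_ideal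
begin

text \<open>V is open, so derivatives within V are full derivatives and every coordinate direction
  is tangent to V; its image is tangent to the coset, and left translation takes it to W.\<close>

lemma parametrization_velocity:
  assumes "p \<in> sol_group" "local_parametrization (coset p) V \<psi>" "x \<in> V"
  shows "(\<psi> has_derivative frechet_derivative \<psi> (at x)) (at x)" "\<psi> x \<in> sol_group"
    "tri_adj (\<psi> x) ** frechet_derivative \<psi> (at x) v \<in> W"
proof -
  have \<psi>: "open V" "openin (top_of_set (coset p)) (\<psi> ` V)" "smooth_map V \<psi>"
    using assms(2) by (auto simp: local_parametrization_def diffeomorphism_def)
  have sub: "\<psi> ` V \<subseteq> coset p" using \<psi>(2) by (rule openin_imp_subset)
  have at: "at x within V = at x" by (rule at_within_open[OF assms(3) \<psi>(1)])
  obtain \<psi>' where "(\<psi> has_derivative \<psi>') (at x within V)"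
    using smooth_map_has_derivative[OF \<psi>(3) assms(3)] by blast
  then show "(\<psi> has_derivative frechet_derivative \<psi> (at x)) (at x)"
    unfolding at by (metis differentiableI frechet_derivative_works)
  have q: "\<psi> x \<in> coset p" using sub assms(3) by blast
  then show s: "\<psi> x \<in> sol_group" using coset_subset[OF assms(1)] by blast
  have "frechet_derivative \<psi> (at x) v \<in> tangent_space (coset p) (\<psi> x)"
    using differential_in_tangent_space[OF \<psi>(3) sub assms(3), of v] tangent_space_open[OF \<psi>(1) assms(3)] at
    by simp
  then show "tri_adj (\<psi> x) ** frechet_derivative \<psi> (at x) v \<in> W"
    using s by (auto simp: tangent_space_coset[OF assms(1) q])
qed

end

context diagonal_frame
begin

text \<open>One statement covers S and the leaves: V will be \<ss> or W, of dimension 8 or 7, and B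
  consists of \<open>nil_basis\<close> together with some of T and H. Conjugation leaves the
  components along T and H unchanged, so only the six directions of \<nn> contribute to the
  determinant.\<close>

lemma det_gram_flow:
  fixes \<psi> :: "real ^ 'n \<Rightarrow> complex ^ 3 ^ 3"
  assumes "t1 = t3" "sol_ideal V" and B: "orthonormal_basis V inner_s B"
    and "nil_basis \<subseteq> B" "B \<subseteq> insert T W_basis" "card B = CARD('n)"
    and p: "p \<in> sol_group" and \<psi>: "local_parametrization (sol_ideal.coset V p) U \<psi>" "x \<in> U"
  shows "det (gram_matrix metric_S (\<lambda>x. flow T s (\<psi> x)) x) = det (gram_matrix metric_S \<psi> x)"
proof -
  interpret V: sol_ideal V by fact
  note vel = V.parametrization_velocity[OF p \<psi>]
  let ?e = "flow_elem s"
  define \<theta> where "\<theta> i = tri_adj (\<psi> x) ** frechet_derivative \<psi> (at x) (axis i 1)" for i :: 'n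
  define \<theta>' where "\<theta>' i = tri_adj ?e ** \<theta> i ** ?e" for i
  define u v where "u = exp (s * t1)" "v = exp (s * t2)"
  have e: "?e = tri u v u 0 0 0" by (simp only: flow_elem_def u_v_def) (simp only: assms(1))
  \<comment> \<open>With t1 = t3 the first and third diagonal entries coincide, and this is the
    determinant condition.\<close>
  have uv: "u * v * u = 1" using flow_elem_in_sol[of s] by (simp add: e)
  have \<theta>: "\<theta> i \<in> V" for i using vel(3) by (simp add: \<theta>_def)
  \<comment> \<open>Conjugation multiplies the entry (i,j) by e_j / e_i, where the adjugate writes 1
    / e_i as the product of the other two diagonal entries. The entry (1,3) is fixed because e_1 =
    e_3.\<close>
  have conj: "tri_adj ?e ** tri a b c y z w ** ?e = tri a b c (v * v * u * y) (u * u * u * z) w"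
    for a b c :: real and y z w :: complex
  proof -
    have "v * u * a * u = (u * v * u) * a" "u * u * b * v = (u * v * u) * b"
      "u * v * c * u = (u * v * u) * c" by simp_all
    moreover have "complex_of_real (u * v * u) = 1" by (simp only: uv of_real_1)
    ultimately show ?thesis using uv by (simp add: e tri_adj_tri tri_mult mult_ac)
  qed
  have \<theta>': "\<theta>' i \<in> V" for i
  proof -
    obtain a b c y z w where eq: "\<theta> i = tri a b c y z w"
      using \<theta>[of i] V.subset_sol by (blast elim: sol_algebraE)
    show ?thesis
      using \<theta>[of i] V.tri_in_iff[of a b c y z w] V.tri_in_iff[of a b c "v * v * u * y" "u * u * u * z" w]
      by (simp add: \<theta>'_def eq conj)
  qed
  define l where "l b = (if b \<in> {tri 0 0 0 1 0 0, tri 0 0 0 \<i> 0 0} then v * v * u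
    else if b \<in> {tri 0 0 0 0 1 0, tri 0 0 0 0 \<i> 0} then u * u * u else 1)" for b
  have scale: "inner_s (\<theta>' i) b = l b * inner_s (\<theta> i) b" if "b \<in> B" for i b
  proof -
    obtain a1 b1 c1 y z w where eq: "\<theta> i = tri a1 b1 c1 y z w"
      using \<theta>[of i] V.subset_sol by (blast elim: sol_algebraE)
    have "b \<in> insert T W_basis" using that assms(5) by blast
    then show ?thesis
      by (auto simp: \<theta>'_def eq conj inner_s_tri l_def nil_basis_def H_def T_def)
  qed
  have fin: "finite B" using B by (simp add: orthonormal_basis_def)
  obtain f where f: "bij_betw f (UNIV :: 'n set) B"
    using finite_same_card_bij[OF finite_class.finite_UNIV fin] assms(6) by auto
  have "(\<Prod>b\<in>B. l b) = (\<Prod>b\<in>nil_basis. l b)"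
    using assms(4) fin by (intro prod.mono_neutral_right) (auto simp: l_def nil_basis_def)
  \<comment> \<open>The factors v v u and u u u each occur twice, for the directions 1 and \<i>;
    together they make u^8 v^4.\<close>
  also have "\<dots> = (u * v * u) ^ 4" by (simp add: nil_basis_def l_def power4_eq_xxxx)
  finally have prod: "(\<Prod>k\<in>UNIV. l (f k)) = 1"
    using prod.reindex_bij_betw[OF f, of l] uv by simp
  have gram: "gram_matrix metric_S \<psi> x = (\<chi> i j. inner_s (\<theta> i) (\<theta> j))"
    using vel(2) by (simp add: gram_matrix_def metric_S_def matrix_inv_sol \<theta>_def)
  have D: "frechet_derivative (\<lambda>x. \<psi> x ** ?e) (at x) = (\<lambda>w. frechet_derivative \<psi> (at x) w ** ?e)"
    by (rule frechet_derivative_at[symmetric])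
      (rule bounded_linear.has_derivative[OF bounded_linear_right_mult vel(1)])
  have "tri_adj (\<psi> x ** ?e) ** (frechet_derivative \<psi> (at x) (axis i 1) ** ?e) = \<theta>' i" for i
  \<comment> \<open>Multiplying both sides by the base point avoids expanding the adjugate of a
    product.\<close>
  proof (rule left_mult_inj[OF sol_group_mult[OF vel(2) flow_elem_in_sol]])
    have "\<psi> x ** ?e ** \<theta>' i = \<psi> x ** (?e ** (tri_adj ?e ** (\<theta> i ** ?e)))"
      by (simp only: \<theta>'_def matrix_mul_assoc)
    also have "\<dots> = \<psi> x ** \<theta> i ** ?e" using flow_elem_in_sol by (simp add: matrix_mul_assoc)
    also have "\<psi> x ** \<theta> i = frechet_derivative \<psi> (at x) (axis i 1)" using vel(2) by (simp add: \<theta>_def)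
    finally show "\<psi> x ** ?e ** (tri_adj (\<psi> x ** ?e) ** (frechet_derivative \<psi> (at x) (axis i 1) ** ?e)) =
        \<psi> x ** ?e ** \<theta>' i"
      using sol_group_mult[OF vel(2) flow_elem_in_sol] by simp
  qed
  then have "gram_matrix metric_S (\<lambda>x. flow T s (\<psi> x)) x = (\<chi> i j. inner_s (\<theta>' i) (\<theta>' j))"
    unfolding gram_matrix_def D metric_S_def flow_eq matrix_inv_sol[OF sol_group_mult[OF vel(2) flow_elem_in_sol]]
    by simp
  then show ?thesis
    unfolding gram
    using det_gram_diagonal_scaling[OF B bounded_bilinear_inner_s f \<theta> \<theta>' _ prod] scale bij_betwE[OF f]
    by simp
qed

lemma flow_inverse: "flow T s (flow T (- s) q) = q" "flow T (- s) (flow T s q) = q"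
  by (simp_all add: flow_eq flow_elem_add flow_elem_0 flip: matrix_mul_assoc)

lemma volume_preserving_flow:
  assumes "t1 = t3" "sol_ideal V" and B: "orthonormal_basis V inner_s B"
    and "nil_basis \<subseteq> B" "B \<subseteq> insert T W_basis" "card B = CARD('n)" and p: "p \<in> sol_group"
  shows "volume_preserving TYPE('n::finite) (sol_ideal.coset V p) metric_S
    (sol_ideal.coset V (p ** flow_elem s)) metric_S (flow T s)"
proof -
  interpret V: sol_ideal V by fact
  have im: "flow T s ` V.coset p = V.coset (p ** flow_elem s)" if "p \<in> sol_group" for p s
    unfolding flow_eq by (rule V.right_mult_coset[OF that flow_elem_in_sol])
  have p': "p ** flow_elem s \<in> sol_group" using p flow_elem_in_sol sol_group_mult by blast
  have return: "p ** flow_elem s ** flow_elem (- s) = p"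
    using flow_inverse(2)[of s p] by (simp add: flow_eq)
  have lin: "smooth_map M (flow T r)" for M r
    unfolding flow_eq by (rule smooth_map_linear[OF bounded_linear_right_mult])
  have diff: "diffeomorphism (V.coset q) (V.coset (q ** flow_elem r)) (flow T r)" if "q \<in> sol_group" for q r
  proof (rule diffeomorphismI[OF lin lin])
    have q': "q ** flow_elem r \<in> sol_group" using that flow_elem_in_sol sol_group_mult by blast
    have "q ** flow_elem r ** flow_elem (- r) = q" using flow_inverse(2)[of r q] by (simp add: flow_eq)
    then show "flow T (- r) ` V.coset (q ** flow_elem r) \<subseteq> V.coset q" using im[OF q', of "- r"] by simp
  qed (use im[OF that] flow_inverse in auto)
  have le: "riem_volume TYPE('n) (V.coset q) metric_S A \<le>
      riem_volume TYPE('n) (V.coset (q ** flow_elem r)) metric_S (flow T r ` A)"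
    if "q \<in> sol_group" "A \<subseteq> V.coset q" for q r A
    by (rule riem_volume_mono_diffeomorphism[OF diff[OF that(1)] that(2)])
      (rule det_gram_flow[OF assms(1-6) that(1)])
  show ?thesis
    unfolding volume_preserving_def
  proof (intro conjI ballI impI antisym)
    show "diffeomorphism (V.coset p) (V.coset (p ** flow_elem s)) (flow T s)" by (rule diff[OF p])
    fix A assume A: "A \<subseteq> V.coset p"
    then show "riem_volume TYPE('n) (V.coset p) metric_S A \<le>
        riem_volume TYPE('n) (V.coset (p ** flow_elem s)) metric_S (flow T s ` A)"
      by (rule le[OF p])
    have "flow T s ` A \<subseteq> V.coset (p ** flow_elem s)" using A im[OF p] by blast
    \<comment> \<open>The reverse inequality is the same estimate for the flow at time - s, applied
      to the image of A.\<close>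
    moreover have "flow T (- s) ` flow T s ` A = A" by (simp add: image_image flow_inverse)
    ultimately show "riem_volume TYPE('n) (V.coset (p ** flow_elem s)) metric_S (flow T s ` A) \<le>
        riem_volume TYPE('n) (V.coset p) metric_S A"
      using le[OF p', of "flow T s ` A" "- s"] return by simp
  qed
qed

end

section \<open>The assertions for the leaves of the flow\<close>

context diagonal_frame
begin

lemma tangent_space_S_H_orthogonal: "X \<in> tangent_space (S_H H) (mat 1) \<Longrightarrow> inner_s T X = 0"
  unfolding S_H_eq_coset tangent_space_coset_self[OF sol_group_one] by (auto simp: W_def)

lemma leaves_equidistant:
  "equidistant group_S metric_S (flow T r ` S_H H) (flow T s ` S_H H)"
  unfolding flow_image_S_H group_S_eq by (intro equidistant_cosets flow_elem_in_sol)

lemma leaves_isometric: "riem_isometric (flow T s ` S_H H) metric_S (S_H H) metric_S"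
  unfolding flow_image_S_H unfolding S_H_eq_coset
  by (intro riem_isometric_cosets flow_elem_in_sol sol_group_one)

lemma leaves_foliation: "codim_one_foliation group_S {flow T s ` S_H H | s. True}"
  unfolding flow_image_S_H group_S_eq by (rule codim_one_foliation_leaves)

lemma volume_preserving_S:
  assumes "t1 = t3"
  shows "volume_preserving TYPE(8) group_S metric_S group_S metric_S (flow T s)"
  using volume_preserving_flow[where 'n = 8, OF assms sol_ideal_sol_algebra orthonormal_basis_sol _ order_refl
      _ sol_group_one, of s]
    card_bases by (auto simp: group_S_eq sol_coset sol_group_one flow_elem_in_sol)

lemma volume_preserving_leaves:
  assumes "t1 = t3"
  shows "volume_preserving TYPE(7) (flow T r ` S_H H) metric_S (flow T (r + s) ` S_H H) metric_S (flow T s)"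
  using volume_preserving_flow[where 'n = 7, OF assms sol_ideal_axioms orthonormal_basis_W _ subset_insertI
      _ flow_elem_in_sol, of r s]
    card_bases by (auto simp: flow_image_S_H flow_elem_add)

lemma leaves_minimal:
  assumes "t1 = t3"
  shows "minimal_hypersurface group_S metric_S (flow T s ` S_H H)"
  unfolding flow_image_S_H group_S_eq by (rule minimal_coset[OF assms flow_elem_in_sol])

end

theorem corollary1p2:
  fixes \<alpha> :: real and H T :: "complex ^ 3 ^ 3" and \<phi> :: "real \<Rightarrow> complex ^ 3 ^ 3 \<Rightarrow> complex ^ 3 ^ 3"
  assumes "\<alpha> \<in> {0..pi/2}"
  defines "H \<equiv> cos \<alpha> *\<^sub>R H\<^sub>0 + sin \<alpha> *\<^sub>R H\<^sub>1"
  defines "T \<equiv> sin \<alpha> *\<^sub>R H\<^sub>0 - cos \<alpha> *\<^sub>R H\<^sub>1"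
  defines "\<phi> \<equiv> flow T"
  shows "(\<forall>X\<in>tangent_space (S_H H) (mat 1). inner_s T X = 0) \<and>
         codim_one_foliation group_S {\<phi> s ` S_H H | s. True} \<and>
         (\<forall>r s. equidistant group_S metric_S (\<phi> r ` S_H H) (\<phi> s ` S_H H)) \<and>
         (\<forall>s. riem_isometric (\<phi> s ` S_H H) metric_S (S_H H) metric_S) \<and>
         (\<alpha> = 0 \<longrightarrow>
            damek_ricci_space (S_H H\<^sub>0) metric_S \<and>
            (\<forall>s. minimal_hypersurface group_S metric_S (\<phi> s ` S_H H)) \<and>
            (\<forall>s. riem_isometric (\<phi> s ` S_H H) metric_S (S_H H\<^sub>0) metric_S) \<and>
            (\<forall>s. volume_preserving TYPE(8) group_S metric_S group_S metric_S (\<phi> s)) \<and>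
            (\<forall>r s. volume_preserving TYPE(7)
               (\<phi> r ` S_H H) metric_S (\<phi> (r + s) ` S_H H) metric_S (\<phi> s)))"
proof -
  interpret F: diagonal_frame "sin \<alpha> / 2 - cos \<alpha> / (2 * sqrt 3)" "cos \<alpha> / sqrt 3"
    "- sin \<alpha> / 2 - cos \<alpha> / (2 * sqrt 3)" "cos \<alpha> / 2 + sin \<alpha> / (2 * sqrt 3)" "- sin \<alpha> / sqrt 3"
    "- cos \<alpha> / 2 + sin \<alpha> / (2 * sqrt 3)"
    by (rule diagonal_frame_angle)
  have H: "H = F.H" and T: "T = F.T"
    unfolding F.H_def F.T_def
    by (simp_all add: H_def T_def H\<^sub>0_def H\<^sub>1_def diag3_eq_tri tri_scaleR tri_add tri_diff)
  have "damek_ricci_space (S_H H\<^sub>0) metric_S \<and>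
      (\<forall>s. minimal_hypersurface group_S metric_S (\<phi> s ` S_H H)) \<and>
      (\<forall>s. riem_isometric (\<phi> s ` S_H H) metric_S (S_H H\<^sub>0) metric_S) \<and>
      (\<forall>s. volume_preserving TYPE(8) group_S metric_S group_S metric_S (\<phi> s)) \<and>
      (\<forall>r s. volume_preserving TYPE(7) (\<phi> r ` S_H H) metric_S (\<phi> (r + s) ` S_H H) metric_S (\<phi> s))"
    if \<alpha>: "\<alpha> = 0"
  proof -
    \<comment> \<open>Here T is the negative of \<open>H\<^sub>1\<close>, with diagonal (-1, 2, -1)
      / (2 sqrt 3), so its first and third entries agree.\<close>
    have t: "sin \<alpha> / 2 - cos \<alpha> / (2 * sqrt 3) = - sin \<alpha> / 2 - cos \<alpha> / (2 * sqrt 3)" by (simp add: \<alpha>)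
    have H0: "H\<^sub>0 = F.H" unfolding H[symmetric] by (simp add: \<alpha> H_def)
    have "F.W = {tri (s / 2) 0 (- s / 2) x y z | s x y z. True}"
      unfolding F.W_eq by (simp add: \<alpha>)
    then have "damek_ricci_space (S_H F.H) metric_S"
      unfolding F.S_H_eq_tri_group by (rule F.damek_ricci_tri_group)
    then show ?thesis
      unfolding \<phi>_def T unfolding H0 H
      using F.leaves_minimal[OF t] F.leaves_isometric F.volume_preserving_S[OF t]
        F.volume_preserving_leaves[OF t] by blast
  qed
  then show ?thesis
    unfolding \<phi>_def T H
    using F.tangent_space_S_H_orthogonal F.leaves_foliation F.leaves_equidistant F.leaves_isometric by blast
qed

end
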